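(* Consider the $N$-player stochastic differential game with singular controls described in the context, with data $(\Omega,\mathcal F,\mathbb F,\mathbb P)$, $W^i$, $L$, $f^i$, $h^i$, $g^i$, $\mu^i$, $\sigma^i$, $x_0^i$. Assume that, for each $i=1,\dots,N$: (a) for $\phi^i\in\{h^i,g^i\}$: for each $(l,x^{-i})\in\mathbb R^k\times\mathbb R^{N-1}$ the function $\phi^i(l,\cdot,x^{-i})$ is lower semi-continuous, strictly convex, and submodular on $\mathbb R$ (i.e. $\phi^i(l,\bar x^i,x^{-i})+\phi^i(l,x^i,x^{-i})\ge\phi^i(l,\bar x^i\wedge x^i,x^{-i})+\phi^i(l,\bar x^i\vee x^i,x^{-i})$); and for each $l\in\mathbb R^k$ and all $x,\bar x\in\mathbb R^N$ with $\bar x\ge x$ componentwise, $\phi^i(l,\bar x^i,x^{-i})-\phi^i(l,x^i,x^{-i})\ge\phi^i(l,\bar x^i,\bar x^{-i})-\phi^i(l,x^i,\bar x^{-i})$; (b) there exist functions $\widetilde H^i,\widetilde G^i:\mathbb R^k\times\mathbb R\to[0,\infty)$ such that $h^i(l,x^i,x^{-i})\le\widetilde H^i(l,x^i)$ and $g^i(l,x^i,x^{-i})\le\widetilde G^i(l,x^i)$ for each $(l,x)\in\mathbb R^k\times\mathbb R^N$, with $$\mathbb E\Big[\int_0^T\widetilde H^i(L_t,x_0^iE_t^i)\,dt+\widetilde G^i(L_T,x_0^iE_T^i)\Big]<\infty,\qquad E_t^i:=\exp\Big[\Big(\mu^i-\frac{(\sigma^i)^2}{2}\Big)t+\sigma^iW_t^i\Big];$$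 (c) there is a constant $k_1>0$, independent of $i$, such that $g^i(l,x)\ge k_1x^i$ for each $(l,x)\in\mathbb R^k\times\mathbb R^N$. Then there exists an open-loop Nash equilibrium of this stochastic differential game.
   Context: Let $N\ge2$ be an integer, $k\in\mathbb N$, $T\in(0,\infty)$. $(\Omega,\mathcal F,\mathbb F,\mathbb P)$ is a filtered probability space satisfying the usual conditions, carrying $N$ standard $\mathbb F$-Brownian motions $W^1,\dots,W^N$. For $i=1,\dots,N$: $g^i,h^i:\mathbb R^k\times\mathbb R^N\to[0,\infty)$ are measurable, $\mu^i,\sigma^i\in\mathbb R$, $x_0^i>0$, and $f^i:\Omega\times[0,T]\to[0,\infty)$ are continuous $\mathbb F$-adapted processes. $L:\Omega\times[0,T]\to\mathbb R^k$ is an $\mathbb F$-adapted process with càdlàg components. For $x\in\mathbb R^N$, $x^{-i}:=(x^j)_{j\ne i}$. The set of admissible strategies $\mathcal A$ is the set of nondecreasing, nonnegative, càdlàg, $\mathbb F$-adapted, $\mathbb R$-valued processes; $\mathcal A^N$ is its $N$-fold product. Player $i$ chooses $\xi^i\in\mathcal A$ to control $$dX_t^i=\mu^iX_t^i\,dt+\sigma^iX_t^i\,dW_t^i+d\xi_t^i,\quad t\in[0,T],\qquad X_{0-}^i=x_0^i,$$ whose solution is $X_t^i=E_t^i\big[x_0^i+\int_{[0,t]}\frac{1}{E_s^i}\,d\xi_s^i\big]$, in order to minimize $$\mathcal J^i(\xi^i,\xi^{-i}):=\mathbb E\Big[\int_0^Th^i(L_t,X_t^i,X_t^{-i})\,dt+g^i(L_T,X_T^i,X_T^{-i})+\int_{[0,T]}f_t^i\,d\xi_t^i\Big].$$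 Integrals over $[0,t]$ include the initial jump: $\int_{[0,t]}\varphi_s\,d\xi_s:=\varphi_0\xi_0+\int_{(0,t]}\varphi_s\,d\xi_s$ (Lebesgue–Stieltjes). An open-loop Nash equilibrium is $\hat\xi\in\mathcal A^N$ such that, for every $i=1,\dots,N$, $\mathcal J^i(\hat\xi)<\infty$ and $\mathcal J^i(\hat\xi^i,\hat\xi^{-i})\le\mathcal J^i(\xi^i,\hat\xi^{-i})$ for every $\xi^i\in\mathcal A$. *)

theory Defs
  imports "HOL-Probability.Probability"
begin

text \<open>
  Players are indexed by a finite type \<open>'n\<close>. A process is a function of time and scenario,
  \<open>X t \<omega>\<close>, of which only the restriction to \<open>t \<in> {0..T}\<close> matters. "Continuous" and "cadlag"
  refer to every path.
\<close>

section \<open>Processes\<close>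

text \<open>
  The filtration lives on the compact time set \<open>{0..T}\<close>, whence the library locale
  \<open>filtration\<close>, which is indexed by a full type, is not used. Right-continuity is a condition
  on \<open>[0,T)\<close> only. The last clause makes \<open>M\<close> complete and puts all null sets into \<open>F 0\<close>.
\<close>

definition usual_filtration :: "'w measure \<Rightarrow> real \<Rightarrow> (real \<Rightarrow> 'w measure) \<Rightarrow> bool" where
  "usual_filtration M T F \<longleftrightarrow>
     (\<forall>t\<in>{0..T}. subalgebra M (F t)) \<and>
     (\<forall>s t. 0 \<le> s \<and> s \<le> t \<and> t \<le> T \<longrightarrow> sets (F s) \<subseteq> sets (F t)) \<and>
     (\<forall>t\<in>{0..<T}. sets (F t) = (\<Inter>s\<in>{t<..T}. sets (F s))) \<and>
     (\<forall>A\<in>null_sets M. \<forall>B\<subseteq>A. B \<in> sets (F 0))"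

definition adapted ::
    "real \<Rightarrow> (real \<Rightarrow> 'w measure) \<Rightarrow> (real \<Rightarrow> 'w \<Rightarrow> 'b::topological_space) \<Rightarrow> bool" where
  "adapted T F X \<longleftrightarrow> (\<forall>t\<in>{0..T}. X t \<in> borel_measurable (F t))"

definition cadlag_on :: "real \<Rightarrow> (real \<Rightarrow> real) \<Rightarrow> bool" where
  "cadlag_on T x \<longleftrightarrow>
     (\<forall>t\<in>{0..<T}. (x \<longlongrightarrow> x t) (at_right t)) \<and>
     (\<forall>t\<in>{0<..T}. \<exists>l. (x \<longlongrightarrow> l) (at_left t))"

definition brownian_motion ::
    "'w measure \<Rightarrow> real \<Rightarrow> (real \<Rightarrow> 'w measure) \<Rightarrow> (real \<Rightarrow> 'w \<Rightarrow> real) \<Rightarrow> bool" where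
  "brownian_motion M T F W \<longleftrightarrow>
     adapted T F W \<and>
     (\<forall>\<omega>\<in>space M. continuous_on {0..T} (\<lambda>t. W t \<omega>)) \<and>
     (AE \<omega> in M. W 0 \<omega> = 0) \<and>
     (\<forall>s t. 0 \<le> s \<and> s < t \<and> t \<le> T \<longrightarrow>
        distributed M lborel (\<lambda>\<omega>. W t \<omega> - W s \<omega>) (normal_density 0 (sqrt (t - s))) \<and>
        prob_space.indep_set M (sets (F s))
          (sets (vimage_algebra (space M) (\<lambda>\<omega>. W t \<omega> - W s \<omega>) borel)))"

text \<open>
  \<open>\<phi> 0 * \<xi> 0\<close> is the contribution of the initial jump (convention \<open>\<xi>\<^sub>0\<^sub>- = 0\<close>). As
  \<open>interval_measure\<close> needs a nondecreasing right-continuous function on the whole line, the path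
  is extended from \<open>[0,T]\<close> by constants.
\<close>

definition stieltjes_integral :: "real \<Rightarrow> (real \<Rightarrow> real) \<Rightarrow> (real \<Rightarrow> real) \<Rightarrow> real \<Rightarrow> real" where
  "stieltjes_integral T \<phi> \<xi> t =
     \<phi> 0 * \<xi> 0 + (LINT s:{0<..t}|interval_measure (\<lambda>s. \<xi> (max 0 (min s T))). \<phi> s)"

section \<open>The game\<close>

definition admissible ::
    "'w measure \<Rightarrow> real \<Rightarrow> (real \<Rightarrow> 'w measure) \<Rightarrow> (real \<Rightarrow> 'w \<Rightarrow> real) set" where
  "admissible M T F = {\<xi>. adapted T F \<xi> \<and>
     (\<forall>\<omega>\<in>space M. mono_on {0..T} (\<lambda>t. \<xi> t \<omega>) \<and> (\<forall>t\<in>{0..T}. 0 \<le> \<xi> t \<omega>) \<and>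
        cadlag_on T (\<lambda>t. \<xi> t \<omega>))}"

definition geom_bm :: "real \<Rightarrow> real \<Rightarrow> (real \<Rightarrow> 'w \<Rightarrow> real) \<Rightarrow> real \<Rightarrow> 'w \<Rightarrow> real" where
  "geom_bm \<mu> \<sigma> W t \<omega> = exp ((\<mu> - \<sigma>\<^sup>2 / 2) * t + \<sigma> * W t \<omega>)"

text \<open>
  The solution of \<open>dX\<^sub>t = \<mu> X\<^sub>t dt + \<sigma> X\<^sub>t dW\<^sub>t + d\<xi>\<^sub>t\<close>, \<open>X\<^sub>0\<^sub>- = x0\<close>, given by variation of constants.
\<close>

definition controlled_state ::
    "real \<Rightarrow> real \<Rightarrow> real \<Rightarrow> real \<Rightarrow> (real \<Rightarrow> 'w \<Rightarrow> real) \<Rightarrow> (real \<Rightarrow> 'w \<Rightarrow> real)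
       \<Rightarrow> real \<Rightarrow> 'w \<Rightarrow> real" where
  "controlled_state T \<mu> \<sigma> x0 W \<xi> t \<omega> =
     geom_bm \<mu> \<sigma> W t \<omega> *
       (x0 + stieltjes_integral T (\<lambda>s. 1 / geom_bm \<mu> \<sigma> W s \<omega>) (\<lambda>s. \<xi> s \<omega>) t)"

definition state_vector ::
    "real \<Rightarrow> ('n \<Rightarrow> real) \<Rightarrow> ('n \<Rightarrow> real) \<Rightarrow> ('n \<Rightarrow> real) \<Rightarrow> ('n \<Rightarrow> real \<Rightarrow> 'w \<Rightarrow> real)
       \<Rightarrow> ('n \<Rightarrow> real \<Rightarrow> 'w \<Rightarrow> real) \<Rightarrow> real \<Rightarrow> 'w \<Rightarrow> real ^ 'n" where
  "state_vector T \<mu> \<sigma> x0 W \<xi> t \<omega> =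
     (\<chi> j. controlled_state T (\<mu> j) (\<sigma> j) (x0 j) (W j) (\<xi> j) t \<omega>)"

text \<open>
  All costs are nonnegative, so the expected cost is an extended nonnegative real. The integral of
  \<open>f i\<close> is pathwise finite, since \<open>f i\<close> has continuous paths on the compact interval.
\<close>

definition expected_cost ::
    "'w measure \<Rightarrow> real \<Rightarrow> ('n \<Rightarrow> real) \<Rightarrow> ('n \<Rightarrow> real) \<Rightarrow> ('n \<Rightarrow> real)
       \<Rightarrow> ('n \<Rightarrow> real \<Rightarrow> 'w \<Rightarrow> real) \<Rightarrow> (real \<Rightarrow> 'w \<Rightarrow> real ^ 'k)
       \<Rightarrow> ('n \<Rightarrow> real \<Rightarrow> 'w \<Rightarrow> real)
       \<Rightarrow> ('n \<Rightarrow> real ^ 'k \<Rightarrow> real ^ 'n \<Rightarrow> real) \<Rightarrow> ('n \<Rightarrow> real ^ 'k \<Rightarrow> real ^ 'n \<Rightarrow> real)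
       \<Rightarrow> 'n \<Rightarrow> ('n \<Rightarrow> real \<Rightarrow> 'w \<Rightarrow> real) \<Rightarrow> ennreal" where
  "expected_cost M T \<mu> \<sigma> x0 W L f h g i \<xi> =
     (\<integral>\<^sup>+\<omega>.
        (\<integral>\<^sup>+t\<in>{0..T}. ennreal (h i (L t \<omega>) (state_vector T \<mu> \<sigma> x0 W \<xi> t \<omega>)) \<partial>lborel)
        + ennreal (g i (L T \<omega>) (state_vector T \<mu> \<sigma> x0 W \<xi> T \<omega>))
        + ennreal (stieltjes_integral T (\<lambda>s. f i s \<omega>) (\<lambda>s. \<xi> i s \<omega>) T) \<partial>M)"

definition open_loop_nash :: "'s set \<Rightarrow> ('n \<Rightarrow> ('n \<Rightarrow> 's) \<Rightarrow> ennreal) \<Rightarrow> ('n \<Rightarrow> 's) \<Rightarrow> bool" where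
  "open_loop_nash A J \<xi> \<longleftrightarrow>
     (\<forall>i. \<xi> i \<in> A) \<and>
     (\<forall>i. J i \<xi> < \<infinity> \<and> (\<forall>\<eta>\<in>A. J i \<xi> \<le> J i (\<xi>(i := \<eta>))))"

section \<open>Structural conditions on the costs\<close>

definition lower_semicontinuous :: "(real \<Rightarrow> real) \<Rightarrow> bool" where
  "lower_semicontinuous \<phi> \<longleftrightarrow> (\<forall>x. \<forall>c<\<phi> x. \<forall>\<^sub>F y in nhds x. c < \<phi> y)"

definition strictly_convex :: "(real \<Rightarrow> real) \<Rightarrow> bool" where
  "strictly_convex \<phi> \<longleftrightarrow>
     (\<forall>x y u. x \<noteq> y \<and> 0 < u \<and> u < 1 \<longrightarrow>
        \<phi> ((1 - u) * x + u * y) < (1 - u) * \<phi> x + u * \<phi> y)"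

definition submodular :: "(real \<Rightarrow> real) \<Rightarrow> bool" where
  "submodular \<phi> \<longleftrightarrow> (\<forall>x y. \<phi> (min y x) + \<phi> (max y x) \<le> \<phi> y + \<phi> x)"

text \<open>\<open>repl x i a\<close> is the vector \<open>(a, x\<^sup>-\<^sup>i)\<close> with \<open>i\<close>-th coordinate \<open>a\<close> and the others those of \<open>x\<close>.\<close>

definition repl :: "real ^ 'n \<Rightarrow> 'n \<Rightarrow> real \<Rightarrow> real ^ 'n" where
  "repl x i a = (\<chi> j. if j = i then a else x $ j)"

definition decreasing_differences :: "'n \<Rightarrow> (real ^ 'n \<Rightarrow> real) \<Rightarrow> bool" where
  "decreasing_differences i \<phi> \<longleftrightarrow>
     (\<forall>x y. (\<forall>j. x $ j \<le> y $ j) \<longrightarrow>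
        \<phi> y - \<phi> (repl y i (x $ i)) \<le> \<phi> (repl x i (y $ i)) - \<phi> x)"

definition submodular_cost :: "'n \<Rightarrow> (real ^ 'k \<Rightarrow> real ^ 'n \<Rightarrow> real) \<Rightarrow> bool" where
  "submodular_cost i \<phi> \<longleftrightarrow>
     (\<forall>l x. lower_semicontinuous (\<lambda>a. \<phi> l (repl x i a)) \<and>
            strictly_convex (\<lambda>a. \<phi> l (repl x i a)) \<and>
            submodular (\<lambda>a. \<phi> l (repl x i a))) \<and>
     (\<forall>l. decreasing_differences i (\<phi> l))"

end

theory Submission
  imports Defs
begin

text \<open>
  Discounting by the geometric Brownian motion \<open>E\<close> turns the control \<open>\<xi>\<close> into
  \<open>\<eta>\<^sub>t = \<integral>\<^bsub>[0,t]\<^esub> 1/E d\<xi>\<close>. This is a bijection of the set of strategies onto itself, with inverse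
  \<open>\<xi>\<^sub>t = \<integral>\<^bsub>[0,t]\<^esub> E d\<eta>\<close>; the state becomes \<open>E (x0 + \<eta>)\<close>, an increasing affine function of the value of
  \<open>\<eta>\<close> at the same time, and the cost of control becomes \<open>\<integral> f E d\<eta>\<close>, which is additive in \<open>\<eta>\<close>.
  In the variable \<open>\<eta>\<close> the game is therefore submodular for the order "\<open>a\<^sub>t \<le> b\<^sub>t\<close> for all \<open>t\<close>, almost
  surely": strategies have pointwise joins and meets, \<open>\<integral> f E d(a \<or> b) + \<integral> f E d(a \<and> b)\<close> equals
  \<open>\<integral> f E da + \<integral> f E db\<close>, and decreasing differences give the exchange inequality
  \<open>J i (a \<or> b, \<zeta>) + J i (a \<and> b, \<eta>) \<le> J i (a, \<eta>) + J i (b, \<zeta>)\<close> whenever the opponents satisfy \<open>\<eta> \<le> \<zeta>\<close>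
  (\<open>cost_exchange\<close>).

  Order also replaces compactness. Monotone sequences of strategies converge at all but countably
  many times and at \<open>T\<close>, and by Fatou's lemma the cost of a player is lower semicontinuous in the player's
  own strategy along such sequences (\<open>cost_limit_le\<close>). The lower bound \<open>g \<ge> k1 x\<close> bounds
  \<open>\<E> (E\<^sub>T \<eta>\<^sub>T)\<close> by the cost, and the cost of every best reply is at most the cost of doing nothing, which
  is bounded uniformly in the opponents; hence the increasing sequences that occur have finite
  suprema (\<open>terminal_size_bounded\<close>).

  From these facts the equilibrium is obtained abstractly, in the locale \<open>submodular_game\<close>. Best
  replies exist: joining near-minimisers adds up their errors, so the joins of the tails of a
  minimising sequence, and then the infimum over the tails, are again near-minimisers and finally a
  minimiser (\<open>best_reply_exists\<close>). By the exchange inequality a best reply to a smaller profile can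
  be joined to a best reply to a larger one without loss (\<open>best_reply_join\<close>). As in the
  Knaster-Tarski theorem one considers the profiles that lie below some of their own best replies.
  They are closed under suprema of increasing sequences (\<open>ascending_chain_upper\<close>), so one of them is
  maximal as measured by a bounded strictly increasing functional (\<open>ascending_maximal\<close>). A profile of
  best replies above the maximal one lies again below its own best replies, hence agrees
  with it almost surely, and the maximal profile is a Nash equilibrium (\<open>nash_exists\<close>).
\<close>

section \<open>Nash equilibria from order and semicontinuity\<close>

text \<open>
  An abstract game on a preordered set of strategies; the order is only a preorder because
  strategies will be compared almost surely. \<open>K\<close> is a size controlled by the cost, and its
  boundedness is what makes an increasing sequence have a least upper bound. The costs are required
  to be lower semicontinuous along monotone sequences in the player's own strategy only, so that the
  dependence on the opponents may be discontinuous. \<open>\<Phi>\<close> detects whether a larger strategy differs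
  from a smaller one in a way that matters to some cost.
\<close>

locale submodular_game =
  fixes A :: "'s set"
    and le :: "'s \<Rightarrow> 's \<Rightarrow> bool" (infix "\<sqsubseteq>" 50)
    and join meet :: "'s \<Rightarrow> 's \<Rightarrow> 's"
    and bottom :: 's
    and J :: "'n::finite \<Rightarrow> ('n \<Rightarrow> 's) \<Rightarrow> ennreal"
    and K :: "'n \<Rightarrow> 's \<Rightarrow> ennreal"
    and C :: "'n \<Rightarrow> ennreal"
    and \<Phi> :: "'s \<Rightarrow> real"
  assumes le_refl: "a \<sqsubseteq> a"
    and le_trans: "a \<sqsubseteq> b \<Longrightarrow> b \<sqsubseteq> c \<Longrightarrow> a \<sqsubseteq> c"
    and join_in: "a \<in> A \<Longrightarrow> b \<in> A \<Longrightarrow> join a b \<in> A"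
    and join_upper1: "a \<sqsubseteq> join a b"
    and join_upper2: "b \<sqsubseteq> join a b"
    and join_least: "a \<sqsubseteq> c \<Longrightarrow> b \<sqsubseteq> c \<Longrightarrow> join a b \<sqsubseteq> c"
    and meet_in: "a \<in> A \<Longrightarrow> b \<in> A \<Longrightarrow> meet a b \<in> A"
    and bottom_in: "bottom \<in> A"
    and bottom_le: "a \<in> A \<Longrightarrow> bottom \<sqsubseteq> a"
    and sup_exists: "\<And>a c i. (\<And>n. a n \<in> A) \<Longrightarrow> (\<And>n::nat. a n \<sqsubseteq> a (Suc n)) \<Longrightarrow>
          (\<And>n. K i (a n) \<le> c) \<Longrightarrow> c < \<infinity> \<Longrightarrow>
          \<exists>s\<in>A. (\<forall>n. a n \<sqsubseteq> s) \<and> (\<forall>b\<in>A. (\<forall>n. a n \<sqsubseteq> b) \<longrightarrow> s \<sqsubseteq> b) \<and>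
            (\<forall>\<eta> d. (\<forall>j. \<eta> j \<in> A) \<longrightarrow> (\<forall>n. J i (\<eta>(i := a n)) \<le> d) \<longrightarrow> J i (\<eta>(i := s)) \<le> d)"
    and inf_exists: "\<And>a i. (\<And>n. a n \<in> A) \<Longrightarrow> (\<And>n::nat. a (Suc n) \<sqsubseteq> a n) \<Longrightarrow>
          \<exists>s\<in>A. \<forall>\<eta> d. (\<forall>j. \<eta> j \<in> A) \<longrightarrow> (\<forall>\<^sub>F n in sequentially. J i (\<eta>(i := a n)) \<le> d) \<longrightarrow>
            J i (\<eta>(i := s)) \<le> d"
    and submod: "\<And>\<eta> \<zeta> a b i. (\<And>j. \<eta> j \<in> A) \<Longrightarrow> (\<And>j. \<zeta> j \<in> A) \<Longrightarrow> (\<And>j. \<eta> j \<sqsubseteq> \<zeta> j) \<Longrightarrow>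
          a \<in> A \<Longrightarrow> b \<in> A \<Longrightarrow>
          J i (\<zeta>(i := join a b)) + J i (\<eta>(i := meet a b)) \<le> J i (\<eta>(i := a)) + J i (\<zeta>(i := b))"
    and J_bottom: "\<And>\<eta> i. (\<And>j. \<eta> j \<in> A) \<Longrightarrow> J i (\<eta>(i := bottom)) \<le> C i"
    and C_finite: "C i < \<infinity>"
    and K_le_J: "\<And>\<eta> a i. (\<And>j. \<eta> j \<in> A) \<Longrightarrow> a \<in> A \<Longrightarrow> K i a \<le> J i (\<eta>(i := a))"
    and K_mono: "a \<in> A \<Longrightarrow> b \<in> A \<Longrightarrow> a \<sqsubseteq> b \<Longrightarrow> K i a \<le> K i b"
    and \<Phi>_mono: "a \<in> A \<Longrightarrow> b \<in> A \<Longrightarrow> a \<sqsubseteq> b \<Longrightarrow> \<Phi> a \<le> \<Phi> b"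
    and \<Phi>_bounded: "a \<in> A \<Longrightarrow> \<Phi> a \<le> 2"
    and \<Phi>_strict: "\<And>\<eta> a b i. (\<And>j. \<eta> j \<in> A) \<Longrightarrow> a \<in> A \<Longrightarrow> b \<in> A \<Longrightarrow> a \<sqsubseteq> b \<Longrightarrow> \<Phi> b \<le> \<Phi> a \<Longrightarrow>
          J i (\<eta>(i := a)) = J i (\<eta>(i := b))"
begin

abbreviation profile :: "('n \<Rightarrow> 's) \<Rightarrow> bool" where
  "profile \<eta> \<equiv> \<forall>j. \<eta> j \<in> A"

abbreviation profile_le :: "('n \<Rightarrow> 's) \<Rightarrow> ('n \<Rightarrow> 's) \<Rightarrow> bool" where
  "profile_le \<eta> \<zeta> \<equiv> \<forall>j. \<eta> j \<sqsubseteq> \<zeta> j"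

definition best_reply :: "'n \<Rightarrow> ('n \<Rightarrow> 's) \<Rightarrow> 's \<Rightarrow> bool" where
  "best_reply i \<eta> a \<longleftrightarrow> a \<in> A \<and> (\<forall>b\<in>A. J i (\<eta>(i := a)) \<le> J i (\<eta>(i := b)))"

lemma best_reply_cost: "profile \<eta> \<Longrightarrow> best_reply i \<eta> a \<Longrightarrow> J i (\<eta>(i := a)) \<le> C i"
  using J_bottom bottom_in unfolding best_reply_def by (meson order_trans)

text \<open>
  If \<open>a\<close> and \<open>b\<close> are within \<open>\<alpha>\<close> and \<open>\<beta>\<close> of the infimum, then their join is within \<open>\<alpha> + \<beta>\<close> of it, since
  the meet cannot go below the infimum. Starting from strategies \<open>x n\<close> with errors \<open>2\<^sup>-\<^sup>n\<close>, the join of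
  all \<open>x m\<close> with \<open>m \<ge> n\<close> has error at most \<open>2 / 2\<^sup>n\<close>. These joins decrease in \<open>n\<close>, and the infimum of
  them has error zero.
\<close>

lemma best_reply_exists:
  assumes \<eta>: "profile \<eta>"
  shows "\<exists>a. best_reply i \<eta> a"
proof -
  define I where "I a = J i (\<eta>(i := a))" for a
  define v where "v = (INF a\<in>A. I a)"
  have v_le: "v \<le> I a" if "a \<in> A" for a
    unfolding v_def using that by (rule INF_lower)
  have "v \<le> C i"
    using v_le[OF bottom_in] J_bottom[of \<eta> i] \<eta> unfolding I_def by auto
  hence v_fin: "v < \<infinity>"
    using C_finite order_le_less_trans by blast
  have "\<exists>a\<in>A. I a \<le> v + ennreal ((1/2) ^ n)" for n
  proof -
    have "v < v + ennreal ((1/2) ^ n)"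
      using v_fin by (cases v) (auto simp: ennreal_less_iff simp flip: ennreal_plus)
    then show ?thesis
      unfolding v_def INF_less_iff by (blast intro: less_imp_le)
  qed
  then obtain x where x: "x n \<in> A" "I (x n) \<le> v + ennreal ((1/2) ^ n)" for n
    by metis
  have near_join: "I (join a b) \<le> v + ennreal (\<alpha> + \<beta>)"
    if "a \<in> A" "b \<in> A" "I a \<le> v + ennreal \<alpha>" "I b \<le> v + ennreal \<beta>" "0 \<le> \<alpha>" "0 \<le> \<beta>" for a b \<alpha> \<beta>
  proof -
    have "v + I (join a b) \<le> I (join a b) + I (meet a b)"
      using v_le[OF meet_in[OF that(1,2)]] by (simp add: add.commute add_left_mono)
    also have "\<dots> \<le> I a + I b"
      unfolding I_def using that \<eta> by (intro submod) (auto simp: le_refl)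
    also have "\<dots> \<le> (v + ennreal \<alpha>) + (v + ennreal \<beta>)"
      using that by (intro add_mono)
    also have "\<dots> = v + (v + ennreal (\<alpha> + \<beta>))"
      using that by (simp add: ennreal_plus ac_simps)
    finally show ?thesis
      using v_fin by (subst (asm) ennreal_add_left_cancel_le) auto
  qed
  \<comment> \<open>\<open>s n m\<close> is the join of \<open>x n, \<dots>, x (n + m)\<close>; its error is a partial geometric sum.\<close>
  define s where "s n m = rec_nat (x n) (\<lambda>m y. join y (x (n + Suc m))) m" for n m
  have s_0: "s n 0 = x n" and s_Suc: "s n (Suc m) = join (s n m) (x (n + Suc m))" for n m
    by (simp_all add: s_def)
  have s_in: "s n m \<in> A" for n m
    by (induction m) (auto simp: s_0 s_Suc x join_in)
  have geom: "(1/2::real) ^ (n + m) \<le> 2 * (1/2) ^ n" for n m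
  proof -
    have "(1/2::real) ^ (n + m) \<le> (1/2) ^ n" by (rule power_decreasing) auto
    also have "\<dots> \<le> 2 * (1/2) ^ n" by simp
    finally show ?thesis .
  qed
  have s_cost: "I (s n m) \<le> v + ennreal (2 * (1/2) ^ n - (1/2) ^ (n + m))" for n m
  proof (induction m)
    case 0
    then show ?case using x(2)[of n] by (simp add: s_0)
  next
    case (Suc m)
    have "I (s n (Suc m)) \<le> v + ennreal ((2 * (1/2) ^ n - (1/2) ^ (n + m)) + (1/2) ^ (n + Suc m))"
      unfolding s_Suc using geom[of n m] by (intro near_join s_in x Suc) auto
    then show ?case by (simp add: field_simps)
  qed
  have s_cost': "I (s n m) \<le> v + ennreal (2 * (1/2) ^ n)" for n m
    by (rule order_trans[OF s_cost]) (intro add_left_mono ennreal_leI, simp)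
  \<comment> \<open>\<open>t n\<close> is the join of the whole tail. It decreases in \<open>n\<close> because it is a least upper bound.\<close>
  have "\<exists>t\<in>A. (\<forall>m. s n m \<sqsubseteq> t) \<and> (\<forall>b\<in>A. (\<forall>m. s n m \<sqsubseteq> b) \<longrightarrow> t \<sqsubseteq> b) \<and>
      I t \<le> v + ennreal (2 * (1/2) ^ n)" for n
  proof -
    have "K i (s n m) \<le> v + ennreal (2 * (1/2) ^ n)" for m
      using K_le_J[of \<eta> "s n m" i] \<eta> s_in s_cost' unfolding I_def by (meson order_trans)
    moreover have "s n m \<sqsubseteq> s n (Suc m)" for m
      by (simp add: s_Suc join_upper1)
    ultimately show ?thesis
      using sup_exists[of "s n" i "v + ennreal (2 * (1/2) ^ n)"] s_in s_cost' \<eta> v_fin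
      unfolding I_def by (auto simp: ennreal_add_less_top)
  qed
  then obtain t where t_in: "t n \<in> A" and t_upper: "s n m \<sqsubseteq> t n"
    and t_least: "b \<in> A \<Longrightarrow> (\<And>m. s n m \<sqsubseteq> b) \<Longrightarrow> t n \<sqsubseteq> b"
    and t_cost: "I (t n) \<le> v + ennreal (2 * (1/2) ^ n)" for n m b
    by metis
  have x_le_t: "x (n + m) \<sqsubseteq> t n" for n m
  proof (cases m)
    case 0
    then show ?thesis using t_upper[of n 0] by (simp add: s_0)
  next
    case (Suc k)
    then show ?thesis
      using le_trans[OF join_upper2 t_upper[of n "Suc k", unfolded s_Suc]] by simp
  qed
  have "t (Suc n) \<sqsubseteq> t n" for n
  proof (rule t_least[OF t_in])
    show "s (Suc n) m \<sqsubseteq> t n" for m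
    proof (induction m)
      case 0
      then show ?case using x_le_t[of n 1] by (simp add: s_0)
    next
      case (Suc m)
      then show ?case using x_le_t[of n "Suc (Suc m)"] by (simp add: s_Suc join_least)
    qed
  qed
  then obtain a where a: "a \<in> A"
    and a_cost: "\<And>d. (\<forall>\<^sub>F n in sequentially. I (t n) \<le> d) \<Longrightarrow> I a \<le> d"
    using inf_exists[of t i] t_in \<eta> unfolding I_def by blast
  have "I a \<le> v"
  proof (rule ennreal_le_epsilon)
    fix e :: real assume "e > 0"
    have "(\<lambda>n. 2 * (1/2::real) ^ n) \<longlonglongrightarrow> 2 * 0"
      by (intro tendsto_intros) auto
    then have "\<forall>\<^sub>F n in sequentially. 2 * (1/2::real) ^ n < e"
      using \<open>e > 0\<close> order_tendstoD(2) by fastforce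
    then have "\<forall>\<^sub>F n in sequentially. I (t n) \<le> v + ennreal e"
      by eventually_elim (rule order_trans[OF t_cost], intro add_left_mono ennreal_leI, simp)
    then show "I a \<le> v + ennreal e" by (rule a_cost)
  qed
  then show ?thesis
    using a v_le unfolding best_reply_def I_def by (meson order_trans)
qed

text \<open>
  Passing from \<open>b\<close> to the join against \<open>\<zeta>\<close> costs at most what is gained by passing from \<open>a\<close> to the
  meet against \<open>\<eta>\<close>, and nothing can be gained there because \<open>a\<close> is optimal against \<open>\<eta>\<close>.
\<close>

lemma best_reply_join:
  assumes "profile \<eta>" "profile \<zeta>" "profile_le \<eta> \<zeta>" "best_reply i \<eta> a" "best_reply i \<zeta> b"
  shows "best_reply i \<zeta> (join a b)"
proof -
  have in_A: "a \<in> A" "b \<in> A" using assms by (auto simp: best_reply_def)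
  have fin: "J i (\<eta>(i := a)) < \<infinity>"
    using best_reply_cost[OF assms(1,4)] C_finite order_le_less_trans by blast
  have "J i (\<eta>(i := a)) + J i (\<zeta>(i := join a b)) \<le> J i (\<zeta>(i := join a b)) + J i (\<eta>(i := meet a b))"
    using assms(4) meet_in[OF in_A] unfolding best_reply_def
    by (subst add.commute, intro add_left_mono) auto
  also have "\<dots> \<le> J i (\<eta>(i := a)) + J i (\<zeta>(i := b))"
    using assms in_A by (intro submod) auto
  finally have "J i (\<zeta>(i := join a b)) \<le> J i (\<zeta>(i := b))"
    using fin by (subst (asm) ennreal_add_left_cancel_le) auto
  then show ?thesis
    using assms(5) join_in[OF in_A] unfolding best_reply_def by (meson order_trans)
qed

text \<open>
  The analogue of the post-fixed points in the Knaster-Tarski theorem, for a best-reply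
  correspondence that may have several values.
\<close>

definition ascending :: "('n \<Rightarrow> 's) \<Rightarrow> bool" where
  "ascending \<eta> \<longleftrightarrow> profile \<eta> \<and> (\<forall>i. \<exists>b. best_reply i \<eta> b \<and> \<eta> i \<sqsubseteq> b)"

text \<open>
  The costs need not be continuous in the opponents, so limits of best replies \<open>b n\<close> to the members of
  the chain need not be best replies to its supremum \<open>\<zeta>\<close>. Instead the \<open>b n\<close> are joined one after the
  other to a best reply to \<open>\<zeta>\<close>, which by \<open>best_reply_join\<close> yields an increasing sequence of best
  replies to the same profile \<open>\<zeta>\<close>; its supremum is a best reply that dominates every \<open>b n\<close>.
\<close>

lemma ascending_chain_upper:
  assumes asc: "\<And>n. ascending (\<eta> n)" and chain: "\<And>n::nat. profile_le (\<eta> n) (\<eta> (Suc n))"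
  shows "\<exists>\<zeta>. ascending \<zeta> \<and> (\<forall>n. profile_le (\<eta> n) \<zeta>)"
proof -
  have prof: "profile (\<eta> n)" for n using asc by (simp add: ascending_def)
  obtain b where b: "best_reply i (\<eta> n) (b n i)" "\<eta> n i \<sqsubseteq> b n i" for n i
    using asc unfolding ascending_def by metis
  have b_in: "b n i \<in> A" for n i using b by (auto simp: best_reply_def)
  have "K i (\<eta> n i) \<le> C i" for n i
  proof -
    have "K i (\<eta> n i) \<le> K i (b n i)" using prof b_in b by (intro K_mono) auto
    also have "\<dots> \<le> J i ((\<eta> n)(i := b n i))" using prof b_in by (intro K_le_J) auto
    also have "\<dots> \<le> C i" using prof b by (intro best_reply_cost) auto
    finally show ?thesis .
  qed
  then have "\<exists>s\<in>A. (\<forall>n. \<eta> n i \<sqsubseteq> s) \<and> (\<forall>b\<in>A. (\<forall>n. \<eta> n i \<sqsubseteq> b) \<longrightarrow> s \<sqsubseteq> b)" for i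
    using sup_exists[of "\<lambda>n. \<eta> n i" i "C i"] prof chain C_finite by blast
  then obtain \<zeta> where \<zeta>: "\<zeta> i \<in> A" "\<eta> n i \<sqsubseteq> \<zeta> i"
    and \<zeta>_least: "c \<in> A \<Longrightarrow> (\<And>n. \<eta> n i \<sqsubseteq> c) \<Longrightarrow> \<zeta> i \<sqsubseteq> c" for i n c
    by metis
  have "\<exists>c. best_reply i \<zeta> c \<and> \<zeta> i \<sqsubseteq> c" for i
  proof -
    obtain c0 where c0: "best_reply i \<zeta> c0" using best_reply_exists \<zeta>(1) by blast
    define c where "c n = rec_nat c0 (\<lambda>n y. join (b n i) y) n" for n
    have c_Suc: "c (Suc n) = join (b n i) (c n)" for n by (simp add: c_def)
    have c_best: "best_reply i \<zeta> (c n)" for n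
    proof (induction n)
      case 0
      then show ?case by (simp add: c_def c0)
    next
      case (Suc n)
      then show ?case
        unfolding c_Suc using prof \<zeta> b by (intro best_reply_join[of "\<eta> n"]) auto
    qed
    have c_in: "c n \<in> A" for n using c_best by (auto simp: best_reply_def)
    have cost: "J i (\<zeta>(i := c n)) = J i (\<zeta>(i := c0))" for n
      using c_best[of n] c0 by (auto simp: best_reply_def intro: antisym)
    have "K i (c n) \<le> C i" for n
      using K_le_J[of \<zeta> "c n" i] best_reply_cost[OF _ c_best, of n] \<zeta>(1) c_in
      by (meson order_trans)
    then obtain s where s: "s \<in> A" "\<And>n. c n \<sqsubseteq> s" "J i (\<zeta>(i := s)) \<le> J i (\<zeta>(i := c0))"
      using sup_exists[of c i "C i"] c_in C_finite \<zeta>(1) cost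
      by (metis (no_types, lifting) c_Suc join_upper2 order_refl)
    have "best_reply i \<zeta> s"
      using s c0 unfolding best_reply_def by (meson order_trans)
    moreover have "\<eta> n i \<sqsubseteq> s" for n
      using b(2)[of n i] s(2)[of "Suc n"] join_upper1[of "b n i" "c n"] le_trans
      unfolding c_Suc by blast
    ultimately show ?thesis using \<zeta>_least[OF s(1)] by blast
  qed
  then show ?thesis using \<zeta> unfolding ascending_def by blast
qed

text \<open>
  The choice underlying the Brezis-Browder ordering principle: each step of the chain comes within
  \<open>1/n\<close> of the best value still reachable, so nothing above the limit of the chain is better.
\<close>

lemma ascending_maximal:
  "\<exists>\<zeta>. ascending \<zeta> \<and> (\<forall>\<eta>. ascending \<eta> \<longrightarrow> profile_le \<zeta> \<eta> \<longrightarrow> (\<Sum>i\<in>UNIV. \<Phi> (\<eta> i)) \<le> (\<Sum>i\<in>UNIV. \<Phi> (\<zeta> i)))"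
proof -
  define \<Psi> where "\<Psi> \<eta> = (\<Sum>i\<in>UNIV. \<Phi> (\<eta> i))" for \<eta> :: "'n \<Rightarrow> 's"
  define U where "U \<eta> = {\<zeta>. ascending \<zeta> \<and> profile_le \<eta> \<zeta>}" for \<eta>
  have \<Psi>_bdd: "bdd_above (\<Psi> ` U \<eta>)" for \<eta>
  proof (rule bdd_aboveI2)
    show "\<Psi> \<zeta> \<le> (\<Sum>i\<in>(UNIV::'n set). 2)" if "\<zeta> \<in> U \<eta>" for \<zeta>
      unfolding \<Psi>_def using that by (intro sum_mono \<Phi>_bounded) (auto simp: U_def ascending_def)
  qed
  have \<Psi>_mono: "\<Psi> \<eta> \<le> \<Psi> \<zeta>" if "ascending \<eta>" "ascending \<zeta>" "profile_le \<eta> \<zeta>" for \<eta> \<zeta>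
    unfolding \<Psi>_def using that by (intro sum_mono \<Phi>_mono) (auto simp: ascending_def)
  have step: "\<exists>\<zeta>. ascending \<zeta> \<and> (profile_le \<eta> \<zeta> \<and> (\<forall>\<theta>\<in>U \<eta>. \<Psi> \<theta> \<le> \<Psi> \<zeta> + 1 / Suc n))"
    if "ascending \<eta>" for \<eta> and n :: nat
  proof -
    have "U \<eta> \<noteq> {}" using that le_refl by (auto simp: U_def)
    then have "(SUP \<theta>\<in>U \<eta>. \<Psi> \<theta>) - 1 / Suc n < (SUP \<theta>\<in>U \<eta>. \<Psi> \<theta>)" "\<Psi> ` U \<eta> \<noteq> {}" by auto
    then obtain \<zeta> where "\<zeta> \<in> U \<eta>" "(SUP \<theta>\<in>U \<eta>. \<Psi> \<theta>) - 1 / Suc n < \<Psi> \<zeta>"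
      using less_cSUP_iff[OF \<open>U \<eta> \<noteq> {}\<close> \<Psi>_bdd] by blast
    moreover have "\<Psi> \<theta> \<le> (SUP \<theta>\<in>U \<eta>. \<Psi> \<theta>)" if "\<theta> \<in> U \<eta>" for \<theta>
      using that \<Psi>_bdd by (rule cSUP_upper)
    ultimately show ?thesis unfolding U_def by force
  qed
  have "ascending (\<lambda>_. bottom)"
    unfolding ascending_def
    using best_reply_exists[of "\<lambda>_. bottom"] bottom_in bottom_le best_reply_def by blast
  then have "\<exists>\<eta>. \<forall>n. ascending (\<eta> n) \<and> (profile_le (\<eta> n) (\<eta> (Suc n)) \<and>
      (\<forall>\<theta>\<in>U (\<eta> n). \<Psi> \<theta> \<le> \<Psi> (\<eta> (Suc n)) + 1 / Suc n))"
    by (intro dependent_nat_choice step) auto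
  then obtain \<eta> where \<eta>: "\<And>n. ascending (\<eta> n)"
    and next_le: "\<And>n. profile_le (\<eta> n) (\<eta> (Suc n))"
    and next_max: "\<And>n \<theta>. \<theta> \<in> U (\<eta> n) \<Longrightarrow> \<Psi> \<theta> \<le> \<Psi> (\<eta> (Suc n)) + 1 / Suc n"
    by blast
  obtain \<zeta> where \<zeta>: "ascending \<zeta>" "\<And>n. profile_le (\<eta> n) \<zeta>"
    using ascending_chain_upper[of \<eta>] \<eta> next_le by blast
  have "\<Psi> \<theta> \<le> \<Psi> \<zeta>" if "ascending \<theta>" "profile_le \<zeta> \<theta>" for \<theta>
  proof (rule LIMSEQ_le_const)
    show "(\<lambda>n. \<Psi> \<zeta> + 1 / real (Suc n)) \<longlonglongrightarrow> \<Psi> \<zeta>"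
      using tendsto_add[OF tendsto_const LIMSEQ_inverse_real_of_nat, of "\<Psi> \<zeta>"] by (simp add: field_simps)
    have "\<Psi> \<theta> \<le> \<Psi> \<zeta> + 1 / real (Suc n)" for n
    proof -
      have "\<theta> \<in> U (\<eta> n)" using that \<zeta> le_trans unfolding U_def by blast
      then show ?thesis using next_max \<Psi>_mono[OF \<eta> \<zeta>, of "Suc n"] by force
    qed
    then show "\<exists>N. \<forall>n\<ge>N. \<Psi> \<theta> \<le> \<Psi> \<zeta> + 1 / real (Suc n)" by blast
  qed
  then show ?thesis using \<zeta>(1) unfolding \<Psi>_def by blast
qed

lemma nash_exists: "\<exists>\<eta>. open_loop_nash A J \<eta>"
proof -
  obtain \<zeta> where \<zeta>: "ascending \<zeta>"
    and max: "\<And>\<eta>. ascending \<eta> \<Longrightarrow> profile_le \<zeta> \<eta> \<Longrightarrow> (\<Sum>i\<in>UNIV. \<Phi> (\<eta> i)) \<le> (\<Sum>i\<in>UNIV. \<Phi> (\<zeta> i))"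
    using ascending_maximal by blast
  have prof: "profile \<zeta>" using \<zeta> by (simp add: ascending_def)
  obtain b where b: "\<And>i. best_reply i \<zeta> (b i)" "\<And>i. \<zeta> i \<sqsubseteq> b i"
    using \<zeta> unfolding ascending_def by metis
  have b_in: "b i \<in> A" for i using b by (auto simp: best_reply_def)
  \<comment> \<open>The profile of all these best replies dominates \<open>\<zeta>\<close>, so best replies to \<open>\<zeta>\<close> can be absorbed into best replies to it.\<close>
  have "ascending b"
    unfolding ascending_def
  proof (intro conjI allI)
    fix i
    obtain c where "best_reply i b c" using best_reply_exists b_in by blast
    then have "best_reply i b (join (b i) c)"
      using prof b_in b by (intro best_reply_join[of \<zeta>]) auto
    then show "\<exists>c. best_reply i b c \<and> b i \<sqsubseteq> c" using join_upper1 by blast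
  qed (rule b_in)
  then have sum_le: "(\<Sum>i\<in>UNIV. \<Phi> (b i)) \<le> (\<Sum>i\<in>UNIV. \<Phi> (\<zeta> i))" using max b by blast
  have \<Phi>_le: "\<Phi> (\<zeta> i) \<le> \<Phi> (b i)" for i using prof b_in b by (intro \<Phi>_mono) auto
  have "\<Phi> (b i) \<le> \<Phi> (\<zeta> i)" for i
  proof (rule ccontr)
    assume "\<not> ?thesis"
    then have "(\<Sum>i\<in>UNIV. \<Phi> (\<zeta> i)) < (\<Sum>i\<in>UNIV. \<Phi> (b i))"
      using \<Phi>_le by (intro sum_strict_mono_ex1) (auto simp: not_le)
    then show False using sum_le by simp
  qed
  then have eq: "J i \<zeta> = J i (\<zeta>(i := b i))" for i
    using \<Phi>_strict[of \<zeta> "\<zeta> i" "b i" i] prof b_in b by simp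
  have "J i \<zeta> < \<infinity>" for i
    using best_reply_cost[OF prof b(1), of i] C_finite[of i] unfolding eq[of i] by (rule order_le_less_trans)
  then show ?thesis
    using eq b(1) prof unfolding open_loop_nash_def best_reply_def by metis
qed

end

section \<open>Stieltjes integrals along increasing paths\<close>

text \<open>
  Left limits exist by monotonicity, see \<open>increasing_path_cadlag\<close>; only right-continuity has to be
  carried along.
\<close>

definition increasing_path :: "real \<Rightarrow> (real \<Rightarrow> real) \<Rightarrow> bool" where
  "increasing_path T x \<longleftrightarrow>
     mono_on {0..T} x \<and> (\<forall>t\<in>{0..T}. 0 \<le> x t) \<and> (\<forall>t\<in>{0..<T}. (x \<longlongrightarrow> x t) (at_right t))"

lemma increasing_pathD:
  assumes "increasing_path T x"
  shows "0 \<le> s \<Longrightarrow> s \<le> t \<Longrightarrow> t \<le> T \<Longrightarrow> x s \<le> x t" "0 \<le> t \<Longrightarrow> t \<le> T \<Longrightarrow> 0 \<le> x t"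
    "0 \<le> t \<Longrightarrow> t < T \<Longrightarrow> (x \<longlongrightarrow> x t) (at_right t)"
proof -
  show "x s \<le> x t" if "0 \<le> s" "s \<le> t" "t \<le> T"
    using assms that mono_onD[of "{0..T}" x s t] by (simp add: increasing_path_def)
qed (use assms in \<open>simp_all add: increasing_path_def\<close>)

lemma mono_on_left_limit:
  fixes x :: "real \<Rightarrow> real"
  assumes "mono_on {0..T} x" "0 < t" "t \<le> T"
  shows "\<exists>l. (x \<longlongrightarrow> l) (at_left t)"
proof -
  have bdd: "bdd_above (x ` {0..<t})"
    using assms by (intro bdd_aboveI2[of _ _ "x t"]) (auto simp: mono_on_def)
  have "(x \<longlongrightarrow> (SUP s\<in>{0..<t}. x s)) (at_left t)"
  proof (rule increasing_tendsto)
    show "\<forall>\<^sub>F s in at_left t. x s \<le> (SUP s\<in>{0..<t}. x s)"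
      unfolding eventually_at_left[OF \<open>0 < t\<close>]
      using bdd by (intro exI[of _ 0]) (auto intro: cSUP_upper simp: assms)
    fix c assume "c < (SUP s\<in>{0..<t}. x s)"
    then obtain s where s: "s \<in> {0..<t}" "c < x s"
      using less_cSUP_iff[OF _ bdd] assms by auto
    have "c < x r" if "s < r" "r < t" for r
      using s that assms monotone_onD[OF assms(1), of s r] by auto
    then show "\<forall>\<^sub>F s in at_left t. c < x s"
      unfolding eventually_at_left[OF \<open>0 < t\<close>] using s by (intro exI[of _ s]) auto
  qed
  then show ?thesis ..
qed

lemma increasing_path_cadlag:
  "increasing_path T x \<longleftrightarrow> mono_on {0..T} x \<and> (\<forall>t\<in>{0..T}. 0 \<le> x t) \<and> cadlag_on T x"
proof -
  have "\<exists>l. (x \<longlongrightarrow> l) (at_left t)" if "mono_on {0..T} x" "t \<in> {0<..T}" for t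
    using that by (intro mono_on_left_limit) auto
  then show ?thesis unfolding increasing_path_def cadlag_on_def by blast
qed

lemma extended_path:
  fixes x :: "real \<Rightarrow> real"
  assumes x: "increasing_path T x" and T: "0 \<le> T"
  defines "F \<equiv> \<lambda>s. x (max 0 (min s T))"
  shows "s \<le> t \<Longrightarrow> F s \<le> F t" "continuous (at_right a) F"
proof -
  show "F s \<le> F t" if "s \<le> t" for s t
    unfolding F_def using that T by (intro increasing_pathD(1)[OF x]) auto
  consider "a < 0" | "0 \<le> a" "a < T" | "T \<le> a" by linarith
  then show "continuous (at_right a) F"
  proof cases
    case 1
    then have "\<forall>\<^sub>F s in at_right a. F a = F s"
      unfolding eventually_at_right[OF 1] F_def by (intro exI[of _ 0]) auto
    then show ?thesis
      unfolding continuous_within by (rule Lim_transform_eventually[OF tendsto_const])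
  next
    case 2
    then have "\<forall>\<^sub>F s in at_right a. x s = F s"
      unfolding eventually_at_right[OF 2(2)] F_def by (intro exI[of _ T]) auto
    moreover have "x a = F a" using 2 by (simp add: F_def)
    ultimately show ?thesis
      using Lim_transform_eventually[OF increasing_pathD(3)[OF x 2]] by (simp add: continuous_within)
  next
    case 3
    then have "\<forall>\<^sub>F s in at_right a. F a = F s"
      unfolding F_def by (intro eventually_at_rightI[of a "a + 1"]) auto
    then show ?thesis
      unfolding continuous_within by (rule Lim_transform_eventually[OF tendsto_const])
  qed
qed

lemma stieltjes_integral_0 [simp]: "stieltjes_integral T \<phi> x 0 = \<phi> 0 * x 0"
  by (simp add: stieltjes_integral_def set_lebesgue_integral_def)

text \<open>
  Together with the value at \<open>0\<close> this estimate determines the Stieltjes integral. All later properties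
  are drawn from it without returning to the underlying measure.
\<close>

lemma stieltjes_integral_increment:
  assumes x: "increasing_path T x" and \<phi>: "continuous_on {0..T} \<phi>"
    and ab: "0 \<le> a" "a \<le> b" "b \<le> T" and c: "\<And>s. s \<in> {a..b} \<Longrightarrow> \<bar>\<phi> s - c\<bar> \<le> e"
  shows "\<bar>stieltjes_integral T \<phi> x b - stieltjes_integral T \<phi> x a - c * (x b - x a)\<bar> \<le> e * (x b - x a)"
proof -
  have T: "0 \<le> T" using ab by simp
  define N where "N = interval_measure (\<lambda>s. x (max 0 (min s T)))"
  have sets_N [measurable_cong]: "sets N = sets borel" by (simp add: N_def)
  have mass: "emeasure N {u<..v} = ennreal (x v - x u)" if "0 \<le> u" "u \<le> v" "v \<le> T" for u v
    using emeasure_interval_measure_Ioc[OF that(2) extended_path[OF x T]] that by (simp add: N_def)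
  have mass': "measure N {u<..v} = x v - x u" if "0 \<le> u" "u \<le> v" "v \<le> T" for u v
    using mass[OF that] increasing_pathD(1)[OF x that] by (simp add: measure_def)
  have int: "set_integrable N {u<..v} \<phi>" if "0 \<le> u" "u \<le> v" "v \<le> T" for u v
  proof -
    have "compact (\<phi> ` {0..T})" using \<phi> by (intro compact_continuous_image) auto
    then obtain B where B: "\<And>s. s \<in> {0..T} \<Longrightarrow> \<bar>\<phi> s\<bar> \<le> B"
      unfolding real_norm_def[symmetric] by (meson bounded_iff compact_imp_bounded imageI)
    have eq: "indicator {u<..v} s *\<^sub>R (indicator {0..T} s *\<^sub>R \<phi> s) = indicator {u<..v} s *\<^sub>R \<phi> s" for s
      using that by (auto simp: indicator_def)
    have "integrable N (\<lambda>s. indicator {u<..v} s *\<^sub>R (indicator {0..T} s *\<^sub>R \<phi> s))"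
    proof (rule integrableI_bounded_set_indicator[where B = B])
      show "{u<..v} \<in> sets N" by (simp add: sets_N)
      show "emeasure N {u<..v} < \<infinity>" using that by (simp add: mass)
      show "AE s in N. s \<in> {u<..v} \<longrightarrow> norm (indicator {0..T} s *\<^sub>R \<phi> s) \<le> B"
        using B that by (auto simp: indicator_def)
      show "(\<lambda>s. indicator {0..T} s *\<^sub>R \<phi> s) \<in> borel_measurable N"
        using borel_measurable_continuous_on_indicator[OF _ \<phi>] by (simp add: measurable_cong_sets[OF sets_N refl])
    qed
    then show ?thesis unfolding set_integrable_def eq .
  qed
  have const: "(LINT s:{a<..b}|N. r) = r * (x b - x a)" for r
  proof -
    have "integrable N (indicator {a<..b} :: real \<Rightarrow> real)"
      using ab mass[of a b] by (intro integrable_real_indicator) (auto simp: sets_N)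
    then show ?thesis
      using ab by (simp add: set_lebesgue_integral_def sets_N mass')
  qed
  have "{0<..b} = {0<..a} \<union> {a<..b}" using ab by auto
  then have "(LINT s:{0<..b}|N. \<phi> s) = (LINT s:{0<..a}|N. \<phi> s) + (LINT s:{a<..b}|N. \<phi> s)"
    using ab by (simp add: set_integral_Un[OF _ int int])
  then have "stieltjes_integral T \<phi> x b - stieltjes_integral T \<phi> x a - c * (x b - x a)
      = (LINT s:{a<..b}|N. \<phi> s) - (LINT s:{a<..b}|N. c)"
    unfolding const by (simp add: stieltjes_integral_def N_def[symmetric])
  also have "\<dots> = (LINT s:{a<..b}|N. \<phi> s - c)"
    using ab int mass[of a b] by (intro set_integral_diff(2)[symmetric]) (auto simp: set_integrable_def sets_N)
  also have "\<bar>\<dots>\<bar> \<le> (LINT s:{a<..b}|N. e)"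
  proof -
    have i: "set_integrable N {a<..b} (\<lambda>s. \<phi> s - c)"
      using ab int mass[of a b] by (intro set_integral_diff(1)) (auto simp: set_integrable_def sets_N)
    show ?thesis
      using integral_norm_bound[of N "\<lambda>s. indicator {a<..b} s *\<^sub>R (\<phi> s - c)"]
      unfolding set_lebesgue_integral_def real_norm_def
    proof (rule order_trans, intro integral_mono)
      show "integrable N (\<lambda>s. \<bar>indicator {a<..b} s *\<^sub>R (\<phi> s - c)\<bar>)"
        using i unfolding set_integrable_def by (rule integrable_abs)
      show "integrable N (\<lambda>s. indicator {a<..b} s *\<^sub>R e)" using ab mass[of a b] by simp
    qed (use c in \<open>auto simp: indicator_def\<close>)
  qed
  also have "\<dots> = e * (x b - x a)" by (rule const)
  finally show ?thesis .
qed

lemma uniformly_continuous_path: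
  fixes \<phi> :: "real \<Rightarrow> real"
  assumes "continuous_on {0..T} \<phi>" "e > 0"
  shows "\<exists>d>0. \<forall>a b s. 0 \<le> a \<longrightarrow> b \<le> T \<longrightarrow> b - a \<le> d \<longrightarrow> s \<in> {a..b} \<longrightarrow> \<bar>\<phi> s - \<phi> a\<bar> \<le> e"
proof -
  obtain d where "d > 0" and d: "\<And>s t. s \<in> {0..T} \<Longrightarrow> t \<in> {0..T} \<Longrightarrow> dist t s < d \<Longrightarrow> dist (\<phi> t) (\<phi> s) < e"
    using compact_uniformly_continuous[OF assms(1)] assms(2) unfolding uniformly_continuous_on_def by auto
  show ?thesis
  proof (intro exI[of _ "d / 2"] conjI allI impI)
    fix a b s :: real assume "0 \<le> a" "b \<le> T" "b - a \<le> d / 2" "s \<in> {a..b}"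
    then have "dist (\<phi> s) (\<phi> a) < e" using \<open>d > 0\<close> by (intro d) (auto simp: dist_real_def)
    then show "\<bar>\<phi> s - \<phi> a\<bar> \<le> e" by (simp add: dist_real_def)
  qed (use \<open>d > 0\<close> in simp)
qed

lemma stieltjes_integral_increment':
  assumes x: "increasing_path T x" and \<phi>: "continuous_on {0..T} \<phi>" and e: "e > 0"
  shows "\<exists>d>0. \<forall>a b. 0 \<le> a \<longrightarrow> a \<le> b \<longrightarrow> b \<le> T \<longrightarrow> b - a \<le> d \<longrightarrow>
    \<bar>stieltjes_integral T \<phi> x b - stieltjes_integral T \<phi> x a - \<phi> a * (x b - x a)\<bar> \<le> e * (x b - x a)"
proof -
  obtain d where d: "d > 0"
    "\<And>a b s. 0 \<le> a \<Longrightarrow> b \<le> T \<Longrightarrow> b - a \<le> d \<Longrightarrow> s \<in> {a..b} \<Longrightarrow> \<bar>\<phi> s - \<phi> a\<bar> \<le> e"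
    using uniformly_continuous_path[OF \<phi> e] by blast
  show ?thesis
  proof (intro exI[of _ d] conjI allI impI)
    fix a b assume "0 \<le> a" "a \<le> b" "b \<le> T" "b - a \<le> d"
    then show "\<bar>stieltjes_integral T \<phi> x b - stieltjes_integral T \<phi> x a - \<phi> a * (x b - x a)\<bar> \<le> e * (x b - x a)"
      by (intro stieltjes_integral_increment[OF x \<phi>] d(2))
  qed (rule d(1))
qed

lemma partition_telescope:
  fixes Z \<kappa> :: "real \<Rightarrow> real"
  assumes "\<And>k. k < n \<Longrightarrow> \<bar>Z (p (Suc k)) - Z (p k) - r k\<bar> \<le> e * (\<kappa> (p (Suc k)) - \<kappa> (p k))"
  shows "\<bar>Z (p n) - Z (p 0) - (\<Sum>k<n. r k)\<bar> \<le> e * (\<kappa> (p n) - \<kappa> (p 0))"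
  using assms
proof (induction n)
  case (Suc n)
  have "\<bar>Z (p n) - Z (p 0) - (\<Sum>k<n. r k)\<bar> \<le> e * (\<kappa> (p n) - \<kappa> (p 0))"
    by (intro Suc.IH Suc.prems less_SucI)
  moreover have "\<bar>Z (p (Suc n)) - Z (p n) - r n\<bar> \<le> e * (\<kappa> (p (Suc n)) - \<kappa> (p n))"
    by (intro Suc.prems lessI)
  moreover have "e * (\<kappa> (p (Suc n)) - \<kappa> (p 0)) = e * (\<kappa> (p (Suc n)) - \<kappa> (p n)) + e * (\<kappa> (p n) - \<kappa> (p 0))"
    by (simp add: right_diff_distrib)
  ultimately show ?case unfolding sum.lessThan_Suc by linarith
qed simp

text \<open>
  The analogue of a vanishing derivative with respect to \<open>\<kappa>\<close>: summing the increments over a fine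
  partition bounds \<open>\<bar>Z t - Z 0\<bar>\<close> by \<open>e (\<kappa> t - \<kappa> 0)\<close>.
\<close>

lemma small_increments_imp_constant:
  fixes Z \<kappa> :: "real \<Rightarrow> real"
  assumes t: "0 \<le> t" "t \<le> T"
    and small: "\<And>e. e > 0 \<Longrightarrow> \<exists>d>0. \<forall>a b. 0 \<le> a \<longrightarrow> a \<le> b \<longrightarrow> b \<le> T \<longrightarrow> b - a \<le> d \<longrightarrow>
      \<bar>Z b - Z a\<bar> \<le> e * (\<kappa> b - \<kappa> a)"
  shows "Z t = Z 0"
proof -
  have bound: "\<bar>Z t - Z 0\<bar> \<le> e * \<bar>\<kappa> t - \<kappa> 0\<bar>" if "e > 0" for e
  proof -
    obtain d where d: "d > 0" "\<And>a b. 0 \<le> a \<Longrightarrow> a \<le> b \<Longrightarrow> b \<le> T \<Longrightarrow> b - a \<le> d \<Longrightarrow>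
      \<bar>Z b - Z a\<bar> \<le> e * (\<kappa> b - \<kappa> a)"
      using small[OF \<open>e > 0\<close>] by blast
    obtain n :: nat where n: "t / d < n" "n > 0"
      using reals_Archimedean2[of "max (t / d) 0"] by auto
    define p where "p k = t * real k / n" for k
    have p_le: "p k \<le> t" if "k \<le> n" for k
    proof -
      have "t * real k \<le> t * real n" using that t by (intro mult_left_mono) auto
      then show ?thesis using n by (simp add: p_def divide_le_eq)
    qed
    have p_step: "p (Suc k) - p k = t / n" for k by (simp add: p_def algebra_simps add_divide_distrib)
    have t_n: "t / n \<le> d" "0 \<le> t / n" using n d(1) t by (auto simp: field_simps)
    have p_0: "0 \<le> p k" for k using t by (simp add: p_def)
    have "\<bar>Z (p n) - Z (p 0) - (\<Sum>k<n. 0)\<bar> \<le> e * (\<kappa> (p n) - \<kappa> (p 0))"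
    proof (rule partition_telescope)
      fix k assume "k < n"
      then show "\<bar>Z (p (Suc k)) - Z (p k) - 0\<bar> \<le> e * (\<kappa> (p (Suc k)) - \<kappa> (p k))"
        using d(2)[of "p k" "p (Suc k)"] p_0[of k] p_step[of k] t_n t p_le[of "Suc k"] by auto
    qed
    then have "\<bar>Z t - Z 0\<bar> \<le> e * (\<kappa> t - \<kappa> 0)" using n by (simp add: p_def)
    also have "\<dots> \<le> e * \<bar>\<kappa> t - \<kappa> 0\<bar>" using that by (intro mult_left_mono) auto
    finally show ?thesis .
  qed
  have "\<bar>Z t - Z 0\<bar> \<le> e" if "e > 0" for e
  proof -
    have "e / (\<bar>\<kappa> t - \<kappa> 0\<bar> + 1) * \<bar>\<kappa> t - \<kappa> 0\<bar> \<le> e"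
      using that by (simp add: divide_le_eq mult_left_mono)
    moreover have "e / (\<bar>\<kappa> t - \<kappa> 0\<bar> + 1) > 0" using that by (intro divide_pos_pos) auto
    ultimately show ?thesis using bound order_trans by blast
  qed
  then have "\<bar>Z t - Z 0\<bar> \<le> 0" by (rule field_le_epsilon) auto
  then show ?thesis by simp
qed

text \<open>
  Any function with the right initial value and the right infinitesimal increments is the integral.
  This turns linearity and the chain rule into local estimates.
\<close>

lemma stieltjes_integral_unique:
  assumes x: "increasing_path T x" and \<phi>: "continuous_on {0..T} \<phi>" and t: "0 \<le> t" "t \<le> T"
    and Z0: "Z 0 = \<phi> 0 * x 0"
    and small: "\<And>e. e > 0 \<Longrightarrow> \<exists>d>0. \<forall>a b. 0 \<le> a \<longrightarrow> a \<le> b \<longrightarrow> b \<le> T \<longrightarrow> b - a \<le> d \<longrightarrow>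
      \<bar>Z b - Z a - \<phi> a * (x b - x a)\<bar> \<le> e * (\<kappa> b - \<kappa> a)"
  shows "stieltjes_integral T \<phi> x t = Z t"
proof -
  have "stieltjes_integral T \<phi> x t - Z t = stieltjes_integral T \<phi> x 0 - Z 0"
  proof (rule small_increments_imp_constant[OF t, where \<kappa> = "\<lambda>s. x s + \<kappa> s"])
    fix e :: real assume e: "e > 0"
    obtain d1 where d1: "d1 > 0" "\<And>a b. 0 \<le> a \<Longrightarrow> a \<le> b \<Longrightarrow> b \<le> T \<Longrightarrow> b - a \<le> d1 \<Longrightarrow>
      \<bar>Z b - Z a - \<phi> a * (x b - x a)\<bar> \<le> e * (\<kappa> b - \<kappa> a)"
      using small[OF e] by blast
    obtain d2 where d2: "d2 > 0" "\<And>a b. 0 \<le> a \<Longrightarrow> a \<le> b \<Longrightarrow> b \<le> T \<Longrightarrow> b - a \<le> d2 \<Longrightarrow>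
      \<bar>stieltjes_integral T \<phi> x b - stieltjes_integral T \<phi> x a - \<phi> a * (x b - x a)\<bar> \<le> e * (x b - x a)"
      using stieltjes_integral_increment'[OF x \<phi> e] by blast
    show "\<exists>d>0. \<forall>a b. 0 \<le> a \<longrightarrow> a \<le> b \<longrightarrow> b \<le> T \<longrightarrow> b - a \<le> d \<longrightarrow>
      \<bar>stieltjes_integral T \<phi> x b - Z b - (stieltjes_integral T \<phi> x a - Z a)\<bar> \<le> e * (x b + \<kappa> b - (x a + \<kappa> a))"
    proof (intro exI[of _ "min d1 d2"] conjI allI impI)
      fix a b :: real assume "0 \<le> a" "a \<le> b" "b \<le> T" "b - a \<le> min d1 d2"
      then show "\<bar>stieltjes_integral T \<phi> x b - Z b - (stieltjes_integral T \<phi> x a - Z a)\<bar>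
          \<le> e * (x b + \<kappa> b - (x a + \<kappa> a))"
        using d1(2)[of a b] d2(2)[of a b] by (simp add: algebra_simps)
    qed (use d1 d2 in auto)
  qed
  then show ?thesis using Z0 by simp
qed

lemma stieltjes_integral_const:
  assumes x: "increasing_path T x" and t: "0 \<le> t" "t \<le> T"
  shows "stieltjes_integral T (\<lambda>_. 1) x t = x t"
proof (rule stieltjes_integral_unique[OF x _ t, where \<kappa> = x])
  show "\<exists>d>0. \<forall>a b. 0 \<le> a \<longrightarrow> a \<le> b \<longrightarrow> b \<le> T \<longrightarrow> b - a \<le> d \<longrightarrow>
      \<bar>x b - x a - 1 * (x b - x a)\<bar> \<le> e * (x b - x a)" if "e > 0" for e
  proof (intro exI[of _ 1] conjI allI impI)
    fix a b assume "0 \<le> a" "a \<le> b" "b \<le> T"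
    then have "x a \<le> x b" by (rule increasing_pathD[OF x])
    then show "\<bar>x b - x a - 1 * (x b - x a)\<bar> \<le> e * (x b - x a)" using that by simp
  qed simp
qed auto

lemma stieltjes_integral_add:
  assumes x: "increasing_path T x" and y: "increasing_path T y" and z: "increasing_path T z"
    and eq: "\<And>s. s \<in> {0..T} \<Longrightarrow> z s = x s + y s"
    and \<phi>: "continuous_on {0..T} \<phi>" and t: "0 \<le> t" "t \<le> T"
  shows "stieltjes_integral T \<phi> z t = stieltjes_integral T \<phi> x t + stieltjes_integral T \<phi> y t"
proof (rule stieltjes_integral_unique[OF z \<phi> t, where \<kappa> = "\<lambda>s. x s + y s"])
  fix e :: real assume e: "e > 0"
  obtain d1 where d1: "d1 > 0" "\<And>a b. 0 \<le> a \<Longrightarrow> a \<le> b \<Longrightarrow> b \<le> T \<Longrightarrow> b - a \<le> d1 \<Longrightarrow>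
    \<bar>stieltjes_integral T \<phi> x b - stieltjes_integral T \<phi> x a - \<phi> a * (x b - x a)\<bar> \<le> e * (x b - x a)"
    using stieltjes_integral_increment'[OF x \<phi> e] by blast
  obtain d2 where d2: "d2 > 0" "\<And>a b. 0 \<le> a \<Longrightarrow> a \<le> b \<Longrightarrow> b \<le> T \<Longrightarrow> b - a \<le> d2 \<Longrightarrow>
    \<bar>stieltjes_integral T \<phi> y b - stieltjes_integral T \<phi> y a - \<phi> a * (y b - y a)\<bar> \<le> e * (y b - y a)"
    using stieltjes_integral_increment'[OF y \<phi> e] by blast
  show "\<exists>d>0. \<forall>a b. 0 \<le> a \<longrightarrow> a \<le> b \<longrightarrow> b \<le> T \<longrightarrow> b - a \<le> d \<longrightarrow>
      \<bar>stieltjes_integral T \<phi> x b + stieltjes_integral T \<phi> y b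
        - (stieltjes_integral T \<phi> x a + stieltjes_integral T \<phi> y a) - \<phi> a * (z b - z a)\<bar>
      \<le> e * (x b + y b - (x a + y a))"
  proof (intro exI[of _ "min d1 d2"] conjI allI impI)
    fix a b :: real assume "0 \<le> a" "a \<le> b" "b \<le> T" "b - a \<le> min d1 d2"
    then show "\<bar>stieltjes_integral T \<phi> x b + stieltjes_integral T \<phi> y b
        - (stieltjes_integral T \<phi> x a + stieltjes_integral T \<phi> y a) - \<phi> a * (z b - z a)\<bar>
      \<le> e * (x b + y b - (x a + y a))"
      using d1(2)[of a b] d2(2)[of a b] by (simp add: algebra_simps eq)
  qed (use d1 d2 in auto)
qed (use t eq in \<open>auto simp: algebra_simps\<close>)

lemma stieltjes_integral_bounds:
  assumes x: "increasing_path T x" and \<phi>: "continuous_on {0..T} \<phi>"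
    and ab: "0 \<le> a" "a \<le> b" "b \<le> T" and C: "\<And>s. s \<in> {0..T} \<Longrightarrow> 0 \<le> \<phi> s \<and> \<phi> s \<le> C"
  shows "stieltjes_integral T \<phi> x a \<le> stieltjes_integral T \<phi> x b"
    "stieltjes_integral T \<phi> x b - stieltjes_integral T \<phi> x a \<le> C * (x b - x a)"
proof -
  have "\<bar>stieltjes_integral T \<phi> x b - stieltjes_integral T \<phi> x a - (C / 2) * (x b - x a)\<bar> \<le> (C / 2) * (x b - x a)"
  proof (rule stieltjes_integral_increment[OF x \<phi> ab])
    fix s assume "s \<in> {a..b}"
    then have "0 \<le> \<phi> s" "\<phi> s \<le> C" using C[of s] ab by auto
    then show "\<bar>\<phi> s - C / 2\<bar> \<le> C / 2" by linarith
  qed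
  moreover have "C * (x b - x a) = (C / 2) * (x b - x a) + (C / 2) * (x b - x a)"
    by (simp flip: distrib_right)
  ultimately show "stieltjes_integral T \<phi> x a \<le> stieltjes_integral T \<phi> x b"
    "stieltjes_integral T \<phi> x b - stieltjes_integral T \<phi> x a \<le> C * (x b - x a)"
    by linarith+
qed

text \<open>
  Right-continuity is inherited because the increments of the integral are at most a constant times
  those of \<open>x\<close>.
\<close>

lemma increasing_path_stieltjes:
  assumes x: "increasing_path T x" and \<phi>: "continuous_on {0..T} \<phi>"
    and nonneg: "\<And>s. s \<in> {0..T} \<Longrightarrow> 0 \<le> \<phi> s"
  shows "increasing_path T (stieltjes_integral T \<phi> x)"
proof -
  have "compact (\<phi> ` {0..T})" using \<phi> by (intro compact_continuous_image) auto
  then obtain C where "\<And>s. s \<in> {0..T} \<Longrightarrow> \<bar>\<phi> s\<bar> \<le> C"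
    unfolding real_norm_def[symmetric] by (meson bounded_iff compact_imp_bounded imageI)
  then have C: "\<And>s. s \<in> {0..T} \<Longrightarrow> 0 \<le> \<phi> s \<and> \<phi> s \<le> C" using nonneg by force
  note bounds = stieltjes_integral_bounds[OF x \<phi> _ _ _ C]
  have "0 \<le> stieltjes_integral T \<phi> x t" if "t \<in> {0..T}" for t
  proof -
    have "0 \<le> \<phi> 0 * x 0" using that nonneg[of 0] increasing_pathD(2)[OF x, of 0] by simp
    also have "\<dots> \<le> stieltjes_integral T \<phi> x t" using bounds(1)[of 0 t] that by simp
    finally show ?thesis .
  qed
  moreover have "(stieltjes_integral T \<phi> x \<longlongrightarrow> stieltjes_integral T \<phi> x t) (at_right t)"
    if t: "t \<in> {0..<T}" for t
  proof (rule tendsto_sandwich)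
    have ev: "\<forall>\<^sub>F s in at_right t. t < s \<and> s \<le> T"
      using t unfolding eventually_at_right[of t T, simplified] by (intro eventually_at_rightI[of t T]) auto
    show "\<forall>\<^sub>F s in at_right t. stieltjes_integral T \<phi> x t \<le> stieltjes_integral T \<phi> x s"
      using ev by eventually_elim (use t bounds(1) in auto)
    show "\<forall>\<^sub>F s in at_right t. stieltjes_integral T \<phi> x s \<le> stieltjes_integral T \<phi> x t + C * (x s - x t)"
      using ev by eventually_elim (use t bounds(2) in \<open>force simp: algebra_simps\<close>)
    have "((\<lambda>s. stieltjes_integral T \<phi> x t + C * (x s - x t)) \<longlongrightarrow>
        stieltjes_integral T \<phi> x t + C * (x t - x t)) (at_right t)"
      using t by (intro tendsto_intros increasing_pathD(3)[OF x]) auto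
    then show "((\<lambda>s. stieltjes_integral T \<phi> x t + C * (x s - x t)) \<longlongrightarrow> stieltjes_integral T \<phi> x t) (at_right t)"
      by simp
  qed (rule tendsto_const)
  ultimately show ?thesis
    unfolding increasing_path_def mono_on_def using bounds(1) by auto
qed

text \<open>
  Locally \<open>d(\<integral> \<psi> dx)\<close> is \<open>\<psi> dx\<close> up to a small multiple of \<open>dx\<close>, so both sides have the same
  increments.
\<close>

lemma stieltjes_integral_chain:
  assumes x: "increasing_path T x" and \<phi>: "continuous_on {0..T} \<phi>" and \<psi>: "continuous_on {0..T} \<psi>"
    and nonneg: "\<And>s. s \<in> {0..T} \<Longrightarrow> 0 \<le> \<psi> s" and t: "0 \<le> t" "t \<le> T"
  shows "stieltjes_integral T \<phi> (stieltjes_integral T \<psi> x) t = stieltjes_integral T (\<lambda>s. \<phi> s * \<psi> s) x t"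
proof (rule stieltjes_integral_unique[OF increasing_path_stieltjes[OF x \<psi> nonneg] \<phi> t, where \<kappa> = x])
  fix e :: real assume e: "e > 0"
  have "compact (\<phi> ` {0..T})" using \<phi> by (intro compact_continuous_image) auto
  then obtain C where C: "\<And>s. s \<in> {0..T} \<Longrightarrow> \<bar>\<phi> s\<bar> \<le> C"
    unfolding real_norm_def[symmetric] by (meson bounded_iff compact_imp_bounded imageI)
  have C0: "0 \<le> C" using C[of t] t by auto
  \<comment> \<open>One unit of \<open>e1\<close> for the integral of \<open>\<phi> \<psi>\<close>, and \<open>C\<close> units for the integral of \<open>\<psi>\<close> multiplied by \<open>\<phi> a\<close>.\<close>
  define e1 where "e1 = e / (1 + C)"
  have "(1 + C) * e1 = e" using C0 by (simp add: e1_def)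
  then have e1: "e1 > 0" "e = e1 + C * e1" using e C0 by (simp_all only: distrib_right mult_1) (simp add: e1_def)
  have \<phi>\<psi>: "continuous_on {0..T} (\<lambda>s. \<phi> s * \<psi> s)" using \<phi> \<psi> by (intro continuous_intros)
  obtain d1 where d1: "d1 > 0" "\<And>a b. 0 \<le> a \<Longrightarrow> a \<le> b \<Longrightarrow> b \<le> T \<Longrightarrow> b - a \<le> d1 \<Longrightarrow>
    \<bar>stieltjes_integral T (\<lambda>s. \<phi> s * \<psi> s) x b - stieltjes_integral T (\<lambda>s. \<phi> s * \<psi> s) x a - \<phi> a * \<psi> a * (x b - x a)\<bar> \<le> e1 * (x b - x a)"
    using stieltjes_integral_increment'[OF x \<phi>\<psi> e1(1)] by blast
  obtain d2 where d2: "d2 > 0" "\<And>a b. 0 \<le> a \<Longrightarrow> a \<le> b \<Longrightarrow> b \<le> T \<Longrightarrow> b - a \<le> d2 \<Longrightarrow>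
    \<bar>stieltjes_integral T \<psi> x b - stieltjes_integral T \<psi> x a - \<psi> a * (x b - x a)\<bar> \<le> e1 * (x b - x a)"
    using stieltjes_integral_increment'[OF x \<psi> e1(1)] by blast
  show "\<exists>d>0. \<forall>a b. 0 \<le> a \<longrightarrow> a \<le> b \<longrightarrow> b \<le> T \<longrightarrow> b - a \<le> d \<longrightarrow>
      \<bar>stieltjes_integral T (\<lambda>s. \<phi> s * \<psi> s) x b - stieltjes_integral T (\<lambda>s. \<phi> s * \<psi> s) x a
        - \<phi> a * (stieltjes_integral T \<psi> x b - stieltjes_integral T \<psi> x a)\<bar> \<le> e * (x b - x a)"
  proof (intro exI[of _ "min d1 d2"] conjI allI impI)
    fix a b :: real assume ab: "0 \<le> a" "a \<le> b" "b \<le> T" "b - a \<le> min d1 d2"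
    define U where "U = stieltjes_integral T (\<lambda>s. \<phi> s * \<psi> s) x b - stieltjes_integral T (\<lambda>s. \<phi> s * \<psi> s) x a
      - \<phi> a * \<psi> a * (x b - x a)"
    define V where "V = stieltjes_integral T \<psi> x b - stieltjes_integral T \<psi> x a - \<psi> a * (x b - x a)"
    have "\<bar>\<phi> a * V\<bar> \<le> C * (e1 * (x b - x a))"
      unfolding abs_mult V_def using ab d2(2)[of a b] C[of a] C0 by (intro mult_mono) auto
    moreover have "\<bar>U\<bar> \<le> e1 * (x b - x a)" unfolding U_def using ab d1(2)[of a b] by auto
    ultimately have "\<bar>U - \<phi> a * V\<bar> \<le> e * (x b - x a)"
      unfolding e1(2) by (simp add: algebra_simps)
    then show "\<bar>stieltjes_integral T (\<lambda>s. \<phi> s * \<psi> s) x b - stieltjes_integral T (\<lambda>s. \<phi> s * \<psi> s) x a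
        - \<phi> a * (stieltjes_integral T \<psi> x b - stieltjes_integral T \<psi> x a)\<bar> \<le> e * (x b - x a)"
      by (simp add: U_def V_def algebra_simps)
  qed (use d1 d2 in auto)
qed simp_all

lemma stieltjes_integral_partition:
  assumes x: "increasing_path T x" and \<phi>: "continuous_on {0..T} \<phi>"
    and p: "p 0 = 0" "p n \<le> T" "\<And>k. k < n \<Longrightarrow> p k \<le> p (Suc k)"
    and osc: "\<And>k s. k < n \<Longrightarrow> s \<in> {p k..p (Suc k)} \<Longrightarrow> \<bar>\<phi> s - \<phi> (p k)\<bar> \<le> e"
  shows "\<bar>stieltjes_integral T \<phi> x (p n) - (\<phi> 0 * x 0 + (\<Sum>k<n. \<phi> (p k) * (x (p (Suc k)) - x (p k))))\<bar>
    \<le> e * (x (p n) - x 0)"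
proof -
  have mono: "p j \<le> p k" if "j \<le> k" "k \<le> n" for j k
    using that
  proof (induction k)
    case (Suc k)
    then show ?case using p(3)[of k] by (cases "j = Suc k") (auto intro: order_trans)
  qed simp
  have p_in: "0 \<le> p k \<and> p k \<le> T" if "k \<le> n" for k
    using mono[of 0 k] mono[of k n] p that by auto
  have "\<bar>stieltjes_integral T \<phi> x (p n) - stieltjes_integral T \<phi> x (p 0) - (\<Sum>k<n. \<phi> (p k) * (x (p (Suc k)) - x (p k)))\<bar>
    \<le> e * (x (p n) - x (p 0))"
    by (intro partition_telescope stieltjes_integral_increment[OF x \<phi>] p osc) (use p_in p in auto)
  then show ?thesis using p by (simp add: algebra_simps)
qed

text \<open>
  The partitions do not depend on the path. Applied scenario by scenario, this makes the integral of
  an adapted process a limit of adapted processes.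
\<close>

lemma stieltjes_integral_riemann:
  fixes t :: real
  assumes x: "increasing_path T x" and \<phi>: "continuous_on {0..T} \<phi>" and t: "0 \<le> t" "t \<le> T"
  shows "(\<lambda>n. \<phi> 0 * x 0 + (\<Sum>k<Suc n. \<phi> (t * k / Suc n) * (x (t * Suc k / Suc n) - x (t * k / Suc n))))
     \<longlonglongrightarrow> stieltjes_integral T \<phi> x t"
proof (rule LIMSEQ_I)
  fix r :: real assume r: "r > 0"
  define e where "e = r / (2 * (x t - x 0 + 1))"
  have xt: "0 \<le> x t - x 0" using increasing_pathD(1)[OF x, of 0 t] t by simp
  have e: "e > 0" using r xt by (simp add: e_def)
  have e_small: "e * (x t - x 0) < r"
  proof -
    have "e * (x t - x 0) \<le> e * (x t - x 0 + 1)" using e by (intro mult_left_mono) auto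
    also have "\<dots> = r / 2" using xt by (simp add: e_def field_simps)
    finally show ?thesis using r by simp
  qed
  obtain d where d: "d > 0" "\<And>a b s. 0 \<le> a \<Longrightarrow> b \<le> T \<Longrightarrow> b - a \<le> d \<Longrightarrow> s \<in> {a..b} \<Longrightarrow> \<bar>\<phi> s - \<phi> a\<bar> \<le> e"
    using uniformly_continuous_path[OF \<phi> e] by blast
  obtain N :: nat where N: "t / d < N" using reals_Archimedean2 by blast
  show "\<exists>no. \<forall>n\<ge>no. norm (\<phi> 0 * x 0 + (\<Sum>k<Suc n. \<phi> (t * k / Suc n) * (x (t * Suc k / Suc n) - x (t * k / Suc n)))
      - stieltjes_integral T \<phi> x t) < r"
  proof (intro exI[of _ N] allI impI)
    fix n assume n: "N \<le> n"
    define p where "p k = t * real k / real (Suc n)" for k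
    have p_end: "p (Suc n) = t" by (simp add: p_def del: of_nat_Suc)
    have p_step: "p (Suc k) - p k = t / Suc n" for k
      by (simp add: p_def algebra_simps add_divide_distrib flip: diff_divide_distrib)
    have "t / d < Suc n" using N n by simp
    then have step_le: "t / Suc n \<le> d" "0 \<le> t / Suc n" using d(1) t by (auto simp: field_simps)
    have p_le: "p k \<le> T" if "k \<le> Suc n" for k
    proof -
      have "t * real k \<le> t * real (Suc n)" using that t by (intro mult_left_mono) auto
      then show ?thesis using t by (simp add: p_def divide_le_eq del: of_nat_Suc) (metis mult_right_mono of_nat_0_le_iff order_trans)
    qed
    have "\<bar>stieltjes_integral T \<phi> x (p (Suc n)) - (\<phi> 0 * x 0 + (\<Sum>k<Suc n. \<phi> (p k) * (x (p (Suc k)) - x (p k))))\<bar>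
      \<le> e * (x (p (Suc n)) - x 0)"
    proof (rule stieltjes_integral_partition[OF x \<phi>])
      fix k s assume "k < Suc n" "s \<in> {p k..p (Suc k)}"
      then show "\<bar>\<phi> s - \<phi> (p k)\<bar> \<le> e"
        using d(2)[of "p k" "p (Suc k)" s] p_step[of k] step_le p_le[of "Suc k"] t by (auto simp: p_def)
    next
      fix k show "p k \<le> p (Suc k)" using p_step[of k] step_le by linarith
    qed (use t in \<open>auto simp: p_def\<close>)
    then show "norm (\<phi> 0 * x 0 + (\<Sum>k<Suc n. \<phi> (t * k / Suc n) * (x (t * Suc k / Suc n) - x (t * k / Suc n)))
      - stieltjes_integral T \<phi> x t) < r"
      unfolding p_end using e_small by (simp add: p_def abs_minus_commute del: sum.lessThan_Suc)
  qed
qed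

text \<open>
  Monotone limits of paths may fail to be pointwise limits at countably many times; convergence of
  integrals is tested on partitions without such times. The endpoint \<open>0\<close> cannot be avoided.
\<close>

lemma partition_avoiding_countable:
  fixes T d :: real
  assumes T: "T > 0" and d: "d > 0" and B: "countable B"
  shows "\<exists>n p. p 0 = 0 \<and> p (Suc n) = T \<and> (\<forall>k\<le>n. p k \<le> p (Suc k) \<and> p (Suc k) - p k \<le> d) \<and>
     (\<forall>k\<in>{1..n}. 0 \<le> p k \<and> p k \<le> T \<and> p k \<notin> B)"
proof -
  obtain n :: nat where n: "2 * T / d < n" "n > 0"
    using reals_Archimedean2[of "max (2 * T / d) 0"] by auto
  \<comment> \<open>One point \<open>q k\<close> is chosen inside each cell of width \<open>h\<close>, so neighbours are at most \<open>2 h\<close> apart.\<close>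
  define h where "h = T / n"
  have h: "h > 0" "2 * h \<le> d" "real n * h = T" using n T d by (auto simp: h_def field_simps)
  have "\<exists>q. real k * h < q \<and> q < real (Suc k) * h \<and> q \<notin> B" for k
  proof -
    have "real k * h < real (Suc k) * h" using h by simp
    then have "\<not> {real k * h<..<real (Suc k) * h} \<subseteq> B"
      using B countable_subset uncountable_open_interval by blast
    then show ?thesis by auto
  qed
  then obtain q where q: "real k * h < q k" "q k < real (Suc k) * h" "q k \<notin> B" for k
    by metis
  define p where "p k = (if k = 0 then 0 else if k \<le> n then q (k - 1) else T)" for k
  have p_Suc: "p (Suc k) = (if k < n then q k else T)" for k by (auto simp: p_def)
  have le_T: "q k \<le> T" if "k < n" for k
  proof -
    have "real (Suc k) * h \<le> real n * h" using that h by (intro mult_right_mono) auto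
    then show ?thesis using q(2)[of k] h by linarith
  qed
  have ge_0: "0 \<le> q k" for k
  proof -
    have "0 \<le> real k * h" using h by simp
    then show ?thesis using q(1)[of k] by linarith
  qed
  show ?thesis
  proof (intro exI[of _ n] exI[of _ p] conjI allI impI ballI)
    fix k assume k: "k \<le> n"
    consider "k = 0" | j where "k = Suc j" "Suc j < n" | j where "k = Suc j" "Suc j = n"
      using k by (cases k) force+
    then have "p k \<le> p (Suc k) \<and> p (Suc k) - p k \<le> d"
    proof cases
      case 1
      then show ?thesis using n q[of 0] h ge_0[of 0] by (simp add: p_def)
    next
      case (2 j)
      then show ?thesis using q[of j] q[of "Suc j"] h by (simp add: p_Suc algebra_simps)
    next
      case (3 j)
      then have "real (Suc j) * h = T" using h by simp
      moreover have "p k = q j" "p (Suc k) = T" using 3 by (auto simp: p_def)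
      ultimately show ?thesis using q[of j] h by (simp add: algebra_simps)
    qed
    then show "p k \<le> p (Suc k)" "p (Suc k) - p k \<le> d" by auto
  next
    fix k assume "k \<in> {1..n}"
    then obtain j where "k = Suc j" "j < n" by (cases k) auto
    then show "0 \<le> p k" "p k \<le> T" "p k \<notin> B" using ge_0 le_T q by (auto simp: p_Suc)
  qed (auto simp: p_def n)
qed

text \<open>
  On a fine partition that avoids \<open>B\<close> the integrals are close to sums that use only times of
  convergence. The time \<open>0\<close>, which may belong to \<open>B\<close>, drops out: the initial jump and the first
  increment carry the same weight \<open>\<phi> 0\<close>, and together they contribute \<open>\<phi> 0\<close> times the value at the
  first later partition point.
\<close>

lemma stieltjes_integral_tendsto:
  assumes T: "T > 0" and x: "increasing_path T x" and y: "\<And>m. increasing_path T (y m)"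
    and \<phi>: "continuous_on {0..T} \<phi>" and B: "countable B" "T \<notin> B"
    and lim: "\<And>t. t \<in> {0..T} \<Longrightarrow> t \<notin> B \<Longrightarrow> (\<lambda>m. y m t) \<longlonglongrightarrow> x t"
  shows "(\<lambda>m. stieltjes_integral T \<phi> (y m) T) \<longlonglongrightarrow> stieltjes_integral T \<phi> x T"
proof (rule LIMSEQ_I)
  fix r :: real assume r: "r > 0"
  have xT: "0 \<le> x T" using increasing_pathD(2)[OF x] T by simp
  define e where "e = r / (3 * (x T + 1))"
  have e: "e > 0" using r xT by (simp add: e_def)
  have e_x: "e * x T \<le> r / 3" "e * (x T + 1) = r / 3"
  proof -
    show "e * (x T + 1) = r / 3" using xT by (simp add: e_def field_simps)
    then show "e * x T \<le> r / 3" using e by (simp add: algebra_simps)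
  qed
  obtain d where d: "d > 0" "\<And>a b s. 0 \<le> a \<Longrightarrow> b \<le> T \<Longrightarrow> b - a \<le> d \<Longrightarrow> s \<in> {a..b} \<Longrightarrow> \<bar>\<phi> s - \<phi> a\<bar> \<le> e"
    using uniformly_continuous_path[OF \<phi> e] by blast
  obtain n p where p: "p 0 = 0" "p (Suc n) = T" "\<And>k. k \<le> n \<Longrightarrow> p k \<le> p (Suc k) \<and> p (Suc k) - p k \<le> d"
    and p_in: "\<And>k. k \<in> {1..n} \<Longrightarrow> 0 \<le> p k \<and> p k \<le> T \<and> p k \<notin> B"
    using partition_avoiding_countable[OF T d(1) B(1)] by blast
  have p_good: "p k \<in> {0..T}" "k > 0 \<Longrightarrow> p k \<notin> B" if "k \<le> Suc n" for k
    using that p p_in[of k] T B(2) by (auto simp: le_Suc_eq) (cases "k = 0"; auto)+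
  define R where "R z = \<phi> 0 * z (p 1) + (\<Sum>k\<in>{1..<Suc n}. \<phi> (p k) * (z (p (Suc k)) - z (p k)))" for z :: "real \<Rightarrow> real"
  have est: "\<bar>stieltjes_integral T \<phi> z T - R z\<bar> \<le> e * z T" if z: "increasing_path T z" for z
  proof -
    have "R z = \<phi> 0 * z 0 + (\<Sum>k<Suc n. \<phi> (p k) * (z (p (Suc k)) - z (p k)))"
      unfolding R_def using p(1)
      by (simp add: sum.lessThan_Suc_shift sum.atLeast1_atMost_eq atLeastLessThanSuc_atLeastAtMost algebra_simps del: sum.lessThan_Suc)
    moreover have "\<bar>stieltjes_integral T \<phi> z (p (Suc n)) - (\<phi> 0 * z 0 + (\<Sum>k<Suc n. \<phi> (p k) * (z (p (Suc k)) - z (p k))))\<bar>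
      \<le> e * (z (p (Suc n)) - z 0)"
    proof (rule stieltjes_integral_partition[OF z \<phi>])
      fix k s assume "k < Suc n" "s \<in> {p k..p (Suc k)}"
      then show "\<bar>\<phi> s - \<phi> (p k)\<bar> \<le> e"
        using d(2)[of "p k" "p (Suc k)" s] p(3)[of k] p_good[of k] p_good[of "Suc k"] by auto
    qed (use p in auto)
    moreover have "e * (z T - z 0) \<le> e * z T"
      using e T increasing_pathD(2)[OF z, of 0] by (intro mult_left_mono) auto
    ultimately show ?thesis using p(2) by simp
  qed
  have "(\<lambda>m. R (y m)) \<longlonglongrightarrow> R x"
    unfolding R_def using p_good by (intro tendsto_intros lim) auto
  moreover have "(\<lambda>m. e * y m T) \<longlonglongrightarrow> e * x T"
    using T B(2) by (intro tendsto_intros lim) auto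
  ultimately have "\<forall>\<^sub>F m in sequentially. dist (R (y m)) (R x) < r / 6"
    "\<forall>\<^sub>F m in sequentially. e * y m T < e * x T + r / 6"
    using r by (intro tendstoD order_tendstoD(2)[of _ "e * x T"]; simp)+
  then have "\<forall>\<^sub>F m in sequentially. norm (stieltjes_integral T \<phi> (y m) T - stieltjes_integral T \<phi> x T) < r"
  proof eventually_elim
    case (elim m)
    then show ?case using est[OF x] est[OF y[of m]] e_x(1) r unfolding real_norm_def dist_real_def by linarith
  qed
  then show "\<exists>no. \<forall>m\<ge>no. norm (stieltjes_integral T \<phi> (y m) T - stieltjes_integral T \<phi> x T) < r"
    unfolding eventually_sequentially .
qed

section \<open>Lattice operations and limits of increasing paths\<close>

text \<open>
  For nondecreasing \<open>\<sigma>\<close> this is the limit from the right at \<open>t < T\<close>, and the sampling times are chosen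
  so that the same formula gives \<open>\<sigma> T\<close> at \<open>t = T\<close>. The countable infimum keeps measurability visible.
\<close>

definition right_limit :: "real \<Rightarrow> (real \<Rightarrow> real) \<Rightarrow> real \<Rightarrow> real" where
  "right_limit T \<sigma> t = (INF k. \<sigma> (t + (T - t) / real (Suc k)))"

context
  fixes T :: real and \<sigma> :: "real \<Rightarrow> real"
  assumes mono: "mono_on {0..T} \<sigma>" and nonneg: "\<And>t. t \<in> {0..T} \<Longrightarrow> 0 \<le> \<sigma> t"
begin

lemma right_approach_in:
  assumes "0 \<le> t" "t \<le> T"
  shows "t + (T - t) / real (Suc k) \<in> {t..T}"
proof -
  have "(T - t) / real (Suc k) \<le> T - t" using assms by (simp add: divide_le_eq mult_le_cancel_left1)
  then show ?thesis using assms by simp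
qed

lemma right_limit_bdd:
  assumes "0 \<le> t" "t \<le> T"
  shows "bdd_below (range (\<lambda>k. \<sigma> (t + (T - t) / real (Suc k))))"
proof (rule bdd_belowI2)
  show "0 \<le> \<sigma> (t + (T - t) / real (Suc k))" for k
    using right_approach_in[OF assms, of k] assms(1) by (intro nonneg) auto
qed

lemma le_right_limit:
  assumes "0 \<le> t" "t \<le> T"
  shows "\<sigma> t \<le> right_limit T \<sigma> t"
  unfolding right_limit_def
proof (rule cINF_greatest)
  show "\<sigma> t \<le> \<sigma> (t + (T - t) / real (Suc k))" for k
    using right_approach_in[OF assms, of k] assms by (intro mono_onD[OF mono]) auto
qed simp

lemma right_limit_at_end [simp]: "right_limit T \<sigma> T = \<sigma> T"
  by (simp add: right_limit_def)

lemma right_approach_tendsto: "(\<lambda>k. t + (T - t) / real (Suc k)) \<longlonglongrightarrow> t"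
proof -
  have "(\<lambda>k. t + (T - t) * inverse (real (Suc k))) \<longlonglongrightarrow> t + (T - t) * 0"
    by (intro tendsto_intros LIMSEQ_inverse_real_of_nat)
  then show ?thesis by (simp add: field_simps)
qed

lemma right_limit_le:
  assumes "0 \<le> t" "t < u" "u \<le> T"
  shows "right_limit T \<sigma> t \<le> \<sigma> u"
proof -
  have t: "t \<le> T" using assms by simp
  have "\<forall>\<^sub>F k in sequentially. t + (T - t) / real (Suc k) < u"
    using order_tendstoD(2)[OF right_approach_tendsto assms(2)] .
  then obtain k where "t + (T - t) / real (Suc k) < u"
    by (auto simp: eventually_sequentially)
  then have "\<sigma> (t + (T - t) / real (Suc k)) \<le> \<sigma> u"
    using right_approach_in[OF assms(1) t, of k] assms by (intro mono_onD[OF mono]) auto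
  then show ?thesis
    unfolding right_limit_def using right_limit_bdd[OF assms(1) t] by (rule cINF_lower2[rotated 2]) auto
qed

lemma right_limit_tendsto:
  assumes "0 \<le> t" "t < T"
  shows "(\<sigma> \<longlongrightarrow> right_limit T \<sigma> t) (at_right t)"
proof (rule decreasing_tendsto)
  show "\<forall>\<^sub>F s in at_right t. right_limit T \<sigma> t \<le> \<sigma> s"
    using assms by (intro eventually_at_rightI[of t T] right_limit_le) auto
  fix c assume "right_limit T \<sigma> t < c"
  then obtain k where k: "\<sigma> (t + (T - t) / real (Suc k)) < c"
    unfolding right_limit_def using assms cINF_less_iff[OF _ right_limit_bdd[of t]] by auto
  show "\<forall>\<^sub>F s in at_right t. \<sigma> s < c"
  proof (rule eventually_at_rightI)
    show "t < t + (T - t) / real (Suc k)" using assms by simp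
    fix s assume s: "s \<in> {t<..<t + (T - t) / real (Suc k)}"
    have "\<sigma> s \<le> \<sigma> (t + (T - t) / real (Suc k))"
      using right_approach_in[of t k] assms s by (intro mono_onD[OF mono]) auto
    then show "\<sigma> s < c" using k by simp
  qed
qed

lemma right_limit_mono:
  assumes "0 \<le> s" "s \<le> t" "t \<le> T"
  shows "right_limit T \<sigma> s \<le> right_limit T \<sigma> t"
proof (cases "s = t")
  case False
  then have "right_limit T \<sigma> s \<le> \<sigma> t" using assms by (intro right_limit_le) auto
  also have "\<dots> \<le> right_limit T \<sigma> t" using assms by (intro le_right_limit) auto
  finally show ?thesis .
qed simp

lemma increasing_path_right_limit: "increasing_path T (right_limit T \<sigma>)"
  unfolding increasing_path_def
proof (intro conjI ballI)
  show "mono_on {0..T} (right_limit T \<sigma>)" by (intro mono_onI right_limit_mono) auto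
  show "0 \<le> right_limit T \<sigma> t" if "t \<in> {0..T}" for t
    using that le_right_limit[of t] nonneg[of t] by auto
  fix t assume t: "t \<in> {0..<T}"
  show "(right_limit T \<sigma> \<longlongrightarrow> right_limit T \<sigma> t) (at_right t)"
  proof (rule decreasing_tendsto)
    show "\<forall>\<^sub>F s in at_right t. right_limit T \<sigma> t \<le> right_limit T \<sigma> s"
      using t by (intro eventually_at_rightI[of t T] right_limit_mono) auto
    fix c assume c: "right_limit T \<sigma> t < c"
    obtain u where u: "u > t" "\<And>s. t < s \<Longrightarrow> s < u \<Longrightarrow> \<sigma> s < c"
      using order_tendstoD(2)[OF right_limit_tendsto c] t by (auto simp: eventually_at_right[of t T])
    define v where "v = (t + min u T) / 2"
    have v: "t < v" "v < u" "v < T" using u t by (auto simp: v_def min_def)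
    show "\<forall>\<^sub>F s in at_right t. right_limit T \<sigma> s < c"
    proof (rule eventually_at_rightI[OF _ v(1)])
      fix s assume s: "s \<in> {t<..<v}"
      have "right_limit T \<sigma> s \<le> \<sigma> v" using s t v by (intro right_limit_le) auto
      then show "right_limit T \<sigma> s < c" using u(2)[OF v(1,2)] by simp
    qed
  qed
qed

text \<open>
  Regularisation does not spoil the least upper bound, since the bounds \<open>b\<close> are right-continuous
  themselves.
\<close>

lemma right_limit_least:
  assumes b: "increasing_path T b" and le: "\<And>t. t \<in> {0..T} \<Longrightarrow> \<sigma> t \<le> b t" and t: "0 \<le> t" "t \<le> T"
  shows "right_limit T \<sigma> t \<le> b t"
proof (cases "t = T")
  case False
  then have "t < T" using t by simp
  have ev: "\<forall>\<^sub>F s in at_right t. \<sigma> s \<le> b s"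
    using t \<open>t < T\<close> by (intro eventually_at_rightI[of t T] le) auto
  show ?thesis
    by (rule tendsto_le[OF _ increasing_pathD(3)[OF b] right_limit_tendsto ev])
      (use t \<open>t < T\<close> in auto)
qed (use le t in auto)

lemma countable_right_limit_neq: "countable {t \<in> {0..T}. right_limit T \<sigma> t \<noteq> \<sigma> t}"
proof (rule countable_subset)
  show "countable {a\<in>{0..T}. \<not> continuous (at a within {0..T}) \<sigma>}"
    using mono by (rule mono_on_ctble_discont)
  show "{t \<in> {0..T}. right_limit T \<sigma> t \<noteq> \<sigma> t} \<subseteq> {a\<in>{0..T}. \<not> continuous (at a within {0..T}) \<sigma>}"
  proof safe
    fix t assume t: "t \<in> {0..T}" "right_limit T \<sigma> t \<noteq> \<sigma> t" "continuous (at t within {0..T}) \<sigma>"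
    then have "t < T" by (cases "t = T") auto
    have "(\<sigma> \<longlongrightarrow> \<sigma> t) (at t within {t..T})"
      using t(1,3) unfolding continuous_within by (elim tendsto_within_subset) auto
    then have "(\<sigma> \<longlongrightarrow> \<sigma> t) (at_right t)"
      using \<open>t < T\<close> by (simp add: at_within_Icc_at_right)
    moreover have "(\<sigma> \<longlongrightarrow> right_limit T \<sigma> t) (at_right t)"
      using t(1) \<open>t < T\<close> by (intro right_limit_tendsto) auto
    ultimately show False using t(2) tendsto_unique trivial_limit_at_right_real by blast
  qed
qed

text \<open>
  Only the values of \<open>\<sigma>\<close> in an arbitrarily short interval after \<open>t\<close> matter; this is how the value at \<open>t\<close>
  becomes known at every time later than \<open>t\<close>.
\<close>

lemma right_limit_tail:
  assumes "0 \<le> t" "t \<le> T"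
  shows "right_limit T \<sigma> t = (INF k. \<sigma> (t + (T - t) / real (Suc (k + m))))"
proof (rule antisym)
  have tail: "\<sigma> (t + (T - t) / real (Suc (k + m))) \<le> \<sigma> (t + (T - t) / real (Suc k))" for k
  proof (intro mono_onD[OF mono])
    show "t + (T - t) / real (Suc (k + m)) \<le> t + (T - t) / real (Suc k)"
      using assms by (intro add_left_mono divide_left_mono) auto
  qed (use right_approach_in[OF assms, of k] right_approach_in[OF assms, of "k + m"] assms in auto)
  show "right_limit T \<sigma> t \<le> (INF k. \<sigma> (t + (T - t) / real (Suc (k + m))))"
    unfolding right_limit_def by (intro cINF_greatest cINF_lower right_limit_bdd assms) auto
  show "(INF k. \<sigma> (t + (T - t) / real (Suc (k + m)))) \<le> right_limit T \<sigma> t"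
    unfolding right_limit_def
  proof (rule cINF_mono)
    show "bdd_below (range (\<lambda>k. \<sigma> (t + (T - t) / real (Suc (k + m)))))"
    proof (rule bdd_belowI2)
      show "0 \<le> \<sigma> (t + (T - t) / real (Suc (k + m)))" for k
        using right_approach_in[OF assms, of "k + m"] assms(1) by (intro nonneg) auto
    qed
  qed (use tail in auto)
qed

end

lemma increasing_path_max:
  assumes "increasing_path T x" "increasing_path T y"
  shows "increasing_path T (\<lambda>t. max (x t) (y t))"
  unfolding increasing_path_def
proof (intro conjI ballI mono_onI)
  show "max (x s) (y s) \<le> max (x t) (y t)" if "s \<in> {0..T}" "t \<in> {0..T}" "s \<le> t" for s t
    using that increasing_pathD(1)[OF assms(1), of s t] increasing_pathD(1)[OF assms(2), of s t] by auto
  show "0 \<le> max (x t) (y t)" if "t \<in> {0..T}" for t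
    using that increasing_pathD(2)[OF assms(1), of t] by auto
qed (auto intro!: tendsto_max increasing_pathD(3) assms)

lemma increasing_path_min:
  assumes "increasing_path T x" "increasing_path T y"
  shows "increasing_path T (\<lambda>t. min (x t) (y t))"
  unfolding increasing_path_def
proof (intro conjI ballI mono_onI)
  show "min (x s) (y s) \<le> min (x t) (y t)" if "s \<in> {0..T}" "t \<in> {0..T}" "s \<le> t" for s t
    using that increasing_pathD(1)[OF assms(1), of s t] increasing_pathD(1)[OF assms(2), of s t] by auto
  show "0 \<le> min (x t) (y t)" if "t \<in> {0..T}" for t
    using that increasing_pathD(2)[OF assms(1), of t] increasing_pathD(2)[OF assms(2), of t] by auto
qed (auto intro!: tendsto_min increasing_pathD(3) assms)

lemma increasing_path_0: "increasing_path T (\<lambda>_. 0)"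
  by (auto simp: increasing_path_def mono_on_def)

lemma bdd_below_paths:
  assumes "\<And>n. increasing_path T (y n)" "0 \<le> t" "t \<le> T"
  shows "bdd_below (range (\<lambda>n. y n t))"
  using increasing_pathD(2)[OF assms(1)] assms by (intro bdd_belowI2[of _ 0]) auto

text \<open>
  An infimum of upper semicontinuous functions is upper semicontinuous, which for nondecreasing
  functions is right-continuity. Unlike a supremum, an infimum thus needs no regularisation.
\<close>

lemma increasing_path_INF:
  assumes y: "\<And>n::nat. increasing_path T (y n)"
  shows "increasing_path T (\<lambda>t. INF n. y n t)"
  unfolding increasing_path_def
proof (intro conjI ballI mono_onI)
  have mono: "(INF n. y n s) \<le> (INF n. y n t)" if "0 \<le> s" "s \<le> t" "t \<le> T" for s t
  proof (rule cINF_mono)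
    show "bdd_below (range (\<lambda>n. y n s))" using that by (intro bdd_below_paths[OF y]) auto
    show "\<exists>m\<in>UNIV. y m s \<le> y n t" for n
      using increasing_pathD(1)[OF y that, of n] by blast
  qed simp
  then show "(INF n. y n s) \<le> (INF n. y n t)" if "s \<in> {0..T}" "t \<in> {0..T}" "s \<le> t" for s t
    using that by auto
  show "0 \<le> (INF n. y n t)" if "t \<in> {0..T}" for t
    using that by (intro cINF_greatest increasing_pathD(2)[OF y]) auto
  fix t assume t: "t \<in> {0..<T}"
  show "((\<lambda>t. INF n. y n t) \<longlongrightarrow> (INF n. y n t)) (at_right t)"
  proof (rule decreasing_tendsto)
    show "\<forall>\<^sub>F s in at_right t. (INF n. y n t) \<le> (INF n. y n s)"
      using t by (intro eventually_at_rightI[of t T] mono) auto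
    fix c assume "(INF n. y n t) < c"
    then obtain n where n: "y n t < c"
      using t cINF_less_iff[OF _ bdd_below_paths[of T y t, OF y]] by auto
    have "\<forall>\<^sub>F s in at_right t. y n s < c"
      using t by (intro order_tendstoD(2)[OF increasing_pathD(3)[OF y] n]) auto
    moreover have "\<forall>\<^sub>F s in at_right t. s \<in> {t<..<T}"
      using t by (intro eventually_at_rightI[of t T]) auto
    ultimately show "\<forall>\<^sub>F s in at_right t. (INF n. y n s) < c"
    proof eventually_elim
      case (elim s)
      then have "(INF n. y n s) \<le> y n s"
        using t by (intro cINF_lower bdd_below_paths[OF y]) auto
      then show ?case using elim by simp
    qed
  qed
qed

lemma bdd_above_paths:
  assumes y: "\<And>n::nat. increasing_path T (y n)" and bdd: "bdd_above (range (\<lambda>n. y n T))"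
    and "0 \<le> t" "t \<le> T"
  shows "bdd_above (range (\<lambda>n. y n t))"
proof -
  obtain c where "\<And>n. y n T \<le> c" using bdd by (auto simp: bdd_above_def)
  then show ?thesis
    using increasing_pathD(1)[OF y assms(3,4)] by (intro bdd_aboveI2[of _ _ c]) (auto intro: order_trans)
qed

lemma SUP_path:
  assumes y: "\<And>n::nat. increasing_path T (y n)" and bdd: "bdd_above (range (\<lambda>n. y n T))"
  shows "mono_on {0..T} (\<lambda>t. SUP n. y n t)" "t \<in> {0..T} \<Longrightarrow> 0 \<le> (SUP n. y n t)"
proof -
  show "mono_on {0..T} (\<lambda>t. SUP n. y n t)"
  proof (intro mono_onI cSUP_mono)
    fix s t n assume st: "s \<in> {0..T}" "t \<in> {0..T}" "s \<le> t"
    show "bdd_above (range (\<lambda>n. y n t))" using st by (intro bdd_above_paths[OF y bdd]) auto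
    show "\<exists>m\<in>UNIV. y n s \<le> y m t"
      using st increasing_pathD(1)[OF y, of s t n] by auto
  qed simp
  show "0 \<le> (SUP n. y n t)" if "t \<in> {0..T}"
  proof (rule cSUP_upper2)
    show "bdd_above (range (\<lambda>n. y n t))" using that by (intro bdd_above_paths[OF y bdd]) auto
    show "0 \<le> y 0 t" using that by (intro increasing_pathD(2)[OF y]) auto
  qed simp
qed

lemma increasing_path_add:
  assumes "increasing_path T x" "increasing_path T y"
  shows "increasing_path T (\<lambda>t. x t + y t)"
  unfolding increasing_path_def
proof (intro conjI ballI mono_onI)
  show "x s + y s \<le> x t + y t" if "s \<in> {0..T}" "t \<in> {0..T}" "s \<le> t" for s t
    using that by (intro add_mono increasing_pathD(1)[OF assms(1)] increasing_pathD(1)[OF assms(2)]) auto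
  show "0 \<le> x t + y t" if "t \<in> {0..T}" for t
    using that by (intro add_nonneg_nonneg increasing_pathD(2)[OF assms(1)] increasing_pathD(2)[OF assms(2)]) auto
qed (auto intro!: tendsto_add increasing_pathD(3) assms)

text \<open>
  The integral is additive in the integrator and \<open>max a b + min a b = a + b\<close>: the cost of control is
  modular.
\<close>

lemma stieltjes_integral_max_min:
  assumes x: "increasing_path T x" and y: "increasing_path T y"
    and \<phi>: "continuous_on {0..T} \<phi>" and t: "0 \<le> t" "t \<le> T"
  shows "stieltjes_integral T \<phi> (\<lambda>s. max (x s) (y s)) t + stieltjes_integral T \<phi> (\<lambda>s. min (x s) (y s)) t
    = stieltjes_integral T \<phi> x t + stieltjes_integral T \<phi> y t"
proof -
  note xy = increasing_path_add[OF x y]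
  have "stieltjes_integral T \<phi> (\<lambda>s. x s + y s) t
      = stieltjes_integral T \<phi> (\<lambda>s. max (x s) (y s)) t + stieltjes_integral T \<phi> (\<lambda>s. min (x s) (y s)) t"
    by (rule stieltjes_integral_add[OF increasing_path_max[OF x y] increasing_path_min[OF x y] xy _ \<phi> t])
      (simp add: max_def min_def)
  moreover have "stieltjes_integral T \<phi> (\<lambda>s. x s + y s) t = stieltjes_integral T \<phi> x t + stieltjes_integral T \<phi> y t"
    by (rule stieltjes_integral_add[OF x y xy _ \<phi> t]) simp
  ultimately show ?thesis by simp
qed

lemma stieltjes_integral_zero_path:
  assumes "continuous_on {0..T} \<phi>" "0 \<le> t" "t \<le> T"
  shows "stieltjes_integral T \<phi> (\<lambda>_. 0) t = 0"
  using stieltjes_integral_add[OF increasing_path_0 increasing_path_0 increasing_path_0 _ assms] by simp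

lemma stieltjes_integral_cong:
  assumes "0 \<le> T" "\<And>s. s \<in> {0..T} \<Longrightarrow> x s = y s"
  shows "stieltjes_integral T \<phi> x t = stieltjes_integral T \<phi> y t"
proof -
  have "(\<lambda>s. x (max 0 (min s T))) = (\<lambda>s. y (max 0 (min s T)))" using assms by auto
  moreover have "x 0 = y 0" using assms by auto
  ultimately show ?thesis unfolding stieltjes_integral_def by simp
qed

section \<open>The lattice of strategies\<close>

locale filtered_space = prob_space M
  for M :: "'w measure" and T :: real and F :: "real \<Rightarrow> 'w measure" +
  assumes T_pos: "0 < T" and usual: "usual_filtration M T F"
begin

lemma space_F: "t \<in> {0..T} \<Longrightarrow> space (F t) = space M"
  using usual by (auto simp: usual_filtration_def subalgebra_def)

lemma measurable_F_mono:
  assumes "X \<in> borel_measurable (F s)" "0 \<le> s" "s \<le> t" "t \<le> T"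
  shows "X \<in> borel_measurable (F t)"
proof (rule measurable_from_subalg[OF _ assms(1)])
  show "subalgebra (F t) (F s)"
    using assms usual space_F[of s] space_F[of t] unfolding usual_filtration_def subalgebra_def by auto
qed

lemma measurable_F_M:
  assumes "X \<in> borel_measurable (F t)" "t \<in> {0..T}"
  shows "X \<in> borel_measurable M"
  using assms usual unfolding usual_filtration_def by (intro measurable_from_subalg[OF _ assms(1)]) auto

lemma adapted_measurable_M: "adapted T F X \<Longrightarrow> t \<in> {0..T} \<Longrightarrow> X t \<in> borel_measurable M"
  using measurable_F_M unfolding adapted_def by blast

lemma measurable_F_right_continuous:
  fixes X :: "'w \<Rightarrow> 'b::topological_space"
  assumes t: "0 \<le> t" "t < T" and X: "\<And>u. u \<in> {t<..T} \<Longrightarrow> X \<in> borel_measurable (F u)"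
  shows "X \<in> borel_measurable (F t)"
proof (rule measurableI)
  fix A :: "'b set" assume A: "A \<in> sets borel"
  have "X -` A \<inter> space (F t) \<in> sets (F u)" if u: "u \<in> {t<..T}" for u
  proof -
    have "X -` A \<inter> space (F u) \<in> sets (F u)" using X[OF u] A by (rule measurable_sets)
    then show ?thesis using u t by (simp add: space_F)
  qed
  then show "X -` A \<inter> space (F t) \<in> sets (F t)"
    using usual t unfolding usual_filtration_def by auto
qed simp

lemma admissible_iff:
  "\<xi> \<in> admissible M T F \<longleftrightarrow> adapted T F \<xi> \<and> (\<forall>\<omega>\<in>space M. increasing_path T (\<lambda>t. \<xi> t \<omega>))"
  unfolding admissible_def increasing_path_cadlag by auto

lemma admissible_path: "\<xi> \<in> admissible M T F \<Longrightarrow> \<omega> \<in> space M \<Longrightarrow> increasing_path T (\<lambda>t. \<xi> t \<omega>)"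
  by (simp add: admissible_iff)

lemma admissible_measurable: "\<xi> \<in> admissible M T F \<Longrightarrow> t \<in> {0..T} \<Longrightarrow> \<xi> t \<in> borel_measurable (F t)"
  by (simp add: admissible_iff adapted_def)

lemma admissible_0: "(\<lambda>_ _. 0) \<in> admissible M T F"
  by (simp add: admissible_iff adapted_def increasing_path_0)

lemma admissible_max:
  assumes "a \<in> admissible M T F" "b \<in> admissible M T F"
  shows "(\<lambda>t \<omega>. max (a t \<omega>) (b t \<omega>)) \<in> admissible M T F"
  using assms unfolding admissible_iff adapted_def
  by (auto intro!: increasing_path_max borel_measurable_max)

lemma admissible_min:
  assumes "a \<in> admissible M T F" "b \<in> admissible M T F"
  shows "(\<lambda>t \<omega>. min (a t \<omega>) (b t \<omega>)) \<in> admissible M T F"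
  using assms unfolding admissible_iff adapted_def
  by (auto intro!: increasing_path_min borel_measurable_min)

lemma admissible_stieltjes:
  assumes \<xi>: "\<xi> \<in> admissible M T F" and \<phi>: "adapted T F \<phi>"
    and cont: "\<And>\<omega>. \<omega> \<in> space M \<Longrightarrow> continuous_on {0..T} (\<lambda>s. \<phi> s \<omega>)"
    and nonneg: "\<And>\<omega> s. \<omega> \<in> space M \<Longrightarrow> s \<in> {0..T} \<Longrightarrow> 0 \<le> \<phi> s \<omega>"
  shows "(\<lambda>t \<omega>. stieltjes_integral T (\<lambda>s. \<phi> s \<omega>) (\<lambda>s. \<xi> s \<omega>) t) \<in> admissible M T F"
  unfolding admissible_iff adapted_def
proof (intro conjI ballI)
  show "increasing_path T (stieltjes_integral T (\<lambda>s. \<phi> s \<omega>) (\<lambda>s. \<xi> s \<omega>))" if "\<omega> \<in> space M" for \<omega>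
    using that by (intro increasing_path_stieltjes admissible_path[OF \<xi>] cont nonneg)
  fix t assume t: "t \<in> {0..T}"
  have meas: "\<xi> s \<in> borel_measurable (F t)" "\<phi> s \<in> borel_measurable (F t)" if "0 \<le> s" "s \<le> t" for s
    using that t admissible_measurable[OF \<xi>, of s] \<phi>
    by (auto intro!: measurable_F_mono[of _ s t] simp: adapted_def)
  have le: "t * real k / real (Suc n) \<le> t" "0 \<le> t * real k / real (Suc n)" if "k \<le> Suc n" for k n
  proof -
    have "t * real k \<le> t * real (Suc n)" using that t by (intro mult_left_mono) auto
    then show "t * real k / real (Suc n) \<le> t" by (simp add: divide_le_eq del: of_nat_Suc)
    show "0 \<le> t * real k / real (Suc n)" using t by simp
  qed
  show "(\<lambda>\<omega>. stieltjes_integral T (\<lambda>s. \<phi> s \<omega>) (\<lambda>s. \<xi> s \<omega>) t) \<in> borel_measurable (F t)"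
  proof (rule borel_measurable_LIMSEQ_real)
    show "(\<lambda>n. \<phi> 0 \<omega> * \<xi> 0 \<omega> + (\<Sum>k<Suc n. \<phi> (t * real k / real (Suc n)) \<omega> *
        (\<xi> (t * real (Suc k) / real (Suc n)) \<omega> - \<xi> (t * real k / real (Suc n)) \<omega>)))
       \<longlonglongrightarrow> stieltjes_integral T (\<lambda>s. \<phi> s \<omega>) (\<lambda>s. \<xi> s \<omega>) t" if "\<omega> \<in> space (F t)" for \<omega>
      using that t space_F[OF t] by (intro stieltjes_integral_riemann admissible_path[OF \<xi>] cont) auto
    show "(\<lambda>\<omega>. \<phi> 0 \<omega> * \<xi> 0 \<omega> + (\<Sum>k<Suc n. \<phi> (t * real k / real (Suc n)) \<omega> *
        (\<xi> (t * real (Suc k) / real (Suc n)) \<omega> - \<xi> (t * real k / real (Suc n)) \<omega>)))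
       \<in> borel_measurable (F t)" for n
      using t by (intro borel_measurable_add borel_measurable_times borel_measurable_sum
          borel_measurable_diff meas le) auto
  qed
qed

definition process_le :: "(real \<Rightarrow> 'w \<Rightarrow> real) \<Rightarrow> (real \<Rightarrow> 'w \<Rightarrow> real) \<Rightarrow> bool" where
  "process_le a b \<longleftrightarrow> (AE \<omega> in M. \<forall>t\<in>{0..T}. a t \<omega> \<le> b t \<omega>)"

text \<open>
  The mode of convergence that monotone limits of strategies enjoy. The terminal time must not be
  exceptional, as it carries a cost of its own.
\<close>

definition path_converges :: "(nat \<Rightarrow> real \<Rightarrow> real) \<Rightarrow> (real \<Rightarrow> real) \<Rightarrow> bool" where
  "path_converges y x \<longleftrightarrow>
     (\<exists>B. countable B \<and> T \<notin> B \<and> (\<forall>t\<in>{0..T} - B. (\<lambda>n. y n t) \<longlonglongrightarrow> x t))"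

text \<open>
  The regularised supremum at \<open>t\<close> is a limit of values at times after \<open>t\<close>, so it is measurable for
  every \<open>F u\<close> with \<open>u > t\<close> and hence for \<open>F t\<close>, by right-continuity of the filtration.
\<close>

lemma admissible_bounded_sup:
  assumes a: "\<And>n::nat. a n \<in> admissible M T F"
    and bdd: "\<And>\<omega>. \<omega> \<in> space M \<Longrightarrow> bdd_above (range (\<lambda>n. a n T \<omega>))"
  shows "(\<lambda>t \<omega>. right_limit T (\<lambda>s. SUP n. a n s \<omega>) t) \<in> admissible M T F"
  unfolding admissible_iff adapted_def
proof (intro conjI ballI)
  note path = admissible_path[OF a]
  have SUP_a: "mono_on {0..T} (\<lambda>t. SUP n. a n t \<omega>)" "t \<in> {0..T} \<Longrightarrow> 0 \<le> (SUP n. a n t \<omega>)"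
    if "\<omega> \<in> space M" for \<omega> t
    using SUP_path[of T "\<lambda>n t. a n t \<omega>"] path bdd that by auto
  show "increasing_path T (right_limit T (\<lambda>s. SUP n. a n s \<omega>))" if "\<omega> \<in> space M" for \<omega>
    using that by (intro increasing_path_right_limit SUP_a)
  have meas_SUP: "(\<lambda>\<omega>. SUP n. a n s \<omega>) \<in> borel_measurable (F u)" if "0 \<le> s" "s \<le> u" "u \<le> T" for s u
  proof (rule borel_measurable_cSUP)
    show "a n s \<in> borel_measurable (F u)" for n
      using that by (intro measurable_F_mono[OF admissible_measurable[OF a]]) auto
    show "bdd_above ((\<lambda>n. a n s \<omega>) ` UNIV)" if "\<omega> \<in> space (F u)" for \<omega>
      using that \<open>0 \<le> s\<close> \<open>s \<le> u\<close> \<open>u \<le> T\<close> space_F[of u]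
      by (intro bdd_above_paths[of T "\<lambda>n t. a n t \<omega>", OF path bdd]) auto
  qed simp
  fix t assume t: "t \<in> {0..T}"
  show "(\<lambda>\<omega>. right_limit T (\<lambda>s. SUP n. a n s \<omega>) t) \<in> borel_measurable (F t)"
  proof (cases "t = T")
    case True
    then show ?thesis using meas_SUP[of T T] T_pos by (simp add: right_limit_def)
  next
    case False
    then have "0 \<le> t" "t < T" using t by auto
    then show ?thesis
    proof (rule measurable_F_right_continuous)
      fix u assume u: "u \<in> {t<..T}"
      have in_T: "t + (T - t) / real (Suc k) \<in> {t..T}" for k
      proof -
        have "(T - t) / real (Suc k) \<le> T - t" using t by (simp add: divide_le_eq mult_le_cancel_left1)
        then show ?thesis using t by simp
      qed
      obtain m :: nat where m: "(T - t) / (u - t) < m" using reals_Archimedean2 by blast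
      have le_u: "t + (T - t) / real (Suc (k + m)) \<le> u" for k
      proof -
        have "(T - t) / (u - t) < real (Suc (k + m))" using m by simp
        then have "(T - t) / real (Suc (k + m)) < u - t"
          using u by (simp add: divide_less_eq mult.commute del: of_nat_Suc)
        then show ?thesis by simp
      qed
      have "(\<lambda>\<omega>. INF k. SUP n. a n (t + (T - t) / real (Suc (k + m))) \<omega>) \<in> borel_measurable (F u)"
      proof (rule borel_measurable_cINF)
        show "(\<lambda>\<omega>. SUP n. a n (t + (T - t) / real (Suc (k + m))) \<omega>) \<in> borel_measurable (F u)" for k
          using le_u u t by (intro meas_SUP) auto
        show "bdd_below ((\<lambda>k. SUP n. a n (t + (T - t) / real (Suc (k + m))) \<omega>) ` UNIV)"
          if "\<omega> \<in> space (F u)" for \<omega>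
        proof (rule bdd_belowI2)
          fix k
          show "0 \<le> (SUP n. a n (t + (T - t) / real (Suc (k + m))) \<omega>)"
            using that u t space_F[of u] in_T[of "k + m"]
            by (intro SUP_a) auto
        qed
      qed simp
      moreover have "right_limit T (\<lambda>s. SUP n. a n s \<omega>) t = (INF k. SUP n. a n (t + (T - t) / real (Suc (k + m))) \<omega>)"
        if "\<omega> \<in> space (F u)" for \<omega>
        using that u t space_F[of u]
        by (intro right_limit_tail SUP_a) auto
      ultimately show "(\<lambda>\<omega>. right_limit T (\<lambda>s. SUP n. a n s \<omega>) t) \<in> borel_measurable (F u)"
        by (simp cong: measurable_cong)
    qed
  qed
qed

text \<open>
  Where the supremum is infinite, all strategies are reset to zero. This affects a null set, which
  belongs to \<open>F 0\<close> by the usual conditions, so adaptedness survives.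
\<close>

lemma process_sup_exists:
  assumes a: "\<And>n::nat. a n \<in> admissible M T F" and chain: "\<And>n. process_le (a n) (a (Suc n))"
    and bdd: "AE \<omega> in M. bdd_above (range (\<lambda>n. a n T \<omega>))"
  shows "\<exists>s\<in>admissible M T F. (\<forall>n. process_le (a n) s) \<and>
      (\<forall>b\<in>admissible M T F. (\<forall>n. process_le (a n) b) \<longrightarrow> process_le s b) \<and>
      (AE \<omega> in M. path_converges (\<lambda>n t. a n t \<omega>) (\<lambda>t. s t \<omega>))"
proof -
  \<comment> \<open>The scenarios in which the supremum is finite.\<close>
  define G where "G = {\<omega> \<in> space M. bdd_above (range (\<lambda>n. a n T \<omega>))}"
  obtain N where "N \<in> null_sets M" "{\<omega> \<in> space M. \<not> bdd_above (range (\<lambda>n. a n T \<omega>))} \<subseteq> N"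
    using bdd by (auto simp: eventually_ae_filter)
  then have N: "N \<in> null_sets M" "space M - G \<subseteq> N" by (auto simp: G_def)
  have "space M - G \<in> sets (F 0)" using usual N unfolding usual_filtration_def by blast
  then have "space (F 0) - (space M - G) \<in> sets (F 0)" by (rule sets.compl_sets)
  moreover have "space (F 0) - (space M - G) = G" using space_F[of 0] T_pos by (auto simp: G_def)
  ultimately have G0: "G \<in> sets (F 0)" by simp
  have G: "G \<in> sets (F t)" if "t \<in> {0..T}" for t
    using that G0 usual unfolding usual_filtration_def by auto
  define b where "b n t \<omega> = (if \<omega> \<in> G then a n t \<omega> else 0)" for n t \<omega>
  have b: "b n \<in> admissible M T F" for n
    unfolding admissible_iff adapted_def
  proof (intro conjI ballI)
    show "b n t \<in> borel_measurable (F t)" if "t \<in> {0..T}" for t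
      unfolding b_def using that G by (intro measurable_If_set admissible_measurable[of "a n"] a) auto
    show "increasing_path T (\<lambda>t. b n t \<omega>)" if "\<omega> \<in> space M" for \<omega>
      using that admissible_path[OF a] by (cases "\<omega> \<in> G") (auto simp: b_def increasing_path_0)
  qed
  note path = admissible_path[OF b]
  have b_bdd: "bdd_above (range (\<lambda>n. b n T \<omega>))" if "\<omega> \<in> space M" for \<omega>
    using that by (cases "\<omega> \<in> G") (auto simp: b_def G_def)
  have b_bdd_t: "bdd_above (range (\<lambda>n. b n t \<omega>))" if "\<omega> \<in> space M" "t \<in> {0..T}" for t \<omega>
    using that bdd_above_paths[of T "\<lambda>n t. b n t \<omega>" t, OF path b_bdd] by auto
  define s where "s t \<omega> = right_limit T (\<lambda>s. SUP n. b n s \<omega>) t" for t \<omega>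
  have s_in: "s \<in> admissible M T F"
    unfolding s_def using b b_bdd by (rule admissible_bounded_sup)
  have AE_G: "AE \<omega> in M. \<omega> \<in> G"
    using bdd by (rule AE_mp) (auto intro!: AE_I2 simp: G_def)
  have AE_chain: "AE \<omega> in M. \<forall>n. \<forall>t\<in>{0..T}. a n t \<omega> \<le> a (Suc n) t \<omega>"
    using chain unfolding process_le_def AE_all_countable by simp
  have SUP_b: "mono_on {0..T} (\<lambda>t. SUP n. b n t \<omega>)" "t \<in> {0..T} \<Longrightarrow> 0 \<le> (SUP n. b n t \<omega>)"
    if "\<omega> \<in> space M" for \<omega> t
    using SUP_path[of T "\<lambda>n t. b n t \<omega>"] path b_bdd that by auto
  have "process_le (a n) s" for n
    unfolding process_le_def using AE_G AE_space
  proof eventually_elim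
    case (elim \<omega>)
    show ?case
    proof
      fix t assume t: "t \<in> {0..T}"
      have "a n t \<omega> = b n t \<omega>" using elim by (simp add: b_def)
      also have "\<dots> \<le> (SUP n. b n t \<omega>)"
        using t elim by (intro cSUP_upper b_bdd_t) auto
      also have "\<dots> \<le> s t \<omega>" unfolding s_def
        using t elim by (intro le_right_limit[where \<sigma> = "\<lambda>s. SUP n. b n s \<omega>"] SUP_b) auto
      finally show "a n t \<omega> \<le> s t \<omega>" .
    qed
  qed
  moreover have "process_le s c" if c: "c \<in> admissible M T F" and le: "\<And>n. process_le (a n) c" for c
  proof -
    have "AE \<omega> in M. \<forall>n. \<forall>t\<in>{0..T}. a n t \<omega> \<le> c t \<omega>"
      using le unfolding process_le_def AE_all_countable by simp
    then show ?thesis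
      unfolding process_le_def using AE_G AE_space
    proof eventually_elim
      case (elim \<omega>)
      show ?case
      proof
        fix t assume t: "t \<in> {0..T}"
        show "s t \<omega> \<le> c t \<omega>"
          unfolding s_def
        proof (rule right_limit_least)
          show "increasing_path T (\<lambda>t. c t \<omega>)" using c elim by (intro admissible_path)
          show "(SUP n. b n t \<omega>) \<le> c t \<omega>" if "t \<in> {0..T}" for t
            using that elim by (intro cSUP_least) (auto simp: b_def)
        qed (use t elim SUP_b in auto)
      qed
    qed
  qed
  moreover have "AE \<omega> in M. path_converges (\<lambda>n t. a n t \<omega>) (\<lambda>t. s t \<omega>)"
    using AE_G AE_chain AE_space
  proof eventually_elim
    case (elim \<omega>)
    define B where "B = {t \<in> {0..T}. s t \<omega> \<noteq> (SUP n. b n t \<omega>)}"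
    have "countable B"
      unfolding B_def s_def using elim by (intro countable_right_limit_neq SUP_b) auto
    moreover have "T \<notin> B" by (simp add: B_def s_def right_limit_def)
    moreover have "(\<lambda>n. a n t \<omega>) \<longlonglongrightarrow> s t \<omega>" if t: "t \<in> {0..T} - B" for t
    proof -
      have "(\<lambda>n. b n t \<omega>) \<longlonglongrightarrow> (SUP n. b n t \<omega>)"
      proof (rule LIMSEQ_incseq_SUP)
        show "bdd_above (range (\<lambda>n. b n t \<omega>))"
          using t elim by (intro b_bdd_t) auto
        show "incseq (\<lambda>n. b n t \<omega>)"
          using t elim by (intro incseq_SucI) (auto simp: b_def)
      qed
      then show ?thesis using t elim by (simp add: b_def B_def)
    qed
    ultimately show ?case unfolding path_converges_def by blast
  qed
  ultimately show ?thesis using s_in by blast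
qed

lemma process_inf_exists:
  assumes a: "\<And>n::nat. a n \<in> admissible M T F" and chain: "\<And>n. process_le (a (Suc n)) (a n)"
  shows "\<exists>s\<in>admissible M T F. AE \<omega> in M. path_converges (\<lambda>n t. a n t \<omega>) (\<lambda>t. s t \<omega>)"
proof (rule bexI)
  note path = admissible_path[OF a]
  show "(\<lambda>t \<omega>. INF n. a n t \<omega>) \<in> admissible M T F"
    unfolding admissible_iff adapted_def
  proof (intro conjI ballI)
    show "increasing_path T (\<lambda>t. INF n. a n t \<omega>)" if "\<omega> \<in> space M" for \<omega>
      using that by (intro increasing_path_INF[of T "\<lambda>n t. a n t \<omega>"] path)
    show "(\<lambda>\<omega>. INF n. a n t \<omega>) \<in> borel_measurable (F t)" if "t \<in> {0..T}" for t
    proof (rule borel_measurable_cINF)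
      show "bdd_below (range (\<lambda>n. a n t \<omega>))" if "\<omega> \<in> space (F t)" for \<omega>
        using that \<open>t \<in> {0..T}\<close> space_F[of t] by (intro bdd_below_paths[of T "\<lambda>n t. a n t \<omega>"] path) auto
    qed (use that in \<open>auto intro: admissible_measurable a\<close>)
  qed
  have "AE \<omega> in M. \<forall>n. \<forall>t\<in>{0..T}. a (Suc n) t \<omega> \<le> a n t \<omega>"
    using chain unfolding process_le_def AE_all_countable by simp
  then show "AE \<omega> in M. path_converges (\<lambda>n t. a n t \<omega>) (\<lambda>t. INF n. a n t \<omega>)"
    using AE_space
  proof eventually_elim
    case (elim \<omega>)
    have "(\<lambda>n. a n t \<omega>) \<longlonglongrightarrow> (INF n. a n t \<omega>)" if "t \<in> {0..T}" for t
      using that elim by (intro LIMSEQ_decseq_INF bdd_below_paths[of T "\<lambda>n t. a n t \<omega>"] path decseq_SucI) auto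
    then show ?case unfolding path_converges_def by (intro exI[of _ "{}"]) auto
  qed
qed

definition sample_time :: "nat \<Rightarrow> real" where
  "sample_time k = max 0 (min T (real_of_rat (from_nat k)))"

lemma sample_time_in: "sample_time k \<in> {0..T}"
  using T_pos by (auto simp: sample_time_def)

text \<open>
  The sampling times are dense and include \<open>T\<close>, since all rationals beyond \<open>T\<close> are mapped to \<open>T\<close>.
\<close>

lemma eq_at_sample_times:
  assumes x: "increasing_path T x" and y: "increasing_path T y"
    and eq: "\<And>k. x (sample_time k) = y (sample_time k)" and t: "t \<in> {0..T}"
  shows "x t = y t"
proof (cases "t = T")
  case True
  obtain q where "T < real_of_rat q" using of_rat_dense[of T "T + 1"] by auto
  then have "sample_time (to_nat q) = T" using T_pos by (simp add: sample_time_def)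
  then show ?thesis using eq[of "to_nat q"] True by simp
next
  case False
  then have t: "0 \<le> t" "t < T" using t by auto
  have "x t \<le> y u \<and> y t \<le> x u" if u: "t < u" "u < T" for u
  proof -
    obtain q where "t < real_of_rat q" "real_of_rat q < u" using of_rat_dense[OF u(1)] by blast
    moreover define r where "r = (real_of_rat q :: real)"
    ultimately have r: "t \<le> r" "r \<le> u" by simp_all
    have k: "sample_time (to_nat q) = r" using t u r by (simp add: sample_time_def r_def)
    have "x t \<le> x r" "x r \<le> x u" using r t u by (auto intro!: increasing_pathD(1)[OF x])
    moreover have "y t \<le> y r" "y r \<le> y u" using r t u by (auto intro!: increasing_pathD(1)[OF y])
    ultimately show ?thesis using eq[of "to_nat q"] by (simp add: k)
  qed
  then have ev: "\<forall>\<^sub>F u in at_right t. x t \<le> y u" "\<forall>\<^sub>F u in at_right t. y t \<le> x u"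
    using t by (auto intro!: eventually_at_rightI[of t T])
  have "x t \<le> y t" by (rule tendsto_lowerbound[OF increasing_pathD(3)[OF y t] ev(1)]) simp
  moreover have "y t \<le> x t" by (rule tendsto_lowerbound[OF increasing_pathD(3)[OF x t] ev(2)]) simp
  ultimately show ?thesis by simp
qed

text \<open>
  A bounded functional that is strictly increasing for the almost sure order: the weights are
  summable, \<open>1 - exp (- x)\<close> is strictly increasing and bounded on \<open>[0,\<infinity>)\<close>, and a strategy is determined
  by its values at the sampling times.
\<close>

definition size_functional :: "(real \<Rightarrow> 'w \<Rightarrow> real) \<Rightarrow> real" where
  "size_functional a = (\<Sum>k. (1/2) ^ k * expectation (\<lambda>\<omega>. 1 - exp (- a (sample_time k) \<omega>)))"

lemma sample_integrable:
  assumes a: "a \<in> admissible M T F"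
  shows "integrable M (\<lambda>\<omega>. 1 - exp (- a (sample_time k) \<omega>))"
    "expectation (\<lambda>\<omega>. 1 - exp (- a (sample_time k) \<omega>)) \<in> {0..1}"
proof -
  have bounds: "0 \<le> 1 - exp (- a (sample_time k) \<omega>)" "1 - exp (- a (sample_time k) \<omega>) \<le> 1"
    if "\<omega> \<in> space M" for \<omega>
    using increasing_pathD(2)[OF admissible_path[OF a that], of "sample_time k"] sample_time_in[of k] by auto
  have "a (sample_time k) \<in> borel_measurable M"
    using measurable_F_M[OF admissible_measurable[OF a sample_time_in] sample_time_in] .
  then show int: "integrable M (\<lambda>\<omega>. 1 - exp (- a (sample_time k) \<omega>))"
    using bounds by (intro integrable_const_bound[where B = 1]) auto
  have "expectation (\<lambda>\<omega>. 1 - exp (- a (sample_time k) \<omega>)) \<le> expectation (\<lambda>\<omega>. 1)"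
    using bounds by (intro integral_mono int) auto
  moreover have "0 \<le> expectation (\<lambda>\<omega>. 1 - exp (- a (sample_time k) \<omega>))"
    using bounds by (intro integral_nonneg_AE AE_I2) auto
  ultimately show "expectation (\<lambda>\<omega>. 1 - exp (- a (sample_time k) \<omega>)) \<in> {0..1}"
    by (simp add: prob_space)
qed

lemma size_functional_summable:
  assumes "a \<in> admissible M T F"
  shows "summable (\<lambda>k. (1/2) ^ k * expectation (\<lambda>\<omega>. 1 - exp (- a (sample_time k) \<omega>)))"
proof (rule summable_comparison_test)
  show "summable (\<lambda>k. (1/2 :: real) ^ k)" by simp
  show "\<exists>N. \<forall>k\<ge>N. norm ((1/2) ^ k * expectation (\<lambda>\<omega>. 1 - exp (- a (sample_time k) \<omega>))) \<le> (1/2) ^ k"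
    using sample_integrable(2)[OF assms] by (auto simp: abs_mult intro!: mult_left_le)
qed

lemma size_functional_le: "a \<in> admissible M T F \<Longrightarrow> size_functional a \<le> 2"
proof -
  assume a: "a \<in> admissible M T F"
  have "size_functional a \<le> (\<Sum>k. (1/2 :: real) ^ k)"
    unfolding size_functional_def using sample_integrable(2)[OF a]
    by (intro suminf_le size_functional_summable a) (auto intro!: mult_left_le)
  also have "\<dots> = 2" by (subst suminf_geometric) auto
  finally show ?thesis .
qed

lemma sample_mono:
  assumes "a \<in> admissible M T F" "b \<in> admissible M T F" "process_le a b"
  shows "AE \<omega> in M. 1 - exp (- a (sample_time k) \<omega>) \<le> 1 - exp (- b (sample_time k) \<omega>)"
    "expectation (\<lambda>\<omega>. 1 - exp (- a (sample_time k) \<omega>)) \<le> expectation (\<lambda>\<omega>. 1 - exp (- b (sample_time k) \<omega>))"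
proof -
  show le: "AE \<omega> in M. 1 - exp (- a (sample_time k) \<omega>) \<le> 1 - exp (- b (sample_time k) \<omega>)"
    using assms(3) unfolding process_le_def by eventually_elim (use sample_time_in[of k] in auto)
  show "expectation (\<lambda>\<omega>. 1 - exp (- a (sample_time k) \<omega>)) \<le> expectation (\<lambda>\<omega>. 1 - exp (- b (sample_time k) \<omega>))"
    by (intro integral_mono_AE le sample_integrable assms)
qed

lemma size_functional_mono:
  assumes "a \<in> admissible M T F" "b \<in> admissible M T F" "process_le a b"
  shows "size_functional a \<le> size_functional b"
  unfolding size_functional_def
proof (rule suminf_le)
  show "(1/2) ^ k * expectation (\<lambda>\<omega>. 1 - exp (- a (sample_time k) \<omega>))
      \<le> (1/2) ^ k * expectation (\<lambda>\<omega>. 1 - exp (- b (sample_time k) \<omega>))" for k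
    using sample_mono(2)[OF assms] by (rule mult_left_mono) simp
qed (intro size_functional_summable assms)+

text \<open>
  The difference of the two functionals is a series with nonnegative terms, so it vanishes term by
  term, and each term is the expectation of a nonnegative variable.
\<close>

lemma size_functional_strict:
  assumes a: "a \<in> admissible M T F" and b: "b \<in> admissible M T F" and le: "process_le a b"
    and size: "size_functional b \<le> size_functional a"
  shows "AE \<omega> in M. \<forall>t\<in>{0..T}. a t \<omega> = b t \<omega>"
proof -
  define D where "D k = (1/2) ^ k * expectation (\<lambda>\<omega>. 1 - exp (- b (sample_time k) \<omega>))
    - (1/2) ^ k * expectation (\<lambda>\<omega>. 1 - exp (- a (sample_time k) \<omega>))" for k
  have D_summable: "summable D"
    unfolding D_def by (intro summable_diff size_functional_summable a b)
  have D_nonneg: "0 \<le> D k" for k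
    unfolding D_def using sample_mono(2)[OF a b le, of k] by (simp add: mult_left_mono)
  have "suminf D = size_functional b - size_functional a"
    unfolding D_def size_functional_def by (intro suminf_diff[symmetric] size_functional_summable a b)
  then have "suminf D = 0" using size suminf_nonneg[OF D_summable D_nonneg] by simp
  then have D_0: "D k = 0" for k using suminf_eq_zero_iff[OF D_summable D_nonneg] by simp
  have "AE \<omega> in M. a (sample_time k) \<omega> = b (sample_time k) \<omega>" for k
  proof -
    define u where "u c \<omega> = 1 - exp (- c (sample_time k) \<omega>)" for c :: "real \<Rightarrow> 'w \<Rightarrow> real" and \<omega>
    have int: "integrable M (u a)" "integrable M (u b)"
      unfolding u_def[abs_def] by (intro sample_integrable a b)+
    have "expectation (u b) = expectation (u a)" using D_0[of k] by (simp add: D_def u_def[abs_def])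
    then have "expectation (\<lambda>\<omega>. u b \<omega> - u a \<omega>) = 0"
      using Bochner_Integration.integral_diff[OF int(2,1)] by simp
    moreover have "AE \<omega> in M. 0 \<le> u b \<omega> - u a \<omega>"
      using sample_mono(1)[OF a b le, of k] unfolding u_def by eventually_elim simp
    ultimately have "AE \<omega> in M. u b \<omega> - u a \<omega> = 0"
      using integral_nonneg_eq_0_iff_AE[of M "\<lambda>\<omega>. u b \<omega> - u a \<omega>"] int by simp
    then show ?thesis by eventually_elim (simp add: u_def)
  qed
  then have "AE \<omega> in M. \<forall>k. a (sample_time k) \<omega> = b (sample_time k) \<omega>"
    by (simp add: AE_all_countable)
  then show ?thesis using AE_space
  proof eventually_elim
    case (elim \<omega>)
    then show ?case
      using eq_at_sample_times[OF admissible_path[OF a] admissible_path[OF b], of \<omega> \<omega>] by blast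
  qed
qed

lemma process_le_refl: "process_le a a"
  by (simp add: process_le_def)

lemma process_le_trans:
  assumes "process_le a b" "process_le b c"
  shows "process_le a c"
  using assms unfolding process_le_def
proof eventually_elim
  case (elim \<omega>)
  show ?case
  proof
    fix t assume "t \<in> {0..T}"
    then have "a t \<omega> \<le> b t \<omega>" "b t \<omega> \<le> c t \<omega>" using elim by simp_all
    then show "a t \<omega> \<le> c t \<omega>" by simp
  qed
qed

lemma process_le_max_min:
  "process_le a (\<lambda>t \<omega>. max (a t \<omega>) (b t \<omega>))" "process_le b (\<lambda>t \<omega>. max (a t \<omega>) (b t \<omega>))"
  by (simp_all add: process_le_def)

lemma process_le_max_least:
  assumes "process_le a c" "process_le b c"
  shows "process_le (\<lambda>t \<omega>. max (a t \<omega>) (b t \<omega>)) c"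
  using assms unfolding process_le_def by eventually_elim simp

lemma process_le_zero:
  assumes "a \<in> admissible M T F"
  shows "process_le (\<lambda>_ _. 0) a"
  unfolding process_le_def
proof (intro AE_I2 ballI)
  show "0 \<le> a t \<omega>" if "\<omega> \<in> space M" "t \<in> {0..T}" for t \<omega>
    using increasing_pathD(2)[OF admissible_path[OF assms that(1)]] that(2) by simp
qed

end

section \<open>The costs as functions of the discounted controls\<close>

lemma liminf_add_ennreal:
  fixes X Y :: "nat \<Rightarrow> ennreal"
  assumes "x \<le> liminf X" "y \<le> liminf Y"
  shows "x + y \<le> liminf (\<lambda>n. X n + Y n)"
proof -
  have "x + y \<le> liminf X + liminf Y" using assms by (rule add_mono)
  also have "\<dots> = (SUP n. (INF m\<in>{n..}. X m) + (INF m\<in>{n..}. Y m))"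
    unfolding liminf_SUP_INF
    by (rule ennreal_SUP_add[symmetric]) (auto intro!: incseq_SucI INF_superset_mono)
  also have "\<dots> \<le> (SUP n. INF m\<in>{n..}. X m + Y m)"
    by (intro SUP_mono' INF_greatest add_mono INF_lower)
  also have "\<dots> = liminf (\<lambda>n. X n + Y n)" by (simp add: liminf_SUP_INF)
  finally show ?thesis .
qed

text \<open>
  Sequential form of lower semicontinuity, phrased for extended values so that Fatou's lemma applies.
\<close>

lemma lower_semicontinuous_liminf:
  assumes \<phi>: "lower_semicontinuous \<phi>" and y: "y \<longlonglongrightarrow> x"
  shows "ennreal (\<phi> x) \<le> liminf (\<lambda>n. ennreal (\<phi> (y n)))"
  unfolding le_Liminf_iff
proof (intro allI impI)
  fix c assume c: "c < ennreal (\<phi> x)"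
  then obtain r where r: "0 \<le> r" "c = ennreal r" by (cases c) auto
  then have "r < \<phi> x" using c by (simp add: ennreal_less_iff)
  then have "\<forall>\<^sub>F z in nhds x. r < \<phi> z" using \<phi> by (simp add: lower_semicontinuous_def)
  then have "\<forall>\<^sub>F n in sequentially. r < \<phi> (y n)" using y by (rule eventually_compose_filterlim)
  then show "\<forall>\<^sub>F n in sequentially. c < ennreal (\<phi> (y n))"
    by eventually_elim (use r in \<open>simp add: ennreal_less_iff\<close>)
qed

text \<open>
  Trivial for \<open>a \<le> b\<close>; for \<open>b < a\<close> it is the condition of decreasing differences for the own
  coordinates \<open>b < a\<close> and the opponents' coordinates of \<open>x \<le> y\<close>.
\<close>

lemma submodular_cost_exchange:
  assumes \<phi>: "submodular_cost i \<phi>" and le: "\<And>j. x $ j \<le> y $ j"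
  shows "\<phi> l (repl y i (max a b)) + \<phi> l (repl x i (min a b)) \<le> \<phi> l (repl x i a) + \<phi> l (repl y i b)"
proof (cases "a \<le> b")
  case True
  then show ?thesis by (simp add: max_def min_def)
next
  case False
  have twice: "repl (repl z i c) i d = repl z i d" "repl z i c $ i = c" for z c d
    by (simp_all add: repl_def vec_eq_iff)
  have "decreasing_differences i (\<phi> l)" using \<phi> by (simp add: submodular_cost_def)
  moreover have "\<forall>j. repl x i b $ j \<le> repl y i a $ j" using False le by (simp add: repl_def)
  ultimately have "\<phi> l (repl y i a) - \<phi> l (repl (repl y i a) i (repl x i b $ i))
      \<le> \<phi> l (repl (repl x i b) i (repl y i a $ i)) - \<phi> l (repl x i b)"
    unfolding decreasing_differences_def by blast
  then show ?thesis using False by (simp add: twice max_def min_def)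
qed

lemma borel_measurable_vec:
  fixes X :: "'w \<Rightarrow> real ^ 'n::finite"
  assumes "\<And>j. (\<lambda>\<omega>. X \<omega> $ j) \<in> borel_measurable N"
  shows "X \<in> borel_measurable N"
  using assms by (subst borel_measurable_euclidean_space) (auto simp: Basis_vec_def inner_axis)

context filtered_space
begin

text \<open>
  The process is the limit of the step processes that take, at time \<open>t\<close>, the value at the next point
  strictly after \<open>t\<close> of the grid of mesh \<open>1 / Suc n\<close>, cut off at \<open>T\<close>.
\<close>

lemma right_continuous_jointly_measurable:
  fixes X :: "real \<Rightarrow> 'w \<Rightarrow> 'b::metric_space"
  assumes meas: "\<And>t. t \<in> {0..T} \<Longrightarrow> X t \<in> borel_measurable M"
    and right: "\<And>\<omega> t. \<omega> \<in> space M \<Longrightarrow> t \<in> {0..<T} \<Longrightarrow> ((\<lambda>s. X s \<omega>) \<longlongrightarrow> X t \<omega>) (at_right t)"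
  shows "(\<lambda>(\<omega>, t :: real). X (max 0 (min t T)) \<omega>) \<in> borel_measurable (M \<Otimes>\<^sub>M (lborel :: real measure))"
proof (rule borel_measurable_LIMSEQ_metric)
  define g :: "nat \<Rightarrow> int \<Rightarrow> real" where "g n z = max 0 (min T ((real_of_int z + 1) / real (Suc n)))" for n z
  have g_in: "g n z \<in> {0..T}" for n z using T_pos by (auto simp: g_def)
  show "(\<lambda>(\<omega>, t :: real). X (g n \<lfloor>max 0 (min t T) * real (Suc n)\<rfloor>) \<omega>) \<in> borel_measurable (M \<Otimes>\<^sub>M (lborel :: real measure))" for n
  proof -
    have 1: "(\<lambda>p. X (g n z) (fst p)) \<in> borel_measurable (M \<Otimes>\<^sub>M (lborel :: real measure))" for z
      using g_in by (intro measurable_compose[OF measurable_fst] meas) auto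
    have 2: "(\<lambda>p. \<lfloor>max 0 (min (snd p) T) * real (Suc n)\<rfloor>) \<in> (M \<Otimes>\<^sub>M (lborel :: real measure)) \<rightarrow>\<^sub>M count_space UNIV"
      by measurable
    show ?thesis
      using measurable_compose_countable[OF 1 2] by (simp add: split_beta')
  qed
  fix p assume "p \<in> space (M \<Otimes>\<^sub>M (lborel :: real measure))"
  then obtain \<omega> t where p: "p = (\<omega>, t)" and \<omega>: "\<omega> \<in> space M" by (cases p) (auto simp: space_pair_measure)
  define u where "u = max 0 (min t T)"
  have u: "0 \<le> u" "u \<le> T" using T_pos by (auto simp: u_def)
  define d where "d n = g n \<lfloor>u * real (Suc n)\<rfloor>" for n
  have above: "u < (real_of_int \<lfloor>u * real (Suc n)\<rfloor> + 1) / real (Suc n)" for n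
    by (simp add: less_divide_eq del: of_nat_Suc)
  have below: "(real_of_int \<lfloor>u * real (Suc n)\<rfloor> + 1) / real (Suc n) \<le> u + inverse (real (Suc n))" for n
  proof -
    have "real_of_int \<lfloor>u * real (Suc n)\<rfloor> + 1 \<le> u * real (Suc n) + 1" by linarith
    also have "\<dots> = (u + inverse (real (Suc n))) * real (Suc n)" by (simp add: distrib_right del: of_nat_Suc)
    finally show ?thesis by (subst pos_divide_le_eq) auto
  qed
  have "(\<lambda>n. X (d n) \<omega>) \<longlonglongrightarrow> X u \<omega>"
  proof (cases "u = T")
    case True
    then have "d n = T" for n using above[of n] u by (simp add: d_def g_def)
    then show ?thesis using True by simp
  next
    case False
    then have "u < T" using u by simp
    have d_gt: "u < d n" and d_le: "d n \<le> u + inverse (real (Suc n))" for n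
    proof -
      show "u < d n" using above[of n] \<open>u < T\<close> by (simp add: d_def g_def)
      show "d n \<le> u + inverse (real (Suc n))" using below[of n] above[of n] u by (simp add: d_def g_def)
    qed
    have "d \<longlonglongrightarrow> u"
    proof (rule tendsto_sandwich[where f = "\<lambda>_. u" and h = "\<lambda>n. u + inverse (real (Suc n))"])
      show "(\<lambda>n. u + inverse (real (Suc n))) \<longlonglongrightarrow> u"
        using tendsto_add[OF tendsto_const LIMSEQ_inverse_real_of_nat, of u] by simp
    qed (use d_gt d_le in \<open>auto intro!: always_eventually less_imp_le\<close>)
    then have "filterlim d (at_right u) sequentially"
      using d_gt by (auto simp: filterlim_at intro!: always_eventually)
    then show ?thesis
      using right[OF \<omega>, of u] u \<open>u < T\<close> by (auto intro: filterlim_compose)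
  qed
  then show "(\<lambda>n. (case p of (\<omega>, t :: real) \<Rightarrow> X (g n \<lfloor>max 0 (min t T) * real (Suc n)\<rfloor>) \<omega>)) \<longlonglongrightarrow>
      (case p of (\<omega>, t :: real) \<Rightarrow> X (max 0 (min t T)) \<omega>)"
    by (simp add: p u_def d_def)
qed

lemma continuous_imp_right_limit:
  fixes x :: "real \<Rightarrow> real"
  assumes "continuous_on {0..T} x" "t \<in> {0..<T}"
  shows "(x \<longlongrightarrow> x t) (at_right t)"
proof -
  have "(x \<longlongrightarrow> x t) (at t within {0..T})" using assms by (auto simp: continuous_on_def)
  then have "(x \<longlongrightarrow> x t) (at t within {t..T})" by (rule tendsto_within_subset) (use assms in auto)
  then show ?thesis using assms by (simp add: at_within_Icc_at_right)
qed

end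

locale singular_control_game = filtered_space M T F
  for M :: "'w measure" and T :: real and F :: "real \<Rightarrow> 'w measure" +
  fixes W :: "'n::finite \<Rightarrow> real \<Rightarrow> 'w \<Rightarrow> real"
    and L :: "real \<Rightarrow> 'w \<Rightarrow> real ^ 'k::finite"
    and f :: "'n \<Rightarrow> real \<Rightarrow> 'w \<Rightarrow> real"
    and h g :: "'n \<Rightarrow> real ^ 'k \<Rightarrow> real ^ 'n \<Rightarrow> real"
    and \<mu> \<sigma> x0 :: "'n \<Rightarrow> real"
    and k1 :: real
  assumes W_adapted: "adapted T F (W i)"
    and W_continuous: "\<omega> \<in> space M \<Longrightarrow> continuous_on {0..T} (\<lambda>t. W i t \<omega>)"
    and h_measurable: "(\<lambda>(l, x). h i l x) \<in> borel_measurable borel"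
    and g_measurable: "(\<lambda>(l, x). g i l x) \<in> borel_measurable borel"
    and h_nonneg: "0 \<le> h i l x"
    and g_nonneg: "0 \<le> g i l x"
    and x0_pos: "0 < x0 i"
    and f_adapted: "adapted T F (f i)"
    and f_continuous: "\<omega> \<in> space M \<Longrightarrow> continuous_on {0..T} (\<lambda>t. f i t \<omega>)"
    and f_nonneg: "\<omega> \<in> space M \<Longrightarrow> t \<in> {0..T} \<Longrightarrow> 0 \<le> f i t \<omega>"
    and L_adapted: "adapted T F L"
    and L_cadlag: "\<omega> \<in> space M \<Longrightarrow> cadlag_on T (\<lambda>t. L t \<omega> $ j)"
    and h_submodular: "submodular_cost i (h i)"
    and g_submodular: "submodular_cost i (g i)"
    and integrable_bound: "\<exists>H G :: real ^ 'k \<Rightarrow> real \<Rightarrow> real.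
           (\<forall>l a. H l a \<ge> 0 \<and> G l a \<ge> 0) \<and>
           (\<forall>l x. h i l x \<le> H l (x $ i) \<and> g i l x \<le> G l (x $ i)) \<and>
           (\<integral>\<^sup>+\<omega>.
              (\<integral>\<^sup>+t\<in>{0..T}. ennreal (H (L t \<omega>) (x0 i * geom_bm (\<mu> i) (\<sigma> i) (W i) t \<omega>)) \<partial>lborel)
              + ennreal (G (L T \<omega>) (x0 i * geom_bm (\<mu> i) (\<sigma> i) (W i) T \<omega>)) \<partial>M) < \<infinity>"
    and k1_pos: "0 < k1"
    and g_coercive: "k1 * (x $ i) \<le> g i l x"
begin

abbreviation E :: "'n \<Rightarrow> real \<Rightarrow> 'w \<Rightarrow> real" where
  "E i \<equiv> geom_bm (\<mu> i) (\<sigma> i) (W i)"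

abbreviation strategies :: "(real \<Rightarrow> 'w \<Rightarrow> real) set" where
  "strategies \<equiv> admissible M T F"

definition state :: "('n \<Rightarrow> real \<Rightarrow> 'w \<Rightarrow> real) \<Rightarrow> real \<Rightarrow> 'w \<Rightarrow> real ^ 'n" where
  "state \<eta> t \<omega> = (\<chi> j. E j t \<omega> * (x0 j + \<eta> j t \<omega>))"

definition path_cost :: "'n \<Rightarrow> ('n \<Rightarrow> real \<Rightarrow> 'w \<Rightarrow> real) \<Rightarrow> 'w \<Rightarrow> ennreal" where
  "path_cost i \<eta> \<omega> =
     (\<integral>\<^sup>+t\<in>{0..T}. ennreal (h i (L t \<omega>) (state \<eta> t \<omega>)) \<partial>lborel)
     + ennreal (g i (L T \<omega>) (state \<eta> T \<omega>))
     + ennreal (stieltjes_integral T (\<lambda>s. f i s \<omega> * E i s \<omega>) (\<lambda>s. \<eta> i s \<omega>) T)"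

definition cost :: "'n \<Rightarrow> ('n \<Rightarrow> real \<Rightarrow> 'w \<Rightarrow> real) \<Rightarrow> ennreal" where
  "cost i \<eta> = (\<integral>\<^sup>+\<omega>. path_cost i \<eta> \<omega> \<partial>M)"

lemma E_pos: "0 < E i t \<omega>"
  by (simp add: geom_bm_def)

lemma E_continuous: "\<omega> \<in> space M \<Longrightarrow> continuous_on {0..T} (\<lambda>t. E i t \<omega>)"
  unfolding geom_bm_def by (intro continuous_intros W_continuous)

lemma E_adapted: "adapted T F (E i)"
  using W_adapted[of i] unfolding adapted_def geom_bm_def[abs_def] by (auto intro: borel_measurable_exp)

lemma fE_adapted: "adapted T F (\<lambda>t \<omega>. f i t \<omega> * E i t \<omega>)"
  using f_adapted[of i] E_adapted[of i] unfolding adapted_def by (auto intro!: borel_measurable_times)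

lemma fE_continuous: "\<omega> \<in> space M \<Longrightarrow> continuous_on {0..T} (\<lambda>t. f i t \<omega> * E i t \<omega>)"
  by (intro continuous_intros f_continuous E_continuous)

lemma fE_nonneg: "\<omega> \<in> space M \<Longrightarrow> t \<in> {0..T} \<Longrightarrow> 0 \<le> f i t \<omega> * E i t \<omega>"
  using f_nonneg E_pos[of i t \<omega>] by simp

lemma state_component [simp]: "state \<eta> t \<omega> $ j = E j t \<omega> * (x0 j + \<eta> j t \<omega>)"
  by (simp add: state_def)

lemma state_update: "state (\<eta>(i := a)) t \<omega> = repl (state \<eta> t \<omega>) i (E i t \<omega> * (x0 i + a t \<omega>))"
  by (simp add: vec_eq_iff repl_def)

lemma state_measurable:
  assumes "\<And>j. \<eta> j \<in> strategies" "t \<in> {0..T}"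
  shows "state \<eta> t \<in> borel_measurable M"
proof (rule borel_measurable_vec)
  fix j
  have "E j t \<in> borel_measurable M" "\<eta> j t \<in> borel_measurable M"
    using assms E_adapted adapted_measurable_M admissible_iff by blast+
  then show "(\<lambda>\<omega>. state \<eta> t \<omega> $ j) \<in> borel_measurable M" by simp
qed

lemma L_measurable: "t \<in> {0..T} \<Longrightarrow> L t \<in> borel_measurable M"
  using L_adapted by (rule adapted_measurable_M)

lemma state_right_continuous:
  assumes "\<And>j. \<eta> j \<in> strategies" "\<omega> \<in> space M" "t \<in> {0..<T}"
  shows "((\<lambda>s. state \<eta> s \<omega>) \<longlongrightarrow> state \<eta> t \<omega>) (at_right t)"
proof (rule vec_tendstoI)
  fix j
  show "((\<lambda>s. state \<eta> s \<omega> $ j) \<longlongrightarrow> state \<eta> t \<omega> $ j) (at_right t)"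
    unfolding state_component using assms(3)
    by (intro tendsto_intros continuous_imp_right_limit[OF E_continuous[OF assms(2)]]
        increasing_pathD(3)[OF admissible_path[OF assms(1,2)]]) auto
qed

lemma L_right_continuous:
  assumes "\<omega> \<in> space M" "t \<in> {0..<T}"
  shows "((\<lambda>s. L s \<omega>) \<longlongrightarrow> L t \<omega>) (at_right t)"
  using L_cadlag[OF assms(1)] assms(2) by (intro vec_tendstoI) (auto simp: cadlag_on_def)

lemma running_cost_measurable:
  assumes \<eta>: "\<And>j. \<eta> j \<in> strategies"
  shows "(\<lambda>(\<omega>, t). ennreal (h i (L t \<omega>) (state \<eta> t \<omega>)) * indicator {0..T} t)
    \<in> borel_measurable (M \<Otimes>\<^sub>M lborel)"
proof -
  have 1: "(\<lambda>(\<omega>, t :: real). L (max 0 (min t T)) \<omega>) \<in> borel_measurable (M \<Otimes>\<^sub>M (lborel :: real measure))"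
    by (rule right_continuous_jointly_measurable[OF L_measurable L_right_continuous])
  have 2: "(\<lambda>(\<omega>, t :: real). state \<eta> (max 0 (min t T)) \<omega>) \<in> borel_measurable (M \<Otimes>\<^sub>M (lborel :: real measure))"
    by (rule right_continuous_jointly_measurable[OF state_measurable[OF \<eta>] state_right_continuous[OF \<eta>]])
  have "(\<lambda>p. (\<lambda>(l, x). h i l x) ((\<lambda>(\<omega>, t :: real). L (max 0 (min t T)) \<omega>) p, (\<lambda>(\<omega>, t :: real). state \<eta> (max 0 (min t T)) \<omega>) p))
    \<in> borel_measurable (M \<Otimes>\<^sub>M (lborel :: real measure))"
    by (rule measurable_compose[OF borel_measurable_Pair[OF 1 2] h_measurable])
  then have "(\<lambda>p. ennreal (h i (L (max 0 (min (snd p) T)) (fst p)) (state \<eta> (max 0 (min (snd p) T)) (fst p)))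
      * indicator {0..T} (snd p)) \<in> borel_measurable (M \<Otimes>\<^sub>M (lborel :: real measure))"
    by (simp add: split_beta')
  moreover have "ennreal (h i (L (max 0 (min t T)) \<omega>) (state \<eta> (max 0 (min t T)) \<omega>)) * indicator {0..T} t
      = ennreal (h i (L t \<omega>) (state \<eta> t \<omega>)) * indicator {0..T} t" for t \<omega>
    by (auto simp: indicator_def)
  ultimately show ?thesis by (simp add: split_beta')
qed

lemma running_cost_path_measurable:
  assumes "\<And>j. \<eta> j \<in> strategies" "\<omega> \<in> space M"
  shows "(\<lambda>t. ennreal (h i (L t \<omega>) (state \<eta> t \<omega>)) * indicator {0..T} t) \<in> borel_measurable lborel"
  using measurable_Pair2[OF running_cost_measurable[OF assms(1)] assms(2)] by simp

lemma path_cost_measurable: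
  assumes \<eta>: "\<And>j. \<eta> j \<in> strategies"
  shows "path_cost i \<eta> \<in> borel_measurable M"
proof -
  have "(\<lambda>\<omega>. \<integral>\<^sup>+t\<in>{0..T}. ennreal (h i (L t \<omega>) (state \<eta> t \<omega>)) \<partial>lborel) \<in> borel_measurable M"
    using lborel.borel_measurable_nn_integral[OF running_cost_measurable[OF \<eta>]] .
  moreover have "(\<lambda>\<omega>. ennreal (g i (L T \<omega>) (state \<eta> T \<omega>))) \<in> borel_measurable M"
    using measurable_compose[OF borel_measurable_Pair[OF L_measurable state_measurable[OF \<eta>]] g_measurable, of T T i] T_pos
    by simp
  moreover have "(\<lambda>\<omega>. stieltjes_integral T (\<lambda>s. f i s \<omega> * E i s \<omega>) (\<lambda>s. \<eta> i s \<omega>) T) \<in> borel_measurable M"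
    using admissible_measurable[OF admissible_stieltjes[OF \<eta> fE_adapted fE_continuous fE_nonneg], of T i i] T_pos
    by (intro measurable_F_M[of _ T]) auto
  ultimately show ?thesis unfolding path_cost_def[abs_def] by measurable
qed

text \<open>
  Player \<open>i\<close>'s strategy enters running and terminal cost only through the own state at the same time,
  in which they are lower semicontinuous. The exceptional times form a Lebesgue null set that omits
  \<open>T\<close>, and the cost of control even converges.
\<close>

lemma path_cost_liminf:
  assumes \<eta>: "\<And>j. \<eta> j \<in> strategies" and s: "s \<in> strategies" and a: "\<And>n::nat. a n \<in> strategies"
    and \<omega>: "\<omega> \<in> space M" and lim: "path_converges (\<lambda>n t. a n t \<omega>) (\<lambda>t. s t \<omega>)"
  shows "path_cost i (\<eta>(i := s)) \<omega> \<le> liminf (\<lambda>n. path_cost i (\<eta>(i := a n)) \<omega>)"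
proof -
  obtain B where B: "countable B" "T \<notin> B"
    and lim_t: "\<And>t. t \<in> {0..T} - B \<Longrightarrow> (\<lambda>n. a n t \<omega>) \<longlonglongrightarrow> s t \<omega>"
    using lim unfolding path_converges_def by blast
  have upd: "(\<eta>(i := c)) j \<in> strategies" if "c \<in> strategies" for c j using that \<eta> by simp
  have lsc: "ennreal (\<phi> (L t \<omega>) (state (\<eta>(i := s)) t \<omega>))
      \<le> liminf (\<lambda>n. ennreal (\<phi> (L t \<omega>) (state (\<eta>(i := a n)) t \<omega>)))"
    if "submodular_cost i \<phi>" "t \<in> {0..T} - B" for \<phi> :: "real ^ 'k \<Rightarrow> real ^ 'n \<Rightarrow> real" and t
    unfolding state_update
  proof (rule lower_semicontinuous_liminf[where \<phi> = "\<lambda>c. \<phi> (L t \<omega>) (repl (state \<eta> t \<omega>) i c)"])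
    show "lower_semicontinuous (\<lambda>c. \<phi> (L t \<omega>) (repl (state \<eta> t \<omega>) i c))"
      using that(1) by (simp add: submodular_cost_def)
    show "(\<lambda>n. E i t \<omega> * (x0 i + a n t \<omega>)) \<longlonglongrightarrow> E i t \<omega> * (x0 i + s t \<omega>)"
      by (intro tendsto_intros lim_t that)
  qed
  have "(\<integral>\<^sup>+t\<in>{0..T}. ennreal (h i (L t \<omega>) (state (\<eta>(i := s)) t \<omega>)) \<partial>lborel)
      \<le> (\<integral>\<^sup>+t. liminf (\<lambda>n. ennreal (h i (L t \<omega>) (state (\<eta>(i := a n)) t \<omega>)) * indicator {0..T} t) \<partial>lborel)"
  proof (rule nn_integral_mono_AE)
    have "AE t in lborel. t \<notin> B" using B by (intro AE_not_in countable_imp_null_set_lborel)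
    then show "AE t in lborel. ennreal (h i (L t \<omega>) (state (\<eta>(i := s)) t \<omega>)) * indicator {0..T} t
      \<le> liminf (\<lambda>n. ennreal (h i (L t \<omega>) (state (\<eta>(i := a n)) t \<omega>)) * indicator {0..T} t)"
    proof eventually_elim
      case (elim t)
      then show ?case using lsc[OF h_submodular, of t] by (cases "t \<in> {0..T}") auto
    qed
  qed
  also have "\<dots> \<le> liminf (\<lambda>n. \<integral>\<^sup>+t\<in>{0..T}. ennreal (h i (L t \<omega>) (state (\<eta>(i := a n)) t \<omega>)) \<partial>lborel)"
    by (rule nn_integral_liminf) (rule running_cost_path_measurable[OF upd[OF a] \<omega>])
  finally have 1: "(\<integral>\<^sup>+t\<in>{0..T}. ennreal (h i (L t \<omega>) (state (\<eta>(i := s)) t \<omega>)) \<partial>lborel)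
      \<le> liminf (\<lambda>n. \<integral>\<^sup>+t\<in>{0..T}. ennreal (h i (L t \<omega>) (state (\<eta>(i := a n)) t \<omega>)) \<partial>lborel)" .
  have 2: "ennreal (g i (L T \<omega>) (state (\<eta>(i := s)) T \<omega>))
      \<le> liminf (\<lambda>n. ennreal (g i (L T \<omega>) (state (\<eta>(i := a n)) T \<omega>)))"
    using B T_pos by (intro lsc g_submodular) auto
  have "(\<lambda>n. ennreal (stieltjes_integral T (\<lambda>s. f i s \<omega> * E i s \<omega>) (\<lambda>s. a n s \<omega>) T))
      \<longlonglongrightarrow> ennreal (stieltjes_integral T (\<lambda>s. f i s \<omega> * E i s \<omega>) (\<lambda>t. s t \<omega>) T)"
    using lim_t
    by (intro tendsto_ennrealI stieltjes_integral_tendsto[OF T_pos admissible_path[OF s \<omega>] admissible_path[OF a \<omega>]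
        fE_continuous[OF \<omega>] B]) auto
  then have 3: "ennreal (stieltjes_integral T (\<lambda>s. f i s \<omega> * E i s \<omega>) (\<lambda>t. s t \<omega>) T)
      \<le> liminf (\<lambda>n. ennreal (stieltjes_integral T (\<lambda>s. f i s \<omega> * E i s \<omega>) (\<lambda>s. a n s \<omega>) T))"
    by (simp add: lim_imp_Liminf)
  show ?thesis
    using liminf_add_ennreal[OF liminf_add_ennreal[OF 1 2] 3] by (simp add: path_cost_def)
qed

lemma cost_limit_le:
  assumes \<eta>: "\<And>j. \<eta> j \<in> strategies" and s: "s \<in> strategies" and a: "\<And>n::nat. a n \<in> strategies"
    and lim: "AE \<omega> in M. path_converges (\<lambda>n t. a n t \<omega>) (\<lambda>t. s t \<omega>)"
    and d: "\<forall>\<^sub>F n in sequentially. cost i (\<eta>(i := a n)) \<le> d"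
  shows "cost i (\<eta>(i := s)) \<le> d"
proof -
  have "cost i (\<eta>(i := s)) \<le> (\<integral>\<^sup>+\<omega>. liminf (\<lambda>n. path_cost i (\<eta>(i := a n)) \<omega>) \<partial>M)"
    unfolding cost_def
  proof (rule nn_integral_mono_AE)
    show "AE \<omega> in M. path_cost i (\<eta>(i := s)) \<omega> \<le> liminf (\<lambda>n. path_cost i (\<eta>(i := a n)) \<omega>)"
      using lim AE_space by eventually_elim (rule path_cost_liminf[OF \<eta> s a])
  qed
  also have "\<dots> \<le> liminf (\<lambda>n. cost i (\<eta>(i := a n)))"
    unfolding cost_def using \<eta> a by (intro nn_integral_liminf path_cost_measurable) simp
  also have "\<dots> \<le> liminf (\<lambda>n::nat. d)"
    using d by (rule Liminf_mono)
  also have "\<dots> = d" by (simp add: Liminf_const)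
  finally show ?thesis .
qed

text \<open>
  The own state is an increasing affine function of the own control, so it commutes with maximum and
  minimum. Running and terminal costs then obey the exchange inequality at each time, and the cost of
  control is modular.
\<close>

lemma path_cost_exchange:
  assumes \<eta>: "\<And>j. \<eta> j \<in> strategies" and \<zeta>: "\<And>j. \<zeta> j \<in> strategies"
    and a: "a \<in> strategies" and b: "b \<in> strategies" and \<omega>: "\<omega> \<in> space M"
    and le: "\<And>j t. t \<in> {0..T} \<Longrightarrow> \<eta> j t \<omega> \<le> \<zeta> j t \<omega>"
  shows "path_cost i (\<zeta>(i := \<lambda>t \<omega>. max (a t \<omega>) (b t \<omega>))) \<omega> + path_cost i (\<eta>(i := \<lambda>t \<omega>. min (a t \<omega>) (b t \<omega>))) \<omega>
    \<le> path_cost i (\<eta>(i := a)) \<omega> + path_cost i (\<zeta>(i := b)) \<omega>"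
proof -
  define \<eta>' where "\<eta>' = \<eta>(i := \<lambda>t \<omega>. min (a t \<omega>) (b t \<omega>))"
  define \<zeta>' where "\<zeta>' = \<zeta>(i := \<lambda>t \<omega>. max (a t \<omega>) (b t \<omega>))"
  define \<eta>a where "\<eta>a = \<eta>(i := a)"
  define \<zeta>b where "\<zeta>b = \<zeta>(i := b)"
  have in_A: "\<eta>' j \<in> strategies" "\<zeta>' j \<in> strategies" "\<eta>a j \<in> strategies" "\<zeta>b j \<in> strategies" for j
    using \<eta> \<zeta> a b by (auto simp: \<eta>'_def \<zeta>'_def \<eta>a_def \<zeta>b_def admissible_max admissible_min)
  have exch: "\<phi> l (state \<zeta>' t \<omega>) + \<phi> l (state \<eta>' t \<omega>) \<le> \<phi> l (state \<eta>a t \<omega>) + \<phi> l (state \<zeta>b t \<omega>)"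
    if \<phi>: "submodular_cost i \<phi>" and t: "t \<in> {0..T}" for \<phi> :: "real ^ 'k \<Rightarrow> real ^ 'n \<Rightarrow> real" and l t
  proof -
    have lin: "E i t \<omega> * (x0 i + max u v) = max (E i t \<omega> * (x0 i + u)) (E i t \<omega> * (x0 i + v))"
      "E i t \<omega> * (x0 i + min u v) = min (E i t \<omega> * (x0 i + u)) (E i t \<omega> * (x0 i + v))" for u v
      using E_pos[of i t \<omega>] by (auto simp: max_def min_def)
    have "state \<eta> t \<omega> $ j \<le> state \<zeta> t \<omega> $ j" for j
      using le[OF t, of j] E_pos[of j t \<omega>] by simp
    from submodular_cost_exchange[OF \<phi> this]
    show ?thesis unfolding \<eta>'_def \<zeta>'_def \<eta>a_def \<zeta>b_def state_update lin .
  qed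
  have exch': "ennreal (\<phi> l (state \<zeta>' t \<omega>)) + ennreal (\<phi> l (state \<eta>' t \<omega>))
      \<le> ennreal (\<phi> l (state \<eta>a t \<omega>)) + ennreal (\<phi> l (state \<zeta>b t \<omega>))"
    if "submodular_cost i \<phi>" "t \<in> {0..T}" "\<And>l x. 0 \<le> \<phi> l x" for \<phi> :: "real ^ 'k \<Rightarrow> real ^ 'n \<Rightarrow> real" and l t
    using exch[OF that(1,2), of l] that(3) by (simp add: ennreal_leI flip: ennreal_plus)
  define I where "I \<theta> = (\<integral>\<^sup>+t\<in>{0..T}. ennreal (h i (L t \<omega>) (state \<theta> t \<omega>)) \<partial>lborel)" for \<theta>
  have I_add: "I \<theta> + I \<theta>' = (\<integral>\<^sup>+t. ennreal (h i (L t \<omega>) (state \<theta> t \<omega>)) * indicator {0..T} t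
      + ennreal (h i (L t \<omega>) (state \<theta>' t \<omega>)) * indicator {0..T} t \<partial>lborel)"
    if "\<And>j. \<theta> j \<in> strategies" "\<And>j. \<theta>' j \<in> strategies" for \<theta> \<theta>'
    unfolding I_def by (intro nn_integral_add[symmetric] running_cost_path_measurable that \<omega>)
  have 1: "I \<zeta>' + I \<eta>' \<le> I \<eta>a + I \<zeta>b"
    unfolding I_add[OF in_A(2,1)] I_add[OF in_A(3,4)]
  proof (rule nn_integral_mono)
    fix t
    show "ennreal (h i (L t \<omega>) (state \<zeta>' t \<omega>)) * indicator {0..T} t + ennreal (h i (L t \<omega>) (state \<eta>' t \<omega>)) * indicator {0..T} t
      \<le> ennreal (h i (L t \<omega>) (state \<eta>a t \<omega>)) * indicator {0..T} t + ennreal (h i (L t \<omega>) (state \<zeta>b t \<omega>)) * indicator {0..T} t"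
      using exch'[OF h_submodular, of t] h_nonneg by (cases "t \<in> {0..T}") auto
  qed
  have 2: "ennreal (g i (L T \<omega>) (state \<zeta>' T \<omega>)) + ennreal (g i (L T \<omega>) (state \<eta>' T \<omega>))
      \<le> ennreal (g i (L T \<omega>) (state \<eta>a T \<omega>)) + ennreal (g i (L T \<omega>) (state \<zeta>b T \<omega>))"
    using T_pos g_nonneg by (intro exch' g_submodular) auto
  define S where "S x = stieltjes_integral T (\<lambda>s. f i s \<omega> * E i s \<omega>) (\<lambda>s. x s \<omega>) T" for x
  have S_nonneg: "0 \<le> S x" if "x \<in> strategies" for x
    unfolding S_def using T_pos
    by (intro increasing_pathD(2)[OF increasing_path_stieltjes[OF admissible_path[OF that \<omega>] fE_continuous[OF \<omega>] fE_nonneg[OF \<omega>]]]) auto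
  have "S (\<zeta>' i) + S (\<eta>' i) = S (\<eta>a i) + S (\<zeta>b i)"
    unfolding S_def \<zeta>'_def \<eta>'_def \<eta>a_def \<zeta>b_def fun_upd_same using T_pos
    by (intro stieltjes_integral_max_min admissible_path a b \<omega> fE_continuous) auto
  then have 3: "ennreal (S (\<zeta>' i)) + ennreal (S (\<eta>' i)) = ennreal (S (\<eta>a i)) + ennreal (S (\<zeta>b i))"
    using S_nonneg in_A by (simp flip: ennreal_plus)
  have "path_cost i \<zeta>' \<omega> + path_cost i \<eta>' \<omega>
      = (I \<zeta>' + I \<eta>') + (ennreal (g i (L T \<omega>) (state \<zeta>' T \<omega>)) + ennreal (g i (L T \<omega>) (state \<eta>' T \<omega>)))
        + (ennreal (S (\<zeta>' i)) + ennreal (S (\<eta>' i)))"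
    by (simp add: path_cost_def I_def S_def ac_simps)
  also have "\<dots> \<le> (I \<eta>a + I \<zeta>b) + (ennreal (g i (L T \<omega>) (state \<eta>a T \<omega>)) + ennreal (g i (L T \<omega>) (state \<zeta>b T \<omega>)))
        + (ennreal (S (\<eta>a i)) + ennreal (S (\<zeta>b i)))"
    by (rule add_mono[OF add_mono[OF 1 2] eq_refl[OF 3]])
  also have "\<dots> = path_cost i \<eta>a \<omega> + path_cost i \<zeta>b \<omega>"
    by (simp add: path_cost_def I_def S_def ac_simps)
  finally show ?thesis by (simp add: \<eta>'_def \<zeta>'_def \<eta>a_def \<zeta>b_def)
qed

lemma cost_exchange:
  assumes \<eta>: "\<And>j. \<eta> j \<in> strategies" and \<zeta>: "\<And>j. \<zeta> j \<in> strategies" and le: "\<And>j. process_le (\<eta> j) (\<zeta> j)"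
    and a: "a \<in> strategies" and b: "b \<in> strategies"
  shows "cost i (\<zeta>(i := \<lambda>t \<omega>. max (a t \<omega>) (b t \<omega>))) + cost i (\<eta>(i := \<lambda>t \<omega>. min (a t \<omega>) (b t \<omega>)))
    \<le> cost i (\<eta>(i := a)) + cost i (\<zeta>(i := b))"
proof -
  have cost_add: "cost i \<theta> + cost i \<theta>' = (\<integral>\<^sup>+\<omega>. path_cost i \<theta> \<omega> + path_cost i \<theta>' \<omega> \<partial>M)"
    if "\<And>j. \<theta> j \<in> strategies" "\<And>j. \<theta>' j \<in> strategies" for \<theta> \<theta>'
    unfolding cost_def by (intro nn_integral_add[symmetric] path_cost_measurable that)
  have all_le: "AE \<omega> in M. \<forall>j. \<forall>t\<in>{0..T}. \<eta> j t \<omega> \<le> \<zeta> j t \<omega>"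
    using le unfolding process_le_def by (simp add: AE_all_countable)
  have "(\<integral>\<^sup>+\<omega>. path_cost i (\<zeta>(i := \<lambda>t \<omega>. max (a t \<omega>) (b t \<omega>))) \<omega>
        + path_cost i (\<eta>(i := \<lambda>t \<omega>. min (a t \<omega>) (b t \<omega>))) \<omega> \<partial>M)
      \<le> (\<integral>\<^sup>+\<omega>. path_cost i (\<eta>(i := a)) \<omega> + path_cost i (\<zeta>(i := b)) \<omega> \<partial>M)"
  proof (rule nn_integral_mono_AE)
    show "AE \<omega> in M. path_cost i (\<zeta>(i := \<lambda>t \<omega>. max (a t \<omega>) (b t \<omega>))) \<omega>
        + path_cost i (\<eta>(i := \<lambda>t \<omega>. min (a t \<omega>) (b t \<omega>))) \<omega>
      \<le> path_cost i (\<eta>(i := a)) \<omega> + path_cost i (\<zeta>(i := b)) \<omega>"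
      using all_le AE_space by eventually_elim (rule path_cost_exchange[OF \<eta> \<zeta> a b], auto)
  qed
  then show ?thesis
    using \<eta> \<zeta> a b admissible_max[OF a b] admissible_min[OF a b] by (subst (1 2) cost_add) auto
qed

lemma cost_cong:
  assumes "AE \<omega> in M. \<forall>j. \<forall>t\<in>{0..T}. \<eta> j t \<omega> = \<zeta> j t \<omega>"
  shows "cost i \<eta> = cost i \<zeta>"
  unfolding cost_def
proof (rule nn_integral_cong_AE)
  show "AE \<omega> in M. path_cost i \<eta> \<omega> = path_cost i \<zeta> \<omega>"
    using assms
  proof eventually_elim
    case (elim \<omega>)
    have state_eq: "state \<eta> t \<omega> = state \<zeta> t \<omega>" if "t \<in> {0..T}" for t
      using elim that by (simp add: vec_eq_iff)
    have "(\<integral>\<^sup>+t\<in>{0..T}. ennreal (h i (L t \<omega>) (state \<eta> t \<omega>)) \<partial>lborel)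
        = (\<integral>\<^sup>+t\<in>{0..T}. ennreal (h i (L t \<omega>) (state \<zeta> t \<omega>)) \<partial>lborel)"
      by (intro nn_integral_cong) (auto simp: state_eq indicator_def)
    moreover have "stieltjes_integral T (\<lambda>s. f i s \<omega> * E i s \<omega>) (\<lambda>s. \<eta> i s \<omega>) T
        = stieltjes_integral T (\<lambda>s. f i s \<omega> * E i s \<omega>) (\<lambda>s. \<zeta> i s \<omega>) T"
      using elim T_pos by (intro stieltjes_integral_cong) auto
    ultimately show ?case using T_pos by (simp add: path_cost_def state_eq)
  qed
qed

text \<open>
  By the growth condition on \<open>g\<close>, a lower bound of the cost of \<open>a\<close> against all opponents.
\<close>

definition terminal_size :: "'n \<Rightarrow> (real \<Rightarrow> 'w \<Rightarrow> real) \<Rightarrow> ennreal" where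
  "terminal_size i a = (\<integral>\<^sup>+\<omega>. ennreal (k1 * (E i T \<omega> * a T \<omega>)) \<partial>M)"

lemma terminal_size_le_cost:
  "terminal_size i a \<le> cost i (\<eta>(i := a))"
  unfolding terminal_size_def cost_def
proof (rule nn_integral_mono)
  fix \<omega>
  have "k1 * (E i T \<omega> * a T \<omega>) \<le> k1 * (state (\<eta>(i := a)) T \<omega> $ i)"
    using k1_pos E_pos[of i T \<omega>] x0_pos[of i] by (simp add: algebra_simps)
  also have "\<dots> \<le> g i (L T \<omega>) (state (\<eta>(i := a)) T \<omega>)" by (rule g_coercive)
  finally have "ennreal (k1 * (E i T \<omega> * a T \<omega>)) \<le> ennreal (g i (L T \<omega>) (state (\<eta>(i := a)) T \<omega>))"
    by (rule ennreal_leI)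
  also have "\<dots> \<le> path_cost i (\<eta>(i := a)) \<omega>"
    unfolding path_cost_def by (simp add: add_increasing add_increasing2)
  finally show "ennreal (k1 * (E i T \<omega> * a T \<omega>)) \<le> path_cost i (\<eta>(i := a)) \<omega>" .
qed

lemma terminal_size_mono:
  assumes "process_le a b"
  shows "terminal_size i a \<le> terminal_size i b"
  unfolding terminal_size_def
proof (rule nn_integral_mono_AE)
  show "AE \<omega> in M. ennreal (k1 * (E i T \<omega> * a T \<omega>)) \<le> ennreal (k1 * (E i T \<omega> * b T \<omega>))"
    using assms unfolding process_le_def
    by eventually_elim (use T_pos k1_pos E_pos in \<open>auto intro!: ennreal_leI mult_left_mono simp: less_imp_le\<close>)
qed

text \<open>
  By monotone convergence the supremum of \<open>k1 E\<^sub>T a\<^sub>T\<close> has finite expectation, so it is finite almost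
  surely, and \<open>k1 E\<^sub>T > 0\<close> can be divided out.
\<close>

lemma terminal_size_bounded:
  assumes a: "\<And>n::nat. a n \<in> strategies" and chain: "\<And>n. process_le (a n) (a (Suc n))"
    and size: "\<And>n. terminal_size i (a n) \<le> c" and c: "c < \<infinity>"
  shows "AE \<omega> in M. bdd_above (range (\<lambda>n. a n T \<omega>))"
proof -
  define u where "u n \<omega> = ennreal (k1 * (E i T \<omega> * a n T \<omega>))" for n \<omega>
  have T: "T \<in> {0..T}" using T_pos by simp
  have E_meas: "E i T \<in> borel_measurable M" by (rule adapted_measurable_M[OF E_adapted T])
  have u_meas: "u n \<in> borel_measurable M" for n
  proof -
    have "a n T \<in> borel_measurable M" using measurable_F_M[OF admissible_measurable[OF a T] T] .
    then show ?thesis unfolding u_def[abs_def] using E_meas by measurable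
  qed
  have u_mono: "AE \<omega> in M. u n \<omega> \<le> u (Suc n) \<omega>" for n
    using chain[of n] unfolding process_le_def u_def
    by eventually_elim (use T_pos k1_pos E_pos in \<open>auto intro!: ennreal_leI mult_left_mono simp: less_imp_le\<close>)
  have "(\<integral>\<^sup>+\<omega>. (SUP n. u n \<omega>) \<partial>M) = (SUP n. integral\<^sup>N M (u n))"
    by (rule nn_integral_monotone_convergence_SUP_AE[where f = u, OF u_mono u_meas])
  also have "\<dots> \<le> c"
    using size unfolding terminal_size_def u_def by (intro SUP_least)
  finally have "(\<integral>\<^sup>+\<omega>. (SUP n. u n \<omega>) \<partial>M) \<noteq> \<infinity>" using c by auto
  then have "AE \<omega> in M. (SUP n. u n \<omega>) \<noteq> \<infinity>"
    using u_meas by (intro nn_integral_PInf_AE borel_measurable_SUP) auto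
  then show ?thesis using AE_space
  proof eventually_elim
    case (elim \<omega>)
    then obtain r where r: "0 \<le> r" "(SUP n. u n \<omega>) = ennreal r"
      by (cases "SUP n. u n \<omega>") auto
    have "a n T \<omega> \<le> r / (k1 * E i T \<omega>)" for n
    proof -
      have "u n \<omega> \<le> ennreal r" unfolding r(2)[symmetric] by (rule SUP_upper) simp
      then have "k1 * (E i T \<omega> * a n T \<omega>) \<le> r" using r(1) by (simp add: u_def ennreal_le_iff)
      then show ?thesis using k1_pos E_pos[of i T \<omega>] by (simp add: pos_le_divide_eq ac_simps)
    qed
    then show ?case by (rule bdd_aboveI2)
  qed
qed

text \<open>
  Under the zero control the own state is \<open>x0 E\<close>, and the integrable majorants of \<open>h\<close> and \<open>g\<close> depend on
  nothing else, in particular not on the opponents.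
\<close>

lemma zero_cost_bounded: "\<exists>C<\<infinity>. \<forall>\<eta>. cost i (\<eta>(i := \<lambda>_ _. 0)) \<le> C"
proof -
  obtain H G :: "real ^ 'k \<Rightarrow> real \<Rightarrow> real" where HG: "\<And>l x. h i l x \<le> H l (x $ i)" "\<And>l x. g i l x \<le> G l (x $ i)"
    and fin: "(\<integral>\<^sup>+\<omega>. (\<integral>\<^sup>+t\<in>{0..T}. ennreal (H (L t \<omega>) (x0 i * E i t \<omega>)) \<partial>lborel)
              + ennreal (G (L T \<omega>) (x0 i * E i T \<omega>)) \<partial>M) < \<infinity>"
    using integrable_bound[of i] by blast
  have "cost i (\<eta>(i := \<lambda>_ _. 0)) \<le> (\<integral>\<^sup>+\<omega>. (\<integral>\<^sup>+t\<in>{0..T}. ennreal (H (L t \<omega>) (x0 i * E i t \<omega>)) \<partial>lborel)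
              + ennreal (G (L T \<omega>) (x0 i * E i T \<omega>)) \<partial>M)" for \<eta>
    unfolding cost_def
  proof (rule nn_integral_mono)
    fix \<omega> assume \<omega>: "\<omega> \<in> space M"
    let ?\<eta> = "\<eta>(i := \<lambda>_ _. 0 :: real)"
    have at_i: "state ?\<eta> t \<omega> $ i = x0 i * E i t \<omega>" for t by (simp add: mult.commute)
    have "(\<integral>\<^sup>+t\<in>{0..T}. ennreal (h i (L t \<omega>) (state ?\<eta> t \<omega>)) \<partial>lborel)
        \<le> (\<integral>\<^sup>+t\<in>{0..T}. ennreal (H (L t \<omega>) (x0 i * E i t \<omega>)) \<partial>lborel)"
      using HG(1)[of _ "state ?\<eta> _ \<omega>"] unfolding at_i
      by (intro nn_integral_mono mult_right_mono ennreal_leI) auto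
    moreover have "ennreal (g i (L T \<omega>) (state ?\<eta> T \<omega>)) \<le> ennreal (G (L T \<omega>) (x0 i * E i T \<omega>))"
      using HG(2)[of _ "state ?\<eta> T \<omega>"] unfolding at_i by (rule ennreal_leI)
    moreover have "stieltjes_integral T (\<lambda>s. f i s \<omega> * E i s \<omega>) (\<lambda>s. ?\<eta> i s \<omega>) T = 0"
      using fE_continuous[OF \<omega>] T_pos by (simp add: stieltjes_integral_zero_path)
    ultimately show "path_cost i ?\<eta> \<omega> \<le> (\<integral>\<^sup>+t\<in>{0..T}. ennreal (H (L t \<omega>) (x0 i * E i t \<omega>)) \<partial>lborel)
              + ennreal (G (L T \<omega>) (x0 i * E i T \<omega>))"
      unfolding path_cost_def by (simp add: add_mono)
  qed
  then show ?thesis using fin by blast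
qed

text \<open>
  The game in the discounted controls is an instance of the abstract submodular game.
\<close>

lemma transformed_nash_exists: "\<exists>\<eta>. open_loop_nash strategies cost \<eta>"
proof -
  obtain C where C: "\<And>i. C i < \<infinity>" "\<And>i \<eta>. cost i (\<eta>(i := \<lambda>_ _. 0)) \<le> C i"
    using zero_cost_bounded by metis
  interpret submodular_game strategies process_le "\<lambda>a b t \<omega>. max (a t \<omega>) (b t \<omega>)"
    "\<lambda>a b t \<omega>. min (a t \<omega>) (b t \<omega>)" "\<lambda>_ _. 0" cost terminal_size C size_functional
  proof (unfold_locales, goal_cases)
    case (10 a c i)
    obtain s where s: "s \<in> strategies" "\<forall>n. process_le (a n) s"
      "\<forall>b\<in>strategies. (\<forall>n. process_le (a n) b) \<longrightarrow> process_le s b"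
      "AE \<omega> in M. path_converges (\<lambda>n t. a n t \<omega>) (\<lambda>t. s t \<omega>)"
      using process_sup_exists[of a, OF 10(1,2) terminal_size_bounded[of a i c, OF 10]] by blast
    have "cost i (\<eta>(i := s)) \<le> d" if "\<forall>j. \<eta> j \<in> strategies" "\<forall>n. cost i (\<eta>(i := a n)) \<le> d" for \<eta> d
      using that by (intro cost_limit_le[of _ s a, OF _ s(1) 10(1) s(4)]) auto
    then show ?case using s by blast
  next
    case (11 a i)
    obtain s where s: "s \<in> strategies" "AE \<omega> in M. path_converges (\<lambda>n t. a n t \<omega>) (\<lambda>t. s t \<omega>)"
      using process_inf_exists[of a, OF 11] by blast
    then show ?case using cost_limit_le[of _ s a, OF _ s(1) 11(1) s(2)] by blast
  next
    case (12 \<eta> \<zeta> a b i)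
    then show ?case by (rule cost_exchange)
  next
    case (19 \<eta> a b i)
    have "AE \<omega> in M. \<forall>t\<in>{0..T}. a t \<omega> = b t \<omega>" by (rule size_functional_strict[OF 19(2-5)])
    then show ?case by (intro cost_cong) (auto elim!: eventually_mono)
  qed (auto intro: process_le_refl process_le_trans admissible_max admissible_min process_le_max_min
      process_le_max_least admissible_0 process_le_zero C C(1)[simplified] terminal_size_le_cost terminal_size_mono
      size_functional_mono size_functional_le)
  show ?thesis by (rule nash_exists)
qed

section \<open>Back to the original game\<close>

definition discounted :: "'n \<Rightarrow> (real \<Rightarrow> 'w \<Rightarrow> real) \<Rightarrow> real \<Rightarrow> 'w \<Rightarrow> real" where
  "discounted j \<xi> t \<omega> = stieltjes_integral T (\<lambda>s. 1 / E j s \<omega>) (\<lambda>s. \<xi> s \<omega>) t"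

definition undiscounted :: "'n \<Rightarrow> (real \<Rightarrow> 'w \<Rightarrow> real) \<Rightarrow> real \<Rightarrow> 'w \<Rightarrow> real" where
  "undiscounted j \<eta> t \<omega> = stieltjes_integral T (\<lambda>s. E j s \<omega>) (\<lambda>s. \<eta> s \<omega>) t"

lemma E_nonzero: "E j t \<omega> \<noteq> 0"
  by (simp add: geom_bm_def)

lemma inverse_E_continuous: "\<omega> \<in> space M \<Longrightarrow> continuous_on {0..T} (\<lambda>t. 1 / E j t \<omega>)"
  by (rule continuous_on_divide[OF continuous_on_const E_continuous]) (simp_all add: E_nonzero)

lemma inverse_E_nonneg: "0 \<le> 1 / E j t \<omega>"
  using E_pos[of j t \<omega>] by (simp add: less_imp_le)

lemma discounted_admissible: "\<xi> \<in> strategies \<Longrightarrow> discounted j \<xi> \<in> strategies"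
  unfolding discounted_def[abs_def]
proof (rule admissible_stieltjes)
  show "adapted T F (\<lambda>t \<omega>. 1 / E j t \<omega>)"
    unfolding adapted_def
  proof
    fix t assume "t \<in> {0..T}"
    then have "E j t \<in> borel_measurable (F t)" using E_adapted by (auto simp: adapted_def)
    then show "(\<lambda>\<omega>. 1 / E j t \<omega>) \<in> borel_measurable (F t)" by simp
  qed
qed (simp_all add: inverse_E_continuous less_imp_le[OF E_pos])

lemma undiscounted_admissible: "\<eta> \<in> strategies \<Longrightarrow> undiscounted j \<eta> \<in> strategies"
  unfolding undiscounted_def[abs_def]
  by (rule admissible_stieltjes[OF _ E_adapted E_continuous less_imp_le[OF E_pos]])

lemma discounted_undiscounted:
  assumes \<eta>: "\<eta> \<in> strategies" and \<omega>: "\<omega> \<in> space M" and t: "t \<in> {0..T}"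
  shows "discounted j (undiscounted j \<eta>) t \<omega> = \<eta> t \<omega>"
proof -
  have "discounted j (undiscounted j \<eta>) t \<omega>
      = stieltjes_integral T (\<lambda>s. 1 / E j s \<omega> * E j s \<omega>) (\<lambda>s. \<eta> s \<omega>) t"
    unfolding discounted_def undiscounted_def using t E_pos
    by (intro stieltjes_integral_chain admissible_path[OF \<eta> \<omega>] inverse_E_continuous E_continuous \<omega>)
      (auto intro: less_imp_le)
  also have "(\<lambda>s. 1 / E j s \<omega> * E j s \<omega>) = (\<lambda>_. 1)"
    by (simp add: E_nonzero)
  finally show ?thesis using stieltjes_integral_const[OF admissible_path[OF \<eta> \<omega>]] t by simp
qed

text \<open>
  The state has the same form by definition; for the cost of control the chain rule cancels \<open>E\<close>
  against \<open>1/E\<close>.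
\<close>

lemma expected_cost_eq_cost:
  assumes \<xi>: "\<And>j. \<xi> j \<in> strategies"
  shows "expected_cost M T \<mu> \<sigma> x0 W L f h g i \<xi> = cost i (\<lambda>j. discounted j (\<xi> j))"
  unfolding expected_cost_def cost_def
proof (rule nn_integral_cong)
  fix \<omega> assume \<omega>: "\<omega> \<in> space M"
  have "state_vector T \<mu> \<sigma> x0 W \<xi> t \<omega> = state (\<lambda>j. discounted j (\<xi> j)) t \<omega>" for t
    by (simp add: state_vector_def controlled_state_def state_def discounted_def)
  moreover have "stieltjes_integral T (\<lambda>s. f i s \<omega> * E i s \<omega>) (\<lambda>s. discounted i (\<xi> i) s \<omega>) T
      = stieltjes_integral T (\<lambda>s. f i s \<omega> * E i s \<omega> * (1 / E i s \<omega>)) (\<lambda>s. \<xi> i s \<omega>) T"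
    unfolding discounted_def using T_pos
    by (intro stieltjes_integral_chain admissible_path[OF \<xi> \<omega>] inverse_E_continuous fE_continuous \<omega> inverse_E_nonneg) auto
  moreover have "(\<lambda>s. f i s \<omega> * E i s \<omega> * (1 / E i s \<omega>)) = (\<lambda>s. f i s \<omega>)"
    by (simp add: E_nonzero)
  ultimately show "(\<integral>\<^sup>+t\<in>{0..T}. ennreal (h i (L t \<omega>) (state_vector T \<mu> \<sigma> x0 W \<xi> t \<omega>)) \<partial>lborel)
        + ennreal (g i (L T \<omega>) (state_vector T \<mu> \<sigma> x0 W \<xi> T \<omega>))
        + ennreal (stieltjes_integral T (\<lambda>s. f i s \<omega>) (\<lambda>s. \<xi> i s \<omega>) T)
      = path_cost i (\<lambda>j. discounted j (\<xi> j)) \<omega>"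
    by (simp add: path_cost_def)
qed

text \<open>
  Discounting is a cost-preserving bijection of strategies, so every deviation in the original game is
  a deviation in the discounted one.
\<close>

lemma nash_equilibrium_exists:
  "\<exists>\<xi>. open_loop_nash strategies (expected_cost M T \<mu> \<sigma> x0 W L f h g) \<xi>"
proof -
  let ?J = "expected_cost M T \<mu> \<sigma> x0 W L f h g"
  obtain \<eta> where \<eta>: "\<And>i. \<eta> i \<in> strategies" "\<And>i. cost i \<eta> < \<infinity>"
    "\<And>i a. a \<in> strategies \<Longrightarrow> cost i \<eta> \<le> cost i (\<eta>(i := a))"
    using transformed_nash_exists unfolding open_loop_nash_def by blast
  define \<xi> where "\<xi> j = undiscounted j (\<eta> j)" for j
  have \<xi>: "\<xi> j \<in> strategies" for j unfolding \<xi>_def using \<eta>(1) by (rule undiscounted_admissible)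
  have J_deviation: "?J i (\<xi>(i := \<theta>)) = cost i (\<eta>(i := discounted i \<theta>))" if "\<theta> \<in> strategies" for i \<theta>
  proof -
    have "?J i (\<xi>(i := \<theta>)) = cost i (\<lambda>j. discounted j ((\<xi>(i := \<theta>)) j))"
      using \<xi> that by (intro expected_cost_eq_cost) simp
    also have "\<dots> = cost i (\<eta>(i := discounted i \<theta>))"
      using discounted_undiscounted[OF \<eta>(1)] by (intro cost_cong AE_I2) (simp add: \<xi>_def)
    finally show ?thesis .
  qed
  have J_eq: "?J i \<xi> = cost i \<eta>" for i
  proof -
    have "?J i \<xi> = cost i (\<lambda>j. discounted j (\<xi> j))" using \<xi> by (rule expected_cost_eq_cost)
    also have "\<dots> = cost i \<eta>"
      using discounted_undiscounted[OF \<eta>(1)] by (intro cost_cong AE_I2) (simp add: \<xi>_def)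
    finally show ?thesis .
  qed
  show ?thesis
    unfolding open_loop_nash_def
    using \<xi> \<eta>(2,3) discounted_admissible J_deviation J_eq by (intro exI[of _ \<xi>]) simp
qed

end

theorem theorem5p2:
  fixes M :: "'w measure" and T :: real and F :: "real \<Rightarrow> 'w measure"
    and W :: "'n::finite \<Rightarrow> real \<Rightarrow> 'w \<Rightarrow> real"
    and L :: "real \<Rightarrow> 'w \<Rightarrow> real ^ 'k::finite"
    and f :: "'n \<Rightarrow> real \<Rightarrow> 'w \<Rightarrow> real"
    and h g :: "'n \<Rightarrow> real ^ 'k \<Rightarrow> real ^ 'n \<Rightarrow> real"
    and \<mu> \<sigma> x0 :: "'n \<Rightarrow> real"
    and k1 :: real
  assumes "CARD('n) \<ge> 2"
    and "T > 0"
    and "prob_space M"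
    and "usual_filtration M T F"
    and "\<And>i. brownian_motion M T F (W i)"
    and "\<And>i. (\<lambda>(l, x). h i l x) \<in> borel_measurable borel"
    and "\<And>i. (\<lambda>(l, x). g i l x) \<in> borel_measurable borel"
    and "\<And>i l x. h i l x \<ge> 0"
    and "\<And>i l x. g i l x \<ge> 0"
    and "\<And>i. x0 i > 0"
    and "\<And>i. adapted T F (f i)"
    and "\<And>i \<omega>. \<omega> \<in> space M \<Longrightarrow> continuous_on {0..T} (\<lambda>t. f i t \<omega>)"
    and "\<And>i t \<omega>. \<omega> \<in> space M \<Longrightarrow> t \<in> {0..T} \<Longrightarrow> f i t \<omega> \<ge> 0"
    and "adapted T F L"
    and "\<And>\<omega> j. \<omega> \<in> space M \<Longrightarrow> cadlag_on T (\<lambda>t. L t \<omega> $ j)"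
    and "\<And>i. submodular_cost i (h i)"
    and "\<And>i. submodular_cost i (g i)"
    and "\<And>i. \<exists>H G :: real ^ 'k \<Rightarrow> real \<Rightarrow> real.
           (\<forall>l a. H l a \<ge> 0 \<and> G l a \<ge> 0) \<and>
           (\<forall>l x. h i l x \<le> H l (x $ i) \<and> g i l x \<le> G l (x $ i)) \<and>
           (\<integral>\<^sup>+\<omega>.
              (\<integral>\<^sup>+t\<in>{0..T}. ennreal (H (L t \<omega>) (x0 i * geom_bm (\<mu> i) (\<sigma> i) (W i) t \<omega>)) \<partial>lborel)
              + ennreal (G (L T \<omega>) (x0 i * geom_bm (\<mu> i) (\<sigma> i) (W i) T \<omega>)) \<partial>M) < \<infinity>"
    and "k1 > 0"
    and "\<And>i l x. g i l x \<ge> k1 * (x $ i)"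
  shows "\<exists>\<xi>. open_loop_nash (admissible M T F)
               (expected_cost M T \<mu> \<sigma> x0 W L f h g) \<xi>"
proof -
  interpret prob_space M by fact
  interpret singular_control_game M T F W L f h g \<mu> \<sigma> x0 k1
    using assms by unfold_locales (auto simp: brownian_motion_def)
  show ?thesis by (rule nash_equilibrium_exists)
qed

end
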